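(* For all $0\leq \delta \leq 1$ and $\varepsilon>0$, there exists $n_0$ such that if $G$ is a balanced bipartite graph on $2n\geq 2n_0$ vertices with minimum degree $\delta(G)\geq \delta n$, then in every 2-coloring of the edges of $G$ there exists a monochromatic cycle of order at least $(f(\delta) - \varepsilon) n$, where \[ f(\delta) = \begin{cases} \delta,& \text{for } 0\leq \delta \leq 2/3, \\ 4\delta-2,& \text{for } 2/3\leq \delta\leq 3/4, \\ 1,& \text{for } 3/4\leq \delta\leq 1. \end{cases} \]
   Context: A bipartite graph is balanced if its two parts have equal size (here $n$ each). A 2-coloring of the edges of $G$ means a pair of edge sets $E_R$ (red edges) and $E_B$ (blue edges) with $E(G)=E_R\cup E_B$; it is not required that $E_R\cap E_B=\emptyset$, so an edge may have both colors. A subgraph is monochromatic if all of its edges lie in $E_R$ or all of its edges lie in $E_B$. The order of a cycle is its number of vertices.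
   Formalization: For δ = 0 nothing is claimed: the literal statement fails there, since an edgeless balanced bipartite graph has minimum degree 0 and contains no cycle; for every δ > 0 a genuine monochromatic cycle with at least three vertices is asserted. *)

theory Defs
  imports Complex_Main
begin

type_synonym 'a edge = "'a set"

definition simple_graph :: "'a set \<Rightarrow> 'a edge set \<Rightarrow> bool" where
  "simple_graph V E \<longleftrightarrow> finite V \<and> (\<forall>e\<in>E. e \<subseteq> V \<and> card e = 2)"

definition balanced_bipartite_graph :: "'a set \<Rightarrow> 'a edge set \<Rightarrow> bool" where
  "balanced_bipartite_graph V E \<longleftrightarrow> simple_graph V E \<and>
     (\<exists>X Y. X \<union> Y = V \<and> X \<inter> Y = {} \<and> card X = card Y \<and>
            (\<forall>e\<in>E. \<exists>x\<in>X. \<exists>y\<in>Y. e = {x, y}))"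

definition vertex_degree :: "'a edge set \<Rightarrow> 'a \<Rightarrow> nat" where
  "vertex_degree E v = card {e \<in> E. v \<in> e}"

(* Only meaningful for nonempty finite V. *)
definition min_degree :: "'a set \<Rightarrow> 'a edge set \<Rightarrow> nat" where
  "min_degree V E = Min (vertex_degree E ` V)"

(* The two colour classes may overlap. *)
definition two_coloring :: "'a edge set \<Rightarrow> 'a edge set \<Rightarrow> 'a edge set \<Rightarrow> bool" where
  "two_coloring E E\<^sub>R E\<^sub>B \<longleftrightarrow> E = E\<^sub>R \<union> E\<^sub>B"

(* A cycle is given by the list of its vertices in cyclic order, so its order
   is the length of the list. *)
definition cycle_edges :: "'a list \<Rightarrow> 'a edge set" where
  "cycle_edges C = {{C ! i, C ! (Suc i mod length C)} | i. i < length C}"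

(* Single vertices and single edges do not count as cycles. In particular an edgeless
   graph has no cycle, so with minimum degree bound 0 no cycle can be asserted. *)
definition is_cycle :: "'a edge set \<Rightarrow> 'a list \<Rightarrow> bool" where
  "is_cycle E C \<longleftrightarrow> 3 \<le> length C \<and> distinct C \<and> cycle_edges C \<subseteq> E"

definition monochromatic :: "'a edge set \<Rightarrow> 'a edge set \<Rightarrow> 'a list \<Rightarrow> bool" where
  "monochromatic E\<^sub>R E\<^sub>B C \<longleftrightarrow> cycle_edges C \<subseteq> E\<^sub>R \<or> cycle_edges C \<subseteq> E\<^sub>B"

definition f_bound :: "real \<Rightarrow> real" where
  "f_bound \<delta> = (if \<delta> \<le> 2/3 then \<delta> else if \<delta> \<le> 3/4 then 4 * \<delta> - 2 else 1)"

end

(*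
  A cycle is found without the regularity lemma. A bipartite graph without long cycles falls apart,
  after the deletion of few edges, into parts with small vertex covers: split it along sparse cuts
  into well connected parts; in such a part either most edges have a small vertex cover, or, by
  repeated use of Koenig's theorem on the pairs of dense parts, disjoint copies of K_{t,t} cover many
  vertices, and these copies can be threaded by short paths into one long cycle.

  Applied to both colours, this leaves two partitions of the vertices (red and blue) such that every
  remaining edge lies inside a part of its colour and meets the cover of that part. If all covers are
  smaller than half the minimum degree, then by double counting every vertex lies in both its
  covers, and a vertex has too few neighbours. If they are smaller than min (2 delta - 1, 1/2) n with
  delta > 2/3, then every part misses a lot of both sides; so the pairs (red part, blue part) of the
  vertices of one side lie on two parallel lines of the grid, and the vertices which are uncovered
  in that colour have no room.
*)
theory Submission
  imports Defs
begin

section \<open>Koenig's theorem\<close>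

text \<open>Where \<open>f_bound\<close> comes from: let 2 s be the cycle length in question, so
  that the covers have size about s, and let d be the minimum degree. The half-degree argument rules
  out 2 s \<le> d, which gives f = \<delta>. The grid argument needs s \<le> 2 d - n, which gives f
  = 4 \<delta> - 2. It also needs n - d < s, which on the middle range says 1 - \<delta> < 2
  \<delta> - 1, that is \<delta> > 2/3; and 2 s \<le> n caps f at 1, reached at \<delta> = 3/4. The
  obstacle in building the cycle is that connecting paths may wander through the tiles and use one
  of them up. A tile that has lost many vertices is therefore closed to later paths; each tile side
  then loses only a constant number of vertices, a small fraction of a large tile. Large tiles that
  cover much cannot be found at once: a matching of dense pairs of blocks only yields tiles much
  smaller than the blocks. So the tile size falls from round to round, while the number of covered
  vertices grows by a fixed fraction of n.\<close>

definition vertex_cover :: "('a \<times> 'b) set \<Rightarrow> 'a set \<Rightarrow> 'b set \<Rightarrow> bool" where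
  "vertex_cover R P Q \<longleftrightarrow> finite P \<and> finite Q \<and> (\<forall>(a, b) \<in> R. a \<in> P \<or> b \<in> Q)"

definition is_matching :: "('a \<times> 'b) set \<Rightarrow> bool" where
  "is_matching M \<longleftrightarrow> inj_on fst M \<and> inj_on snd M"

lemma vertex_cover_converse: "vertex_cover R P Q \<Longrightarrow> vertex_cover (R\<inverse>) Q P"
  unfolding vertex_cover_def by auto

text \<open>
  Uncrossing: the union of the covers on one side (with the common vertex x added) goes with their
  intersection on the other side. The two resulting covers of R have total size at most 2 k + 1.
\<close>

lemma vertex_cover_exchange:
  assumes "finite R" "(x, y1) \<in> R" "(x, y2) \<in> R" "y1 \<noteq> y2"
    and c1: "vertex_cover (R - {(x, y1)}) P1 Q1" "card P1 + card Q1 \<le> k"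
    and c2: "vertex_cover (R - {(x, y2)}) P2 Q2" "card P2 + card Q2 \<le> k"
    and x: "x \<notin> P1" "x \<notin> P2"
  shows "\<exists>P Q. vertex_cover R P Q \<and> card P + card Q \<le> k"
proof -
  have fin: "finite P1" "finite Q1" "finite P2" "finite Q2"
    using c1 c2 by (auto simp: vertex_cover_def)
  \<comment> \<open>The pair (x, y1) survives the deletion of (x, y2), and x is not in
    \<open>P2\<close>, so \<open>Q2\<close> has to cover it; the same holds for y2 with
    \<open>Q1\<close>.\<close>
  have y: "y1 \<in> Q2" "y2 \<in> Q1"
    using assms unfolding vertex_cover_def by fastforce+
  let ?A = "insert x (P1 \<union> P2)" and ?AA = "P1 \<inter> P2" and ?B = "Q1 \<union> Q2" and ?BB = "Q1 \<inter> Q2"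
  have cov1: "vertex_cover R ?A ?BB"
    unfolding vertex_cover_def
  proof (intro conjI ballI)
    fix e assume "e \<in> R"
    then show "case e of (a, b) \<Rightarrow> a \<in> ?A \<or> b \<in> ?BB"
      using c1(1) c2(1) unfolding vertex_cover_def by (cases e) fastforce
  qed (use fin in auto)
  have cov2: "vertex_cover R ?AA ?B"
    unfolding vertex_cover_def
  proof (intro conjI ballI)
    fix e assume "e \<in> R"
    then show "case e of (a, b) \<Rightarrow> a \<in> ?AA \<or> b \<in> ?B"
      using c1(1) c2(1) y unfolding vertex_cover_def by (cases e) fastforce
  qed (use fin in auto)
  have "card ?A + card ?AA = card P1 + card P2 + 1"
    using card_Un_Int[OF fin(1,3)] x fin by simp
  moreover have "card ?B + card ?BB = card Q1 + card Q2"
    using card_Un_Int[OF fin(2,4)] by simp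
  ultimately have "(card ?A + card ?BB) + (card ?AA + card ?B) \<le> 2 * k + 1"
    using c1(2) c2(2) by linarith
  then have "card ?A + card ?BB \<le> k \<or> card ?AA + card ?B \<le> k"
    by linarith
  then show ?thesis
    using cov1 cov2 by blast
qed

text \<open>Induction on the number of pairs. If two pairs share an endpoint, each of them is
  deleted in turn. Both smaller relations have a cover no larger than a matching. Either one of the
  covers also covers the pair deleted for it, or the shared endpoint lies in neither cover and
  uncrossing applies. The larger of the two matchings serves in all cases, being a matching inside
  R.\<close>

theorem koenig:
  fixes R :: "('a \<times> 'b) set"
  assumes "finite R"
  shows "\<exists>M P Q. M \<subseteq> R \<and> is_matching M \<and> vertex_cover R P Q \<and> card P + card Q \<le> card M"
  using assms
proof (induction "card R" arbitrary: R rule: less_induct)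
  case less
  show ?case
  proof (cases "is_matching R")
    case True
    have "vertex_cover R (fst ` R) {}"
      using less.prems by (force simp: vertex_cover_def)
    moreover have "card (fst ` R) + card ({} :: 'b set) \<le> card R"
      using less.prems by (simp add: card_image_le)
    ultimately show ?thesis
      using True by blast
  next
    case False
    define good where "good k \<longleftrightarrow> (\<exists>P Q. vertex_cover R P Q \<and> card P + card Q \<le> k)" for k
    have step: "\<exists>M P Q. M \<subseteq> R - {e} \<and> is_matching M \<and> vertex_cover (R - {e}) P Q \<and> card P + card Q \<le> card M"
      if "e \<in> R" for e
    proof -
      have "card (R - {e}) < card R"
        using that less.prems by (rule card_Diff1_less[rotated])
      then show ?thesis
        using less.hyps[of "R - {e}"] less.prems by blast
    qed
    have two: "\<exists>e f. e \<in> R \<and> f \<in> R \<and> e \<noteq> f \<and> (fst e = fst f \<or> snd e = snd f)"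
      using False unfolding is_matching_def inj_on_def by metis
    then obtain e f where ef: "e \<in> R" "f \<in> R" "e \<noteq> f" "fst e = fst f \<or> snd e = snd f"
      by blast
    obtain M1 P1 Q1 where 1: "M1 \<subseteq> R - {e}" "is_matching M1" "vertex_cover (R - {e}) P1 Q1"
        "card P1 + card Q1 \<le> card M1"
      using step[OF ef(1)] by blast
    obtain M2 P2 Q2 where 2: "M2 \<subseteq> R - {f}" "is_matching M2" "vertex_cover (R - {f}) P2 Q2"
        "card P2 + card Q2 \<le> card M2"
      using step[OF ef(2)] by blast
    define k where "k = max (card M1) (card M2)"
    have "good k"
    proof (cases "fst e \<in> P1 \<or> snd e \<in> Q1 \<or> fst f \<in> P2 \<or> snd f \<in> Q2")
      case True
      then have "vertex_cover R P1 Q1 \<or> vertex_cover R P2 Q2"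
        using 1(3) 2(3) unfolding vertex_cover_def by (cases e; cases f) auto
      then show ?thesis
        unfolding good_def k_def using 1(4) 2(4) by (meson max.coboundedI1 max.coboundedI2)
    next
      case no: False
      have k: "card P1 + card Q1 \<le> k" "card P2 + card Q2 \<le> k"
        using 1(4) 2(4) unfolding k_def by auto
      show ?thesis
      proof (cases "fst e = fst f")
        case True
        obtain x y1 y2 where xy: "e = (x, y1)" "f = (x, y2)" "y1 \<noteq> y2"
          using True ef(3) by (metis prod.collapse)
        show ?thesis
          unfolding good_def
          using vertex_cover_exchange[of R x y1 y2 P1 Q1 k P2 Q2] less.prems ef 1(3) 2(3) xy no k by auto
      next
        case False
        then obtain x y1 y2 where xy: "e = (y1, x)" "f = (y2, x)" "y1 \<noteq> y2"
          using ef(3,4) by (metis prod.collapse)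
        have conv: "(R - {(u, v)})\<inverse> = R\<inverse> - {(v, u)}" for u v
          by auto
        have "\<exists>P Q. vertex_cover (R\<inverse>) P Q \<and> card P + card Q \<le> k"
          using vertex_cover_exchange[of "R\<inverse>" x y1 y2 Q1 P1 k Q2 P2] less.prems ef
            vertex_cover_converse[OF 1(3)] vertex_cover_converse[OF 2(3)] xy no k
          by (simp add: conv add.commute)
        then show ?thesis
          unfolding good_def using vertex_cover_converse[of "R\<inverse>"] by (metis add.commute converse_converse)
      qed
    qed
    then obtain P Q where "vertex_cover R P Q" "card P + card Q \<le> max (card M1) (card M2)"
      unfolding good_def k_def by blast
    moreover have "M1 \<subseteq> R" "M2 \<subseteq> R"
      using 1 2 by auto
    ultimately show ?thesis
      using 1(2) 2(2) by (metis max_def)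
  qed
qed

section \<open>Tilings by complete bipartite graphs\<close>

definition tiling :: "('a \<times> 'b) set \<Rightarrow> nat \<Rightarrow> 'a set \<Rightarrow> 'b set \<Rightarrow> ('a set \<times> 'b set) set \<Rightarrow> bool" where
  "tiling D t X Y T \<longleftrightarrow> finite T \<and>
     (\<forall>p\<in>T. fst p \<subseteq> X \<and> snd p \<subseteq> Y \<and> card (fst p) = t \<and> card (snd p) = t \<and> fst p \<times> snd p \<subseteq> D) \<and>
     (\<forall>p\<in>T. \<forall>q\<in>T. p \<noteq> q \<longrightarrow> fst p \<inter> fst q = {} \<and> snd p \<inter> snd q = {})"

definition has_tiling :: "('a \<times> 'b) set \<Rightarrow> nat \<Rightarrow> 'a set \<Rightarrow> 'b set \<Rightarrow> nat \<Rightarrow> bool" where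
  "has_tiling D t X Y c \<longleftrightarrow> (\<exists>T. tiling D t X Y T \<and> card T = c)"

lemma has_tiling_mono:
  "has_tiling D t A B c \<Longrightarrow> A \<subseteq> A' \<Longrightarrow> B \<subseteq> B' \<Longrightarrow> has_tiling D t A' B' c"
proof -
  have "tiling D t A' B' T" if "tiling D t A B T" "A \<subseteq> A'" "B \<subseteq> B'" for T
  proof -
    have "fst p \<subseteq> A' \<and> snd p \<subseteq> B'" if "p \<in> T" for p
      using \<open>tiling D t A B T\<close> \<open>A \<subseteq> A'\<close> \<open>B \<subseteq> B'\<close> that
      unfolding tiling_def by (meson subset_trans)
    then show ?thesis
      using \<open>tiling D t A B T\<close> by (simp add: tiling_def)
  qed
  then show "has_tiling D t A B c \<Longrightarrow> A \<subseteq> A' \<Longrightarrow> B \<subseteq> B' \<Longrightarrow> has_tiling D t A' B' c"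
    unfolding has_tiling_def by blast
qed

lemma has_tiling_0: "has_tiling D t A B 0"
  unfolding has_tiling_def tiling_def by (rule exI[of _ "{}"]) simp

lemma has_tiling_single:
  assumes "card A = t" "card B = t" "A \<times> B \<subseteq> D"
  shows "has_tiling D t A B 1"
  unfolding has_tiling_def tiling_def
  by (rule exI[of _ "{(A, B)}"]) (simp add: assms)

lemma has_tiling_Un:
  assumes "has_tiling D t A1 B1 c1" "has_tiling D t A2 B2 c2"
    and "A1 \<inter> A2 = {}" "B1 \<inter> B2 = {}" "t > 0"
  shows "has_tiling D t (A1 \<union> A2) (B1 \<union> B2) (c1 + c2)"
proof -
  obtain S T where S: "tiling D t A1 B1 S" "card S = c1" and T: "tiling D t A2 B2 T" "card T = c2"
    using assms unfolding has_tiling_def by blast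
  have d: "fst p \<inter> fst q = {} \<and> snd p \<inter> snd q = {}" if "p \<in> S" "q \<in> T" for p q
  proof -
    have "fst p \<subseteq> A1" "snd p \<subseteq> B1" "fst q \<subseteq> A2" "snd q \<subseteq> B2"
      using that S(1) T(1) unfolding tiling_def by auto
    then show ?thesis
      using assms(3,4) by blast
  qed
  \<comment> \<open>Disjoint nonempty tiles are different, so the two families have no tile in
    common and the cardinalities add up.\<close>
  have "fst p \<noteq> {}" if "p \<in> S" for p
    using that S(1) \<open>t > 0\<close> unfolding tiling_def by (metis card.empty less_irrefl)
  then have "S \<inter> T = {}"
    using d by (metis disjoint_iff inf.idem)
  then have "card (S \<union> T) = c1 + c2"
    using S T by (simp add: card_Un_disjoint tiling_def)
  moreover have "tiling D t (A1 \<union> A2) (B1 \<union> B2) (S \<union> T)"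
    unfolding tiling_def
  proof (intro conjI ballI impI)
    fix p q assume "p \<in> S \<union> T" "q \<in> S \<union> T" "p \<noteq> q"
    then have "fst p \<inter> fst q = {} \<and> snd p \<inter> snd q = {}"
    proof (elim UnE)
      assume "p \<in> S" "q \<in> S"
      then show ?thesis
        using S(1) \<open>p \<noteq> q\<close> by (simp add: tiling_def)
    next
      assume "p \<in> T" "q \<in> T"
      then show ?thesis
        using T(1) \<open>p \<noteq> q\<close> by (simp add: tiling_def)
    qed (use d[of p q] d[of q p] in auto)
    then show "fst p \<inter> fst q = {}" "snd p \<inter> snd q = {}"
      by auto
  next
    show "finite (S \<union> T)"
      using S(1) T(1) by (simp add: tiling_def)
  next
    fix p assume "p \<in> S \<union> T"
    then show "fst p \<subseteq> A1 \<union> A2" "snd p \<subseteq> B1 \<union> B2" "card (fst p) = t" "card (snd p) = t"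
        "fst p \<times> snd p \<subseteq> D"
      using S(1) T(1) by (auto simp only: tiling_def)
  qed
  ultimately show ?thesis
    unfolding has_tiling_def by blast
qed

lemma has_tiling_UN:
  assumes "finite I" "t > 0" "\<And>i. i \<in> I \<Longrightarrow> has_tiling D t (A i) (B i) (c i)"
    and "\<And>i j. i \<in> I \<Longrightarrow> j \<in> I \<Longrightarrow> i \<noteq> j \<Longrightarrow> A i \<inter> A j = {} \<and> B i \<inter> B j = {}"
  shows "has_tiling D t (\<Union>i\<in>I. A i) (\<Union>i\<in>I. B i) (\<Sum>i\<in>I. c i)"
  using assms
proof (induction I rule: finite_induct)
  case empty
  then show ?case by (simp add: has_tiling_0)
next
  case (insert i I)
  have "has_tiling D t (A i \<union> (\<Union>i\<in>I. A i)) (B i \<union> (\<Union>i\<in>I. B i)) (c i + (\<Sum>i\<in>I. c i))"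
  proof (rule has_tiling_Un)
    show "A i \<inter> (\<Union>i\<in>I. A i) = {}" "B i \<inter> (\<Union>i\<in>I. B i) = {}"
      using insert.prems(3)[of i] insert.hyps(2) by (simp_all, blast+)
  qed (use insert in auto)
  then show ?case
    using insert.hyps by simp
qed

lemma has_tiling_complete:
  assumes "finite A" "finite B" "c * t \<le> card A" "c * t \<le> card B" "A \<times> B \<subseteq> D" "t > 0"
  shows "has_tiling D t A B c"
  using assms
proof (induction c arbitrary: A B)
  case 0
  then show ?case by (simp add: has_tiling_0)
next
  case (Suc c)
  obtain A' where A': "A' \<subseteq> A" "card A' = t"
    using Suc.prems by (metis add_leD1 mult_Suc obtain_subset_with_card_n)
  obtain B' where B': "B' \<subseteq> B" "card B' = t"
    using Suc.prems by (metis add_leD1 mult_Suc obtain_subset_with_card_n)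
  have fin: "finite A'" "finite B'"
    using A' B' Suc.prems finite_subset by blast+
  have rest: "has_tiling D t (A - A') (B - B') c"
    by (rule Suc.IH) (use Suc.prems A' B' fin in \<open>auto simp: card_Diff_subset\<close>)
  have "has_tiling D t A' B' 1"
    by (rule has_tiling_single) (use Suc.prems A' B' in auto)
  then have "has_tiling D t (A' \<union> (A - A')) (B' \<union> (B - B')) (1 + c)"
    by (rule has_tiling_Un[OF _ rest]) (use Suc.prems in auto)
  moreover have "A' \<union> (A - A') = A" "B' \<union> (B - B') = B"
    using A' B' by auto
  ultimately show ?case by simp
qed

section \<open>Complete bipartite subrelations of dense relations\<close>

lemma card_rel_by_fst:
  assumes "finite A" "finite B"
  shows "card (D \<inter> A \<times> B) = (\<Sum>a\<in>A. card {b\<in>B. (a, b) \<in> D})"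
proof -
  have "D \<inter> A \<times> B = (SIGMA a:A. {b\<in>B. (a, b) \<in> D})"
    by auto
  then show ?thesis
    using assms by simp
qed

lemma card_rel_by_snd:
  assumes "finite A" "finite B"
  shows "card (D \<inter> A \<times> B) = (\<Sum>b\<in>B. card {a\<in>A. (a, b) \<in> D})"
proof -
  have "D\<inverse> \<inter> B \<times> A = prod.swap ` (D \<inter> A \<times> B)"
    by force
  then have "card (D \<inter> A \<times> B) = card (D\<inverse> \<inter> B \<times> A)"
    by (simp add: card_image)
  then show ?thesis
    using card_rel_by_fst[OF assms(2,1), of "D\<inverse>"] by simp
qed

text \<open>Markov's inequality read backwards: terms below h contribute at most h each, so a large
  sum forces many terms of size at least h.\<close>

lemma sum_le_card_ge:
  fixes f :: "'a \<Rightarrow> real" and M h :: real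
  assumes "finite S" "\<And>x. x \<in> S \<Longrightarrow> f x \<le> M" "h \<ge> 0"
  shows "(\<Sum>x\<in>S. f x) \<le> card {x\<in>S. f x \<ge> h} * M + card S * h"
proof -
  have "(\<Sum>x\<in>S. f x) = (\<Sum>x\<in>{x\<in>S. f x \<ge> h}. f x) + (\<Sum>x\<in>S - {x\<in>S. f x \<ge> h}. f x)"
    using sum.subset_diff[of "{x\<in>S. f x \<ge> h}" S f] assms(1) by simp
  also have "(\<Sum>x\<in>{x\<in>S. f x \<ge> h}. f x) \<le> card {x\<in>S. f x \<ge> h} * M"
    using sum_bounded_above[of "{x\<in>S. f x \<ge> h}" f M] assms by simp
  also have "(\<Sum>x\<in>S - {x\<in>S. f x \<ge> h}. f x) \<le> card (S - {x\<in>S. f x \<ge> h}) * h"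
    using sum_bounded_above[of "S - {x\<in>S. f x \<ge> h}" f h] by force
  also have "card (S - {x\<in>S. f x \<ge> h}) * h \<le> card S * h"
    using assms by (intro mult_right_mono) (auto intro: card_mono)
  finally show ?thesis by simp
qed

text \<open>A form of the Kovari-Sos-Turan theorem by pigeonhole. Among a constant number w of
  columns of high degree, many rows have at least s neighbours; there are only 2^w possible
  neighbourhoods there, so s rows share one. The scale t bounds the sizes of A and B only from
  above, so that the lemma still applies after vertices have been removed.\<close>

lemma complete_bipartite_in_dense:
  fixes \<eta> :: real
  assumes "\<eta> > 0"
  shows "\<exists>t0. \<forall>t\<ge>t0. \<forall>(A::'a set) (B::'b set) D. finite A \<and> finite B \<and> card A \<le> t \<and> card B \<le> t \<and>
           real (card (D \<inter> A \<times> B)) \<ge> \<eta> * real t * real t \<longrightarrow>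
           (\<exists>A'\<subseteq>A. \<exists>B'\<subseteq>B. card A' = s \<and> card B' = s \<and> A' \<times> B' \<subseteq> D)"
proof -
  \<comment> \<open>Rows with fewer than s neighbours in the w chosen columns account for at most s
    t pairs. With this w that is at most w \<eta> t / 4, half of the pairs that these columns
    have.\<close>
  define w where "w = nat \<lceil>4 * real s / \<eta>\<rceil> + 1"
  have w: "real w * \<eta> \<ge> 4 * real s" "w > 0"
  proof -
    have "4 * real s / \<eta> \<le> real w"
      unfolding w_def by linarith
    then show "real w * \<eta> \<ge> 4 * real s"
      using assms by (simp add: field_simps)
  qed (simp add: w_def)
  \<comment> \<open>The first term yields w columns of degree at least \<eta> t / 2; the second
    makes the \<eta> t / 4 good rows at least 2^w s in number, for the pigeonhole argument.\<close>
  define t0 where "t0 = nat \<lceil>max (2 * real w / \<eta>) (4 * 2 ^ w * real s / \<eta>)\<rceil> + 1"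
  show ?thesis
  proof (intro exI[of _ t0] allI impI, elim conjE)
    fix t and A :: "'a set" and B :: "'b set" and D
    assume t: "t0 \<le> t" and fin: "finite A" "finite B" and le: "card A \<le> t" "card B \<le> t"
      and dense: "\<eta> * real t * real t \<le> real (card (D \<inter> A \<times> B))"
    have t': "real t \<ge> 2 * real w / \<eta>" "real t \<ge> 4 * 2 ^ w * real s / \<eta>" "t > 0"
      using t unfolding t0_def by linarith+
    then have tw: "\<eta> * t / 2 \<ge> w" and ts: "\<eta> * t / 4 \<ge> 2 ^ w * real s"
      using assms by (simp_all add: field_simps)
    define B1 where "B1 = {b\<in>B. real (card {a\<in>A. (a, b) \<in> D}) \<ge> \<eta> * t / 2}"
    have "\<eta> * real t * real t \<le> (\<Sum>b\<in>B. real (card {a\<in>A. (a, b) \<in> D}))"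
      using dense card_rel_by_snd[OF fin, of D] by simp
    also have "\<dots> \<le> real (card B1) * t + card B * (\<eta> * t / 2)"
      unfolding B1_def
    proof (rule sum_le_card_ge)
      fix b
      have "card {a\<in>A. (a, b) \<in> D} \<le> card A"
        using fin by (intro card_mono) auto
      then show "real (card {a\<in>A. (a, b) \<in> D}) \<le> real t"
        using le by simp
    qed (use fin assms in auto)
    also have "\<dots> \<le> real (card B1) * t + t * (\<eta> * t / 2)"
      using le assms by (intro add_left_mono mult_right_mono) auto
    finally have "\<eta> * t / 2 * t \<le> real (card B1) * t"
      by (simp add: field_simps)
    then have "\<eta> * t / 2 \<le> card B1"
      using t' by simp
    then have "w \<le> card B1"
      using tw by linarith
    then obtain B0 where B0: "B0 \<subseteq> B1" "card B0 = w"
      by (meson obtain_subset_with_card_n)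
    have finB0: "finite B0" "B0 \<subseteq> B"
      using B0 w by (auto simp: B1_def card_ge_0_finite)
    define A1 where "A1 = {a\<in>A. real (card {b\<in>B0. (a, b) \<in> D}) \<ge> s}"
    have "real w * (\<eta> * t / 2) \<le> (\<Sum>b\<in>B0. real (card {a\<in>A. (a, b) \<in> D}))"
      using sum_bounded_below[of B0 "\<eta> * t / 2" "\<lambda>b. real (card {a\<in>A. (a, b) \<in> D})"] B0
      unfolding B1_def by auto
    also have "\<dots> = (\<Sum>a\<in>A. real (card {b\<in>B0. (a, b) \<in> D}))"
      using card_rel_by_snd[OF fin(1) finB0(1), of D] card_rel_by_fst[OF fin(1) finB0(1), of D]
      by (simp flip: of_nat_sum)
    also have "\<dots> \<le> real (card A1) * w + card A * real s"
      unfolding A1_def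
    proof (rule sum_le_card_ge)
      fix a
      have "card {b\<in>B0. (a, b) \<in> D} \<le> card B0"
        using finB0 by (intro card_mono) auto
      then show "real (card {b\<in>B0. (a, b) \<in> D}) \<le> real w"
        using B0 by simp
    qed (use fin in auto)
    also have "\<dots> \<le> real (card A1) * w + t * real s"
      using le by (intro add_left_mono mult_right_mono) auto
    also have "\<dots> \<le> real (card A1) * w + t * (real w * \<eta> / 4)"
      using w by (intro add_left_mono mult_left_mono) auto
    finally have "real w * (\<eta> * t / 4) \<le> real w * card A1"
      by (simp add: field_simps)
    then have A1: "\<eta> * t / 4 \<le> card A1"
      using w by simp
    define g where "g a = {b\<in>B0. (a, b) \<in> D}" for a
    have "\<exists>S\<in>Pow B0. s \<le> card {a\<in>A1. g a = S} \<and> s \<le> card S"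
    proof (rule ccontr)
      assume "\<not> ?thesis"
      then have no: "\<not> (s \<le> card {a\<in>A1. g a = S} \<and> s \<le> card S)" if "S \<in> Pow B0" for S
        using that by blast
      \<comment> \<open>A row in this class belongs to \<open>A1\<close>, so its neighbourhood S has
        at least s elements; by assumption the class then has fewer than s rows.\<close>
      have small: "card {a\<in>A1. g a = S} \<le> s - 1" if "S \<in> Pow B0" for S
      proof (cases "{a\<in>A1. g a = S} = {}")
        case False
        then have "s \<le> card S"
          unfolding A1_def g_def by auto
        then have "\<not> s \<le> card {a\<in>A1. g a = S}"
          using no[OF that] by (simp only: simp_thms)
        then show ?thesis by linarith
      next
        case True
        then show ?thesis by (simp only: card.empty)
      qed
      have "finite A1"
        unfolding A1_def using fin by simp
      have "finite (\<Union>S\<in>Pow B0. {a\<in>A1. g a = S})"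
        by (rule finite_subset[OF _ \<open>finite A1\<close>]) blast
      moreover have "A1 \<subseteq> (\<Union>S\<in>Pow B0. {a\<in>A1. g a = S})"
      proof
        fix a assume "a \<in> A1"
        moreover have "g a \<in> Pow B0"
          unfolding g_def by blast
        ultimately show "a \<in> (\<Union>S\<in>Pow B0. {a\<in>A1. g a = S})"
          by blast
      qed
      ultimately have "card A1 \<le> card (\<Union>S\<in>Pow B0. {a\<in>A1. g a = S})"
        by (rule card_mono)
      also have "\<dots> \<le> (\<Sum>S\<in>Pow B0. card {a\<in>A1. g a = S})"
        using finB0(1) by (intro card_UN_le) simp
      also have "\<dots> \<le> (\<Sum>S\<in>Pow B0. s - 1)"
        by (rule sum_mono) (rule small)
      also have "\<dots> = 2 ^ w * (s - 1)"
        using finB0 B0 by (simp add: card_Pow)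
      finally have "card A1 \<le> 2 ^ w * (s - 1)" .
      moreover have "s > 0"
      proof (rule ccontr)
        assume "\<not> s > 0"
        then show False using no[of "{}"] by simp
      qed
      moreover have "2 ^ w * (s - 1) < 2 ^ w * s"
        using \<open>s > 0\<close> by simp
      ultimately have "card A1 < 2 ^ w * s"
        by linarith
      then have "real (card A1) < real (2 ^ w * s)"
        by (simp only: of_nat_less_iff)
      then have "real (card A1) < 2 ^ w * real s"
        by simp
      then show False
        using A1 ts by linarith
    qed
    then obtain S where S: "S \<subseteq> B0" "s \<le> card {a\<in>A1. g a = S}" "s \<le> card S"
      by auto
    obtain A' where A': "A' \<subseteq> {a\<in>A1. g a = S}" "card A' = s"
      using S by (meson obtain_subset_with_card_n)
    obtain B' where B': "B' \<subseteq> S" "card B' = s"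
      using S by (meson obtain_subset_with_card_n)
    show "\<exists>A'\<subseteq>A. \<exists>B'\<subseteq>B. card A' = s \<and> card B' = s \<and> A' \<times> B' \<subseteq> D"
    proof (intro exI conjI)
      show "A' \<subseteq> A" "B' \<subseteq> B"
        using A' B' S finB0 unfolding A1_def by auto
      show "A' \<times> B' \<subseteq> D"
        using A' B' unfolding g_def by auto
    qed (use A' B' in auto)
  qed
qed

text \<open>Greedy choice: j \<le> g tiles meet at most 2 j s t \<le> (\<eta> / 2) t^2 pairs, so
  half of the density survives and there is another tile. The sets \<open>A'\<close> and
  \<open>B'\<close> consist of exactly the vertices of the g tiles; this limits what the new tiles
  take away from a block.\<close>

lemma dense_has_tiling:
  fixes \<eta> :: real
  assumes "\<eta> > 0" "s > 0"
  shows "\<exists>t0. \<forall>t\<ge>t0. \<forall>(A::'a set) (B::'b set) D g. finite A \<longrightarrow> finite B \<longrightarrow> card A \<le> t \<longrightarrow> card B \<le> t \<longrightarrow>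
           real (card (D \<inter> A \<times> B)) \<ge> \<eta> * real t * real t \<longrightarrow> real (g * s) \<le> \<eta> / 4 * real t \<longrightarrow>
           (\<exists>A'\<subseteq>A. \<exists>B'\<subseteq>B. card A' = g * s \<and> card B' = g * s \<and> has_tiling D s A' B' g)"
proof -
  obtain t0 where t0: "\<And>t A B D. t \<ge> t0 \<Longrightarrow> finite (A::'a set) \<and> finite (B::'b set) \<and> card A \<le> t \<and> card B \<le> t \<and>
      real (card (D \<inter> A \<times> B)) \<ge> \<eta> / 2 * real t * real t \<Longrightarrow>
      (\<exists>A'\<subseteq>A. \<exists>B'\<subseteq>B. card A' = s \<and> card B' = s \<and> A' \<times> B' \<subseteq> D)"
    using complete_bipartite_in_dense[of "\<eta> / 2" s] assms by (metis half_gt_zero)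
  show ?thesis
  proof (intro exI[of _ t0] allI impI)
    fix t and A :: "'a set" and B :: "'b set" and D g
    assume t: "t0 \<le> t" and fin: "finite A" "finite B" and le: "card A \<le> t" "card B \<le> t"
      and dense: "\<eta> * real t * real t \<le> real (card (D \<inter> A \<times> B))"
      and g: "real (g * s) \<le> \<eta> / 4 * real t"
    have "j \<le> g \<Longrightarrow> \<exists>A'\<subseteq>A. \<exists>B'\<subseteq>B. card A' = j * s \<and> card B' = j * s \<and> has_tiling D s A' B' j" for j
    proof (induction j)
      case 0
      show ?case
        by (rule exI[of _ "{}"], simp, rule exI[of _ "{}"]) (simp add: has_tiling_0)
    next
      case (Suc j)
      then obtain A1 B1 where 1: "A1 \<subseteq> A" "B1 \<subseteq> B" "card A1 = j * s" "card B1 = j * s" "has_tiling D s A1 B1 j"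
        by auto
      have fin1: "finite A1" "finite B1"
        using 1 fin finite_subset by blast+
      have js: "real (j * s) \<le> \<eta> / 4 * real t"
      proof -
        have "j * s \<le> g * s"
          using Suc.prems by simp
        then show ?thesis
          using g of_nat_le_iff[of "j * s" "g * s", where ?'a = real] by linarith
      qed
      have "card (D \<inter> A \<times> B) \<le> card ((D \<inter> (A - A1) \<times> (B - B1)) \<union> (A1 \<times> B \<union> A \<times> B1))"
        using fin fin1 by (intro card_mono) auto
      also have "\<dots> \<le> card (D \<inter> (A - A1) \<times> (B - B1)) + (card (A1 \<times> B) + card (A \<times> B1))"
        by (intro order_trans[OF card_Un_le] add_left_mono card_Un_le)
      also have "\<dots> = card (D \<inter> (A - A1) \<times> (B - B1)) + (j * s * card B + card A * (j * s))"
        using 1 by (simp only: card_cartesian_product)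
      also have "\<dots> \<le> card (D \<inter> (A - A1) \<times> (B - B1)) + (j * s * t + t * (j * s))"
        using le by (intro add_left_mono add_mono mult_left_mono mult_right_mono) auto
      finally have "real (card (D \<inter> A \<times> B)) \<le> real (card (D \<inter> (A - A1) \<times> (B - B1)) + (j * s * t + t * (j * s)))"
        by (simp only: of_nat_le_iff)
      then have "real (card (D \<inter> A \<times> B)) \<le> real (card (D \<inter> (A - A1) \<times> (B - B1))) + 2 * real (j * s) * real t"
        by (simp add: algebra_simps)
      moreover have "real (j * s) * real t \<le> \<eta> / 4 * real t * real t"
        using js by (intro mult_right_mono) auto
      ultimately have "\<eta> / 2 * real t * real t \<le> real (card (D \<inter> (A - A1) \<times> (B - B1)))"
        using dense by (simp add: field_simps)
      moreover have "card (A - A1) \<le> t" "card (B - B1) \<le> t"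
        using le fin by (meson Diff_subset card_mono le_trans)+
      ultimately have "\<exists>A'\<subseteq>A - A1. \<exists>B'\<subseteq>B - B1. card A' = s \<and> card B' = s \<and> A' \<times> B' \<subseteq> D"
        using t0[OF t, of "A - A1" "B - B1" D] fin by blast
      then obtain A2 B2 where 2: "A2 \<subseteq> A - A1" "B2 \<subseteq> B - B1" "card A2 = s" "card B2 = s" "A2 \<times> B2 \<subseteq> D"
        by blast
      have fin2: "finite A2" "finite B2"
        using 2 fin by (meson finite_Diff finite_subset)+
      have "has_tiling D s (A1 \<union> A2) (B1 \<union> B2) (j + 1)"
        by (rule has_tiling_Un[OF 1(5) has_tiling_single[OF 2(3-5)]]) (use 2 assms in auto)
      moreover have "card (A1 \<union> A2) = j * s + s"
        using card_Un_disjoint[of A1 A2] 1 2 fin1 fin2 by auto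
      moreover have "card (B1 \<union> B2) = j * s + s"
        using card_Un_disjoint[of B1 B2] 1 2 fin1 fin2 by auto
      ultimately show ?case
        using 1(1,2) 2(1,2) by (intro exI[of _ "A1 \<union> A2"] conjI exI[of _ "B1 \<union> B2"]) auto
    qed
    then show "\<exists>A'\<subseteq>A. \<exists>B'\<subseteq>B. card A' = g * s \<and> card B' = g * s \<and> has_tiling D s A' B' g"
      by blast
  qed
qed

section \<open>Division into blocks and the reduced relation\<close>

definition blocks :: "nat \<Rightarrow> 'a set \<Rightarrow> 'a set set \<Rightarrow> bool" where
  "blocks t X F \<longleftrightarrow> finite F \<and> (\<forall>A\<in>F. A \<subseteq> X \<and> card A = t) \<and> (\<forall>A\<in>F. \<forall>B\<in>F. A \<noteq> B \<longrightarrow> A \<inter> B = {})"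

lemma tiling_blocks:
  assumes "tiling D t X Y T"
  shows "blocks t X (fst ` T)" "blocks t Y (snd ` T)"
proof -
  have t: "finite T" "\<forall>p\<in>T. fst p \<subseteq> X \<and> snd p \<subseteq> Y \<and> card (fst p) = t \<and> card (snd p) = t \<and> fst p \<times> snd p \<subseteq> D"
    and d: "\<forall>p\<in>T. \<forall>q\<in>T. p \<noteq> q \<longrightarrow> fst p \<inter> fst q = {} \<and> snd p \<inter> snd q = {}"
    using assms[unfolded tiling_def] by blast+
  show "blocks t X (fst ` T)"
    unfolding blocks_def
  proof (intro conjI ballI impI)
    fix A B assume "A \<in> fst ` T" "B \<in> fst ` T" "A \<noteq> B"
    then obtain p q where pq: "p \<in> T" "q \<in> T" "A = fst p" "B = fst q" "p \<noteq> q"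
      by auto
    show "A \<inter> B = {}"
      using d[rule_format, OF pq(1,2,5)] pq(3,4) by (simp only:)
  next
    fix A assume "A \<in> fst ` T"
    then show "A \<subseteq> X" "card A = t"
      using t(2) by auto
  qed (use t(1) in simp)
  show "blocks t Y (snd ` T)"
    unfolding blocks_def
  proof (intro conjI ballI impI)
    fix A B assume "A \<in> snd ` T" "B \<in> snd ` T" "A \<noteq> B"
    then obtain p q where pq: "p \<in> T" "q \<in> T" "A = snd p" "B = snd q" "p \<noteq> q"
      by auto
    show "A \<inter> B = {}"
      using d[rule_format, OF pq(1,2,5)] pq(3,4) by (simp only:)
  next
    fix A assume "A \<in> snd ` T"
    then show "A \<subseteq> Y" "card A = t"
      using t(2) by auto
  qed (use t(1) in simp)
qed

lemma card_Union_blocks: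
  assumes "blocks t X F" "finite X"
  shows "card (\<Union>F) = t * card F"
proof -
  have "card (\<Union>F) = (\<Sum>A\<in>F. card A)"
  proof (rule card_Union_disjoint)
    show "pairwise disjnt F"
      using assms unfolding blocks_def pairwise_def disjnt_def by blast
    show "finite A" if "A \<in> F" for A
      using that assms unfolding blocks_def by (meson finite_subset)
  qed
  then show ?thesis
    using assms unfolding blocks_def by simp
qed

text \<open>Greedy completion. Starting from \<open>F0\<close> allows the sides of the tiles of a
  given tiling to be blocks themselves, so that each of them meets at most one pair of a matching of
  blocks.\<close>

lemma extend_blocks:
  assumes "finite X" "t > 0" "blocks t X F0"
  shows "\<exists>F. F0 \<subseteq> F \<and> blocks t X F \<and> card (X - \<Union>F) < t"
  using assms(3)
proof (induction "card (X - \<Union>F0)" arbitrary: F0 rule: less_induct)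
  case less
  show ?case
  proof (cases "card (X - \<Union>F0) < t")
    case True
    then show ?thesis
      using less.prems by blast
  next
    case False
    then obtain A where A: "A \<subseteq> X - \<Union>F0" "card A = t"
      using obtain_subset_with_card_n[of t "X - \<Union>F0"] by (metis not_less)
    have finA: "finite A" "A \<noteq> {}"
      using A assms by (auto simp: card_gt_0_iff intro: card_ge_0_finite)
    have "blocks t X (insert A F0)"
      using less.prems A unfolding blocks_def by blast
    moreover have "card (X - \<Union>(insert A F0)) < card (X - \<Union>F0)"
      using A finA assms by (intro psubset_card_mono) auto
    ultimately obtain F where "insert A F0 \<subseteq> F" "blocks t X F" "card (X - \<Union>F) < t"
      using less.hyps by blast
    then show ?thesis by blast
  qed
qed

text \<open>The linear error term pays for the vertices left over by a division into blocks. In its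
  uses c is a constant, so this term is absorbed by the quadratic one when n is large.\<close>

definition nearly_covered :: "real \<Rightarrow> real \<Rightarrow> ('a \<times> 'b) set \<Rightarrow> 'a set \<Rightarrow> 'b set \<Rightarrow> real \<Rightarrow> bool" where
  "nearly_covered \<epsilon> c D X Y a \<longleftrightarrow> (\<exists>D'\<subseteq>D. \<exists>P\<subseteq>X. \<exists>Q\<subseteq>Y. vertex_cover D' P Q \<and> real (card P + card Q) \<le> a \<and>
     real (card (D - D')) \<le> \<epsilon> * real (card X) * real (card Y) + c * (real (card X) + real (card Y)))"

lemma nearly_covered_mono:
  assumes "nearly_covered \<epsilon> c D X Y a" "c \<le> c'" "a \<le> a'"
  shows "nearly_covered \<epsilon> c' D X Y a'"
proof -
  have "c * (real (card X) + real (card Y)) \<le> c' * (real (card X) + real (card Y))"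
    using assms(2) by (intro mult_right_mono) auto
  then show ?thesis
    using assms(1,3) unfolding nearly_covered_def by (meson add_left_mono order_trans)
qed

text \<open>P and Q cover the reduced relation known from the regularity method: two blocks are
  related when the density between them is at least \<epsilon>. The unions of the covering blocks
  then cover all pairs of D except those at leftover vertices, which give the linear term, and those
  between sparse pairs of blocks, at most \<epsilon> t^2 for each.\<close>

lemma reduced_cover:
  fixes D :: "('a \<times> 'b) set" and \<epsilon> :: real
  assumes fin: "finite X" "finite Y" and D: "D \<subseteq> X \<times> Y" and bl: "blocks t X F" "blocks t Y G"
    and rest: "card (X - \<Union>F) < t" "card (Y - \<Union>G) < t" and "\<epsilon> \<ge> 0"
    and cov: "vertex_cover {(A, B)\<in>F \<times> G. real (card (D \<inter> A \<times> B)) \<ge> \<epsilon> * real t * real t} P Q"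
  shows "nearly_covered \<epsilon> t D X Y ((card P + card Q) * t)"
proof -
  define R where "R = {(A, B)\<in>F \<times> G. real (card (D \<inter> A \<times> B)) \<ge> \<epsilon> * real t * real t}"
  define D' where "D' = {(x, y)\<in>D. \<exists>(A, B)\<in>R. x \<in> A \<and> y \<in> B}"
  define P' where "P' = \<Union>(P \<inter> F)"
  define Q' where "Q' = \<Union>(Q \<inter> G)"
  have finFG: "finite F" "finite G" "finite P" "finite Q"
    using bl cov unfolding blocks_def vertex_cover_def by auto
  have sub: "P' \<subseteq> X" "Q' \<subseteq> Y"
    using bl unfolding P'_def Q'_def blocks_def by auto
  have "vertex_cover D' P' Q'"
    unfolding vertex_cover_def
  proof (intro conjI ballI)
    fix e assume "e \<in> D'"
    then obtain x y A B where e: "e = (x, y)" "(A, B) \<in> R" "x \<in> A" "y \<in> B"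
      unfolding D'_def by auto
    then have "A \<in> P \<or> B \<in> Q" "A \<in> F" "B \<in> G"
      using cov unfolding vertex_cover_def R_def by auto
    then show "case e of (x, y) \<Rightarrow> x \<in> P' \<or> y \<in> Q'"
      using e unfolding P'_def Q'_def by auto
  qed (use sub fin finite_subset in auto)
  moreover have "card P' + card Q' \<le> (card P + card Q) * t"
  proof -
    have "blocks t X (P \<inter> F)" "blocks t Y (Q \<inter> G)"
      using bl unfolding blocks_def by auto
    then have "card P' = t * card (P \<inter> F)" "card Q' = t * card (Q \<inter> G)"
      using card_Union_blocks fin unfolding P'_def Q'_def by blast+
    moreover have "card (P \<inter> F) \<le> card P" "card (Q \<inter> G) \<le> card Q"
      using finFG by (auto intro: card_mono)
    ultimately show ?thesis
      by (simp add: distrib_left mult.commute[of _ t] add_mono)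
  qed
  moreover have "real (card (D - D')) \<le> \<epsilon> * real (card X) * real (card Y) + real t * (real (card X) + real (card Y))"
  proof -
    define S where "S = F \<times> G - R"
    have finS: "finite S"
      unfolding S_def using finFG by simp
    have "D - D' \<subseteq> (X - \<Union>F) \<times> Y \<union> (X \<times> (Y - \<Union>G) \<union> (\<Union>p\<in>S. D \<inter> fst p \<times> snd p))"
    proof
      fix e assume e: "e \<in> D - D'"
      obtain x y where xy: "e = (x, y)" by (cases e)
      have "x \<in> X" "y \<in> Y"
        using e xy D by auto
      moreover have "(A, B) \<in> S" if "x \<in> A" "A \<in> F" "y \<in> B" "B \<in> G" for A B
        using that e xy unfolding S_def D'_def by auto
      ultimately show "e \<in> (X - \<Union>F) \<times> Y \<union> (X \<times> (Y - \<Union>G) \<union> (\<Union>p\<in>S. D \<inter> fst p \<times> snd p))"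
        using e xy by fastforce
    qed
    moreover have "finite (\<Union>p\<in>S. D \<inter> fst p \<times> snd p)"
      using finS D fin by (meson finite_SigmaI finite_UN finite_Int finite_subset)
    ultimately have "card (D - D') \<le> card ((X - \<Union>F) \<times> Y \<union> (X \<times> (Y - \<Union>G) \<union> (\<Union>p\<in>S. D \<inter> fst p \<times> snd p)))"
      using fin by (intro card_mono) auto
    also have "\<dots> \<le> card ((X - \<Union>F) \<times> Y) + (card (X \<times> (Y - \<Union>G)) + card (\<Union>p\<in>S. D \<inter> fst p \<times> snd p))"
      by (intro order_trans[OF card_Un_le] add_left_mono card_Un_le)
    also have "\<dots> \<le> t * card Y + (card X * t + card (\<Union>p\<in>S. D \<inter> fst p \<times> snd p))"
      unfolding card_cartesian_product using rest by (intro add_mono mult_right_mono mult_left_mono) auto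
    finally have "real (card (D - D')) \<le> real (t * card Y + (card X * t + card (\<Union>p\<in>S. D \<inter> fst p \<times> snd p)))"
      by (simp only: of_nat_le_iff)
    then have 1: "real (card (D - D')) \<le> real t * (real (card X) + real (card Y)) + real (card (\<Union>p\<in>S. D \<inter> fst p \<times> snd p))"
      by (simp add: algebra_simps)
    have "card (\<Union>p\<in>S. D \<inter> fst p \<times> snd p) \<le> (\<Sum>p\<in>S. card (D \<inter> fst p \<times> snd p))"
      using finS by (rule card_UN_le)
    then have "real (card (\<Union>p\<in>S. D \<inter> fst p \<times> snd p)) \<le> real (\<Sum>p\<in>S. card (D \<inter> fst p \<times> snd p))"
      by (simp only: of_nat_le_iff)
    also have "\<dots> = (\<Sum>p\<in>S. real (card (D \<inter> fst p \<times> snd p)))"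
      by simp
    also have "\<dots> \<le> (\<Sum>p\<in>S. \<epsilon> * real t * real t)"
      by (rule sum_mono) (auto simp: S_def R_def)
    also have "\<dots> = real (card S) * (\<epsilon> * real t * real t)"
      by simp
    also have "\<dots> \<le> real (card (F \<times> G)) * (\<epsilon> * real t * real t)"
    proof (rule mult_right_mono)
      have "card S \<le> card (F \<times> G)"
        using finFG unfolding S_def by (intro card_mono) auto
      then show "real (card S) \<le> real (card (F \<times> G))"
        by (simp only: of_nat_le_iff)
    qed (use \<open>\<epsilon> \<ge> 0\<close> in simp)
    also have "\<dots> = \<epsilon> * real (t * card F) * real (t * card G)"
      by (simp add: card_cartesian_product)
    also have "\<dots> = \<epsilon> * real (card (\<Union>F)) * real (card (\<Union>G))"
      using card_Union_blocks bl fin by metis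
    also have "\<dots> \<le> \<epsilon> * real (card X) * real (card Y)"
    proof -
      have "\<Union>F \<subseteq> X" "\<Union>G \<subseteq> Y"
        using bl unfolding blocks_def by auto
      then have "card (\<Union>F) \<le> card X" "card (\<Union>G) \<le> card Y"
        using fin by (auto intro: card_mono)
      then show ?thesis
        using \<open>\<epsilon> \<ge> 0\<close> by (intro mult_mono) auto
    qed
    finally show ?thesis
      using 1 by linarith
  qed
  moreover have "D' \<subseteq> D"
    unfolding D'_def by auto
  ultimately show ?thesis
    using sub unfolding nearly_covered_def of_nat_le_iff by blast
qed

text \<open>
  Every block meets at most one pair of the matching, so after the removal of the new tiles an old
  tile still has room for (c - 1) g tiles.
\<close>

lemma retile:
  assumes fin: "finite X" "finite Y" and T: "tiling D t X Y T" and t: "t = c * g * s" "s > 0"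
    and bl: "blocks t X F" "blocks t Y G" and FG: "fst ` T \<subseteq> F" "snd ` T \<subseteq> G"
    and M: "M \<subseteq> F \<times> G" "is_matching M"
    and tile: "\<And>p. p \<in> M \<Longrightarrow> \<exists>A'\<subseteq>fst p. \<exists>B'\<subseteq>snd p. card A' = g * s \<and> card B' = g * s \<and> has_tiling D s A' B' g"
  shows "has_tiling D s X Y (card M * g + card T * ((c - 1) * g))"
proof -
  have finM: "finite M" "finite T"
    using M bl T finite_subset[of M "F \<times> G"] unfolding blocks_def tiling_def by auto
  obtain U V where UV: "\<And>p. p \<in> M \<Longrightarrow> U p \<subseteq> fst p \<and> V p \<subseteq> snd p \<and> card (U p) = g * s \<and> card (V p) = g * s \<and> has_tiling D s (U p) (V p) g"
    using tile by metis
  have FX: "A \<subseteq> X" "card A = t" if "A \<in> F" for A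
    using bl(1) that unfolding blocks_def by auto
  have GY: "B \<subseteq> Y" "card B = t" if "B \<in> G" for B
    using bl(2) that unfolding blocks_def by auto
  have disjF: "A \<inter> A' = {}" if "A \<in> F" "A' \<in> F" "A \<noteq> A'" for A A'
    using bl(1) that unfolding blocks_def by auto
  have disjG: "A \<inter> A' = {}" if "A \<in> G" "A' \<in> G" "A \<noteq> A'" for A A'
    using bl(2) that unfolding blocks_def by auto
  have Mfst: "fst p \<in> F" "snd p \<in> G" if "p \<in> M" for p
    using M(1) that by auto
  have inj: "fst p \<noteq> fst q" "snd p \<noteq> snd q" if "p \<in> M" "q \<in> M" "p \<noteq> q" for p q
    using M(2) that unfolding is_matching_def inj_on_def by auto
  define UX where "UX = (\<Union>p\<in>M. U p)"
  define VY where "VY = (\<Union>p\<in>M. V p)"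
  have new: "has_tiling D s UX VY (\<Sum>p\<in>M. g)"
    unfolding UX_def VY_def
  proof (rule has_tiling_UN)
    fix p q assume pq: "p \<in> M" "q \<in> M" "p \<noteq> q"
    then have "fst p \<inter> fst q = {}" "snd p \<inter> snd q = {}"
      using disjF disjG Mfst inj by auto
    then show "U p \<inter> U q = {} \<and> V p \<inter> V q = {}"
      using UV[OF pq(1)] UV[OF pq(2)] by blast
  qed (use finM t UV in auto)
  have smallX: "card (A \<inter> UX) \<le> g * s" if A: "A \<in> F" for A
  proof (cases "\<exists>p\<in>M. fst p = A")
    case True
    then obtain p where p: "p \<in> M" "fst p = A" by auto
    have "A \<inter> U q = {}" if "q \<in> M" "q \<noteq> p" for q
      using disjF[OF A Mfst(1)[OF that(1)]] inj(1)[OF p(1) that(1)] that UV[OF that(1)] p by blast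
    then have "A \<inter> UX \<subseteq> U p"
      unfolding UX_def by blast
    moreover have "finite (U p)"
      using UV[OF p(1)] p A FX(1)[OF A] fin by (metis finite_subset)
    ultimately show ?thesis
      using UV[OF p(1)] by (metis card_mono)
  next
    case False
    have "A \<inter> U q = {}" if "q \<in> M" for q
      using disjF[OF A Mfst(1)[OF that(1)]] False that UV[OF that(1)] by blast
    then have "A \<inter> UX = {}"
      unfolding UX_def by blast
    then show ?thesis by simp
  qed
  have smallY: "card (B \<inter> VY) \<le> g * s" if B: "B \<in> G" for B
  proof (cases "\<exists>p\<in>M. snd p = B")
    case True
    then obtain p where p: "p \<in> M" "snd p = B" by auto
    have "B \<inter> V q = {}" if "q \<in> M" "q \<noteq> p" for q
      using disjG[OF B Mfst(2)[OF that(1)]] inj(2)[OF p(1) that(1)] that UV[OF that(1)] p by blast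
    then have "B \<inter> VY \<subseteq> V p"
      unfolding VY_def by blast
    moreover have "finite (V p)"
      using UV[OF p(1)] p B GY(1)[OF B] fin by (metis finite_subset)
    ultimately show ?thesis
      using UV[OF p(1)] by (metis card_mono)
  next
    case False
    have "B \<inter> V q = {}" if "q \<in> M" for q
      using disjG[OF B Mfst(2)[OF that(1)]] False that UV[OF that(1)] by blast
    then have "B \<inter> VY = {}"
      unfolding VY_def by blast
    then show ?thesis by simp
  qed
  have old: "has_tiling D s (\<Union>q\<in>T. fst q - UX) (\<Union>q\<in>T. snd q - VY) (\<Sum>q\<in>T. (c - 1) * g)"
  proof (rule has_tiling_UN)
    fix q assume q: "q \<in> T"
    have qF: "fst q \<in> F" "snd q \<in> G"
      using FG q by auto
    have finq: "finite (fst q)" "finite (snd q)"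
      using FX(1)[OF qF(1)] GY(1)[OF qF(2)] fin finite_subset by blast+
    show "has_tiling D s (fst q - UX) (snd q - VY) ((c - 1) * g)"
    proof (rule has_tiling_complete)
      show "(c - 1) * g * s \<le> card (fst q - UX)"
        using smallX[OF qF(1)] FX(2)[OF qF(1)] finq(1) t
        by (simp add: card_Diff_subset_Int diff_mult_distrib)
      show "(c - 1) * g * s \<le> card (snd q - VY)"
        using smallY[OF qF(2)] GY(2)[OF qF(2)] finq(2) t
        by (simp add: card_Diff_subset_Int diff_mult_distrib)
      have "fst q \<times> snd q \<subseteq> D"
        using T q unfolding tiling_def by blast
      then show "(fst q - UX) \<times> (snd q - VY) \<subseteq> D"
        by blast
    qed (use finq t in auto)
  next
    fix p q assume "p \<in> T" "q \<in> T" "p \<noteq> q"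
    then have "fst p \<inter> fst q = {} \<and> snd p \<inter> snd q = {}"
      using T unfolding tiling_def by blast
    then show "(fst p - UX) \<inter> (fst q - UX) = {} \<and> (snd p - VY) \<inter> (snd q - VY) = {}"
      by blast
  qed (use finM t in auto)
  have "has_tiling D s (UX \<union> (\<Union>q\<in>T. fst q - UX)) (VY \<union> (\<Union>q\<in>T. snd q - VY))
      ((\<Sum>p\<in>M. g) + (\<Sum>q\<in>T. (c - 1) * g))"
    by (rule has_tiling_Un[OF new old]) (use t in auto)
  then have "has_tiling D s X Y ((\<Sum>p\<in>M. g) + (\<Sum>q\<in>T. (c - 1) * g))"
  proof (rule has_tiling_mono)
    have "fst p \<subseteq> X" "snd p \<subseteq> Y" if "p \<in> T" for p
      using T that unfolding tiling_def by auto
    moreover have "U p \<subseteq> X" "V p \<subseteq> Y" if "p \<in> M" for p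
      using UV[OF that] FX(1) GY(1) Mfst[OF that] by blast+
    ultimately show "UX \<union> (\<Union>q\<in>T. fst q - UX) \<subseteq> X" "VY \<union> (\<Union>q\<in>T. snd q - VY) \<subseteq> Y"
      unfolding UX_def VY_def by blast+
  qed
  then show ?thesis by simp
qed

text \<open>One round: both sides are divided into blocks of size t that include the old tiles, and
  Koenig's theorem is applied to the reduced relation. A matching of m dense pairs supplies smaller
  tiles, and the cover of the same size nearly covers D. The equation says that the number of tiled
  vertices per side becomes the mean of k t and m t with weights 1 - 1/c and 1/c. The bound on c
  does not involve s, so the gain of a round does not depend on the size of the tiles.\<close>

lemma tiling_step:
  fixes \<epsilon> :: real
  assumes "\<epsilon> > 0" "s > 0"
  shows "\<exists>t c. t > 0 \<and> s dvd t \<and> c > 0 \<and> real c \<le> 4 / \<epsilon> + 2 \<and>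
    (\<forall>(X::'a set) (Y::'b set) D k. finite X \<longrightarrow> finite Y \<longrightarrow> D \<subseteq> X \<times> Y \<longrightarrow> has_tiling D t X Y k \<longrightarrow>
      (\<exists>m k'. has_tiling D s X Y k' \<and> k' * s * c = k * t * (c - 1) + m * t \<and> nearly_covered \<epsilon> t D X Y (m * t)))"
proof -
  obtain t0 where t0: "\<And>t (A::'a set) (B::'b set) D g. t \<ge> t0 \<Longrightarrow> finite A \<Longrightarrow> finite B \<Longrightarrow> card A \<le> t \<Longrightarrow> card B \<le> t \<Longrightarrow>
      real (card (D \<inter> A \<times> B)) \<ge> \<epsilon> * real t * real t \<Longrightarrow> real (g * s) \<le> \<epsilon> / 4 * real t \<Longrightarrow>
      (\<exists>A'\<subseteq>A. \<exists>B'\<subseteq>B. card A' = g * s \<and> card B' = g * s \<and> has_tiling D s A' B' g)"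
    using dense_has_tiling[OF assms, where ?'a = 'a and ?'b = 'b] by metis
  \<comment> \<open>With t = c g s this c gives g s \<le> (\<epsilon> / 4) t, the room needed for g
    tiles in a dense pair of blocks; g is only there to make t at least \<open>t0\<close>.\<close>
  define c where "c = nat \<lceil>4 / \<epsilon>\<rceil> + 1"
  define g where "g = t0 + 1"
  define t where "t = c * g * s"
  have c: "c > 0" "real c \<ge> 4 / \<epsilon>"
    unfolding c_def by linarith+
  have cle: "real c \<le> 4 / \<epsilon> + 2"
    unfolding c_def using assms(1) by (simp, linarith)
  have t: "t > 0" "t \<ge> t0"
  proof -
    have "t0 \<le> g"
      unfolding g_def by simp
    moreover have "g \<le> c * g" "c * g \<le> t"
      unfolding t_def using c(1) assms by auto
    ultimately show "t \<ge> t0" by linarith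
  qed (use c(1) assms in \<open>simp add: t_def g_def\<close>)
  have gs: "real (g * s) \<le> \<epsilon> / 4 * real t"
  proof -
    have "1 \<le> \<epsilon> / 4 * real c"
      using c(2) assms(1) by (simp add: field_simps)
    then have "1 * real (g * s) \<le> \<epsilon> / 4 * real c * real (g * s)"
      by (rule mult_right_mono) simp
    then show ?thesis
      unfolding t_def by (simp add: mult.assoc)
  qed
  show ?thesis
  proof (rule exI[of _ t], rule exI[of _ c], intro conjI allI impI)
    show "s dvd t"
      unfolding t_def by simp
    fix X :: "'a set" and Y :: "'b set" and D k
    assume fin: "finite X" "finite Y" and D: "D \<subseteq> X \<times> Y" and "has_tiling D t X Y k"
    then obtain T where T: "tiling D t X Y T" "card T = k"
      unfolding has_tiling_def by blast
    obtain F G where F: "fst ` T \<subseteq> F" "blocks t X F" "card (X - \<Union>F) < t"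
      and G: "snd ` T \<subseteq> G" "blocks t Y G" "card (Y - \<Union>G) < t"
      using extend_blocks[OF fin(1) t(1) tiling_blocks(1)[OF T(1)]]
        extend_blocks[OF fin(2) t(1) tiling_blocks(2)[OF T(1)]] by meson
    define R where "R = {(A, B)\<in>F \<times> G. real (card (D \<inter> A \<times> B)) \<ge> \<epsilon> * real t * real t}"
    have "finite R"
    proof (rule finite_subset[of _ "F \<times> G"])
      have "finite F" "finite G"
        using F(2) G(2) unfolding blocks_def by blast+
      then show "finite (F \<times> G)"
        by simp
    qed (auto simp: R_def)
    from koenig[OF this] obtain M P Q where M: "M \<subseteq> R" "is_matching M"
      and PQ: "vertex_cover R P Q" "card P + card Q \<le> card M"
      by blast
    have "has_tiling D s X Y (card M * g + card T * ((c - 1) * g))"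
    proof (rule retile[OF fin T(1) t_def assms(2) F(2) G(2) F(1) G(1) _ M(2)])
      show "M \<subseteq> F \<times> G"
        using M(1) unfolding R_def by auto
      fix p assume "p \<in> M"
      then have p: "fst p \<in> F" "snd p \<in> G" "\<epsilon> * real t * real t \<le> real (card (D \<inter> fst p \<times> snd p))"
        using M(1) unfolding R_def by auto
      then have "card (fst p) = t" "card (snd p) = t"
        using F(2) G(2) unfolding blocks_def by auto
      then show "\<exists>A'\<subseteq>fst p. \<exists>B'\<subseteq>snd p. card A' = g * s \<and> card B' = g * s \<and> has_tiling D s A' B' g"
        using t0[OF t(2), of "fst p" "snd p" D g] p gs t(1) by (simp add: card_ge_0_finite)
    qed
    moreover have "(card M * g + card T * ((c - 1) * g)) * s * c = k * t * (c - 1) + card M * t"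
      unfolding t_def T(2) by (simp add: algebra_simps)
    moreover have "nearly_covered \<epsilon> t D X Y (card M * t)"
    proof (rule nearly_covered_mono)
      show "nearly_covered \<epsilon> t D X Y ((card P + card Q) * t)"
        by (rule reduced_cover[OF fin D F(2) G(2) F(3) G(3) _ PQ(1)[unfolded R_def]]) (use assms(1) in simp)
      have "(card P + card Q) * t \<le> card M * t"
        using PQ(2) by simp
      then show "real ((card P + card Q) * t) \<le> real (card M * t)"
        by (simp only: of_nat_le_iff)
    qed simp
    ultimately show "\<exists>m k'. has_tiling D s X Y k' \<and> k' * s * c = k * t * (c - 1) + m * t \<and> nearly_covered \<epsilon> t D X Y (m * t)"
      by blast
  qed (use t c cle in auto)
qed

lemma card_tiling_le:
  assumes "finite X" "has_tiling D t X Y k"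
  shows "k * t \<le> card X"
proof -
  obtain T where T: "tiling D t X Y T" "card T = k"
    using assms unfolding has_tiling_def by blast
  show ?thesis
  proof (cases "t = 0")
    case False
    have "inj_on fst T"
      using T(1) False unfolding tiling_def inj_on_def by (metis card.empty inf.idem)
    moreover have "blocks t X (fst ` T)"
      using tiling_blocks[OF T(1)] by simp
    ultimately have "card (\<Union>(fst ` T)) = t * k"
      using card_Union_blocks assms(1) T(2) by (metis card_image)
    moreover have "\<Union>(fst ` T) \<subseteq> X"
      using T(1) unfolding tiling_def by auto
    ultimately show ?thesis
      using assms(1) by (metis card_mono mult.commute)
  qed simp
qed

text \<open>Induction on j with s arbitrary, because one round produces tiles of size s from a
  tiling with larger tiles. Let u = k t be the number of vertices per side in the old tiles and v =
  m t. If v \<le> r + \<epsilon> N, the cover is small enough. Otherwise the weighted mean of u and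
  v stays above r if u \<ge> r, and if u < r it exceeds u by at least \<epsilon> N / c, which is at
  least \<epsilon> N / (4 / \<epsilon> + 2).\<close>

lemma tiling_iterate:
  fixes \<epsilon> :: real and j s :: nat
  assumes "\<epsilon> > 0" "s > 0"
  shows "\<exists>C::nat. \<forall>(X::'a set) (Y::'b set) D N r. finite X \<longrightarrow> finite Y \<longrightarrow> D \<subseteq> X \<times> Y \<longrightarrow> N \<ge> 0 \<longrightarrow>
     (\<exists>k. has_tiling D s X Y k \<and> (real (k * s) \<ge> r \<or> real (k * s) \<ge> real j * (\<epsilon> / (4 / \<epsilon> + 2)) * N)) \<or>
     nearly_covered \<epsilon> C D X Y (r + \<epsilon> * N)"
  using assms(2)
proof (induction j arbitrary: s)
  case 0
  show ?case
    by (intro exI[of _ 0] allI impI disjI1 exI[of _ "0::nat"]) (simp add: has_tiling_0)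
next
  case (Suc j)
  define \<gamma> where "\<gamma> = \<epsilon> / (4 / \<epsilon> + 2)"
  obtain t c :: nat where tc: "t > 0" "c > 0" "real c \<le> 4 / \<epsilon> + 2" and
    step: "\<And>(X::'a set) (Y::'b set) D k. finite X \<Longrightarrow> finite Y \<Longrightarrow> D \<subseteq> X \<times> Y \<Longrightarrow> has_tiling D t X Y k \<Longrightarrow>
      (\<exists>m k'. has_tiling D s X Y k' \<and> k' * s * c = k * t * (c - 1) + m * t \<and> nearly_covered \<epsilon> t D X Y (m * t))"
    using tiling_step[OF assms(1) Suc.prems, where ?'a = 'a and ?'b = 'b] by metis
  obtain C :: nat where C: "\<And>(X::'a set) (Y::'b set) D N r. finite X \<Longrightarrow> finite Y \<Longrightarrow> D \<subseteq> X \<times> Y \<Longrightarrow> N \<ge> 0 \<Longrightarrow>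
     (\<exists>k. has_tiling D t X Y k \<and> (real (k * t) \<ge> r \<or> real (k * t) \<ge> real j * \<gamma> * N)) \<or>
     nearly_covered \<epsilon> C D X Y (r + \<epsilon> * N)"
    using Suc.IH[OF tc(1)] unfolding \<gamma>_def by metis
  show ?case
  proof (intro exI[of _ "max C t"] allI impI)
    fix X :: "'a set" and Y :: "'b set" and D N r
    assume fin: "finite X" "finite Y" and D: "D \<subseteq> X \<times> Y" and N: "(0::real) \<le> N"
    let ?tile = "\<exists>k. has_tiling D s X Y k \<and> (r \<le> real (k * s) \<or> real (Suc j) * (\<epsilon> / (4 / \<epsilon> + 2)) * N \<le> real (k * s))"
    let ?cover = "\<lambda>C :: nat. nearly_covered \<epsilon> C D X Y (r + \<epsilon> * N)"
    from C[OF fin D N, of r] show "?tile \<or> ?cover (max C t)"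
    proof
      assume "?cover C"
      then have "?cover (max C t)"
        by (rule nearly_covered_mono) simp_all
      then show ?thesis ..
    next
      assume "\<exists>k. has_tiling D t X Y k \<and> (r \<le> real (k * t) \<or> real j * \<gamma> * N \<le> real (k * t))"
      then obtain k where k: "has_tiling D t X Y k" "r \<le> real (k * t) \<or> real j * \<gamma> * N \<le> real (k * t)"
        by blast
      obtain m k' where k': "has_tiling D s X Y k'" "k' * s * c = k * t * (c - 1) + m * t"
        and cov: "nearly_covered \<epsilon> t D X Y (m * t)"
        using step[OF fin D k(1)] by blast
      show ?thesis
      proof (cases "real (m * t) \<le> r + \<epsilon> * N")
        case True
        from cov have "?cover (max C t)"
          by (rule nearly_covered_mono) (use True in simp_all)
        then show ?thesis ..
      next
        case False
        define u where "u = real (k * t)"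
        define v where "v = real (m * t)"
        have "real (k' * s * c) = real (k * t * (c - 1) + m * t)"
          using k'(2) by simp
        then have eq: "real (k' * s) * c = u * (real c - 1) + v"
          using tc(2) unfolding u_def v_def by (simp add: of_nat_diff)
        have v: "v > r + \<epsilon> * N"
          using False unfolding v_def by simp
        have eN: "\<epsilon> * N \<ge> 0"
          using assms(1) N by simp
        have "r \<le> real (k' * s) \<or> real (Suc j) * \<gamma> * N \<le> real (k' * s)"
        proof (cases "r \<le> u")
          case True
          have "r * c = r * (real c - 1) + r"
            by (simp add: algebra_simps)
          also have "\<dots> \<le> u * (real c - 1) + v"
            using True v eN tc(2) by (intro add_mono mult_right_mono) auto
          finally have "r * c \<le> real (k' * s) * c"
            using eq by simp
          then have "r \<le> real (k' * s)"
            using tc(2) by simp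
          then show ?thesis by simp
        next
          case False
          then have u: "real j * \<gamma> * N \<le> u"
            using k(2) unfolding u_def by blast
          have "\<gamma> * N * c \<le> \<gamma> * N * (4 / \<epsilon> + 2)"
            using tc(3) N assms(1) unfolding \<gamma>_def by (intro mult_left_mono) auto
          also have "\<dots> = \<epsilon> * N"
          proof -
            have "4 / \<epsilon> + 2 > 0"
              using assms(1) by (simp add: add_pos_pos)
            then show ?thesis
              unfolding \<gamma>_def by simp
          qed
          also have "\<dots> \<le> v - u"
            using v False by simp
          finally have "\<gamma> * N * c \<le> v - u" .
          moreover have "real j * \<gamma> * N * c \<le> u * c"
            using u tc(2) by (intro mult_right_mono) auto
          ultimately have "(real j * \<gamma> * N + \<gamma> * N) * c \<le> u * c + (v - u)"
            by (simp add: distrib_right)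
          also have "\<dots> = real (k' * s) * c"
            using eq by (simp add: algebra_simps)
          finally have "real j * \<gamma> * N + \<gamma> * N \<le> real (k' * s)"
            using tc(2) by simp
          then show ?thesis
            by (simp add: algebra_simps)
        qed
        then show ?thesis
          using k'(1) unfolding \<gamma>_def by blast
      qed
    qed
  qed
qed

text \<open>After about 2 / \<gamma> rounds the second alternative of the iteration would tile 2 N
  vertices of X, more than there are.\<close>

lemma tiling_or_cover:
  fixes \<epsilon> :: real
  assumes "\<epsilon> > 0" "s > 0"
  shows "\<exists>C::nat. \<forall>(X::'a set) (Y::'b set) D N r. finite X \<longrightarrow> finite Y \<longrightarrow> D \<subseteq> X \<times> Y \<longrightarrow> real (card X) \<le> N \<longrightarrow> r > 0 \<longrightarrow>
     (\<exists>k. has_tiling D s X Y k \<and> real (k * s) \<ge> r) \<or>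
     nearly_covered \<epsilon> C D X Y (r + \<epsilon> * N)"
proof -
  define \<gamma> where "\<gamma> = \<epsilon> / (4 / \<epsilon> + 2)"
  have \<gamma>: "\<gamma> > 0"
    unfolding \<gamma>_def using assms(1) by (simp add: add_pos_pos)
  define j where "j = nat \<lceil>2 / \<gamma>\<rceil>"
  have "2 / \<gamma> \<le> real j"
    unfolding j_def by linarith
  then have j: "real j * \<gamma> \<ge> 2"
    using \<gamma> by (simp add: field_simps)
  obtain C :: nat where C: "\<And>(X::'a set) (Y::'b set) D N r. finite X \<Longrightarrow> finite Y \<Longrightarrow> D \<subseteq> X \<times> Y \<Longrightarrow> N \<ge> 0 \<Longrightarrow>
     (\<exists>k. has_tiling D s X Y k \<and> (real (k * s) \<ge> r \<or> real (k * s) \<ge> real j * \<gamma> * N)) \<or>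
     nearly_covered \<epsilon> C D X Y (r + \<epsilon> * N)"
    using tiling_iterate[OF assms, where ?'a = 'a and ?'b = 'b and j = j] unfolding \<gamma>_def by metis
  show ?thesis
  proof (intro exI[of _ C] allI impI)
    fix X :: "'a set" and Y :: "'b set" and D N r
    assume fin: "finite X" "finite Y" and D: "D \<subseteq> X \<times> Y" and N: "real (card X) \<le> N" and r: "(0::real) < r"
    let ?tile = "\<exists>k. has_tiling D s X Y k \<and> r \<le> real (k * s)"
    let ?cover = "nearly_covered \<epsilon> C D X Y (r + \<epsilon> * N)"
    show "?tile \<or> ?cover"
    \<comment> \<open>For N = 0 the count 2 N is not out of reach, but then X and hence D are
      empty.\<close>
    proof (cases "N = 0")
      case True
      then have "X = {}"
        using N fin by simp
      then have D0: "D = {}"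
        using D by simp
      have "vertex_cover D {} {}"
        by (simp add: D0 vertex_cover_def)
      moreover have "0 \<le> \<epsilon> * real (card X) * real (card Y) + real C * (real (card X) + real (card Y))"
        using assms(1) by simp
      ultimately have "vertex_cover D {} {} \<and> real (card ({} :: 'a set) + card ({} :: 'b set)) \<le> r + \<epsilon> * N \<and>
          real (card (D - D)) \<le> \<epsilon> * real (card X) * real (card Y) + real C * (real (card X) + real (card Y))"
        using r True by simp
      then have "?cover"
        unfolding nearly_covered_def by (meson empty_subsetI order_refl)
      then show ?thesis ..
    next
      case False
      have "N > 0"
        using False N of_nat_0_le_iff[of "card X", where ?'a = real] by linarith
      have "\<not> real j * \<gamma> * N \<le> real (k * s)" if "has_tiling D s X Y k" for k
      proof -
        have "real (k * s) \<le> N"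
          using card_tiling_le[OF fin(1) that] N by (meson of_nat_mono order_trans)
        moreover have "2 * N \<le> real j * \<gamma> * N"
          using j \<open>N > 0\<close> by (intro mult_right_mono) auto
        ultimately show ?thesis
          using \<open>N > 0\<close> by linarith
      qed
      then show ?thesis
        using C[OF fin D less_imp_le[OF \<open>N > 0\<close>], of r] by blast
    qed
  qed
qed

section \<open>Well connected parts\<close>

text \<open>Cuts are compared with those of the complete graph. This form fits the extremal choice
  of a partition, in which sparse cuts are paid for by crossing pairs; for S a single vertex it is a
  minimum degree condition.\<close>

definition well_connected :: "real \<Rightarrow> 'a set \<Rightarrow> ('a \<times> 'a) set \<Rightarrow> bool" where
  "well_connected \<gamma> V G \<longleftrightarrow> (\<forall>S\<subseteq>V. \<gamma> * real (card S) * real (card (V - S)) \<le> real (card (G \<inter> S \<times> (V - S))))"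

text \<open>
  Among the partitions with few crossing edges take one with the most crossing pairs: a part
  with a sparse cut could be split further.
\<close>

lemma well_connected_partition:
  assumes V: "finite V" "G \<subseteq> V \<times> V" "sym G"
  shows "\<exists>\<rho>::'a \<Rightarrow> nat. real (card {(u, v)\<in>G. \<rho> u \<noteq> \<rho> v}) \<le> \<gamma> * real (card {(u, v)\<in>V \<times> V. \<rho> u \<noteq> \<rho> v}) \<and>
           (\<forall>i. well_connected \<gamma> {v\<in>V. \<rho> v = i} G)"
proof -
  define cross where "cross A \<rho> = {(u, v)\<in>A. \<rho> u \<noteq> \<rho> v}" for A :: "('a \<times> 'a) set" and \<rho> :: "'a \<Rightarrow> nat"
  define ok where "ok \<rho> \<longleftrightarrow> real (card (cross G \<rho>)) \<le> \<gamma> * real (card (cross (V \<times> V) \<rho>))" for \<rho>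
  have finVV: "finite (V \<times> V)"
    using V by simp
  have "ok (\<lambda>_. 0)"
    unfolding ok_def cross_def by simp
  moreover have "\<forall>\<rho>. ok \<rho> \<longrightarrow> card (cross (V \<times> V) \<rho>) < Suc (card (V \<times> V))"
    using finVV by (auto simp: less_Suc_eq_le cross_def intro!: card_mono)
  ultimately obtain \<rho> where \<rho>: "ok \<rho>" "\<And>\<rho>'. ok \<rho>' \<Longrightarrow> card (cross (V \<times> V) \<rho>') \<le> card (cross (V \<times> V) \<rho>)"
    using ex_has_greatest_nat[of ok _ "\<lambda>\<rho>. card (cross (V \<times> V) \<rho>)"] by blast
  have "well_connected \<gamma> {v\<in>V. \<rho> v = i} G" for i
  proof (rule ccontr)
    define W where "W = {v\<in>V. \<rho> v = i}"
    assume "\<not> well_connected \<gamma> {v\<in>V. \<rho> v = i} G"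
    then obtain S where S: "S \<subseteq> W" "real (card (G \<inter> S \<times> (W - S))) < \<gamma> * real (card S) * real (card (W - S))"
      unfolding well_connected_def W_def[symmetric] by (meson not_le)
    have WV: "W \<subseteq> V" "finite W" "finite S"
      using V(1) S(1) unfolding W_def by (auto intro: finite_subset)
    obtain n where n: "n \<notin> \<rho> ` V"
      using ex_new_if_finite[of "\<rho> ` V"] V(1) by auto
    define \<rho>' where "\<rho>' v = (if v \<in> S then n else \<rho> v)" for v
    \<comment> \<open>Giving the fresh label n to S makes exactly the pairs between S and W - S
      newly crossing, and each such pair of vertices counts in both orders.\<close>
    have split: "card (cross A \<rho>') = card (cross A \<rho>) + (card (A \<inter> S \<times> (W - S)) + card (A \<inter> (W - S) \<times> S))"
      if A: "A \<subseteq> V \<times> V" for A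
    proof -
      have finA: "finite A"
        using A finVV finite_subset by blast
      have "cross A \<rho>' = cross A \<rho> \<union> (A \<inter> S \<times> (W - S) \<union> A \<inter> (W - S) \<times> S)"
      proof (intro set_eqI iffI)
        fix e assume "e \<in> cross A \<rho>'"
        then obtain u v where "e = (u, v)" "(u, v) \<in> A" "\<rho>' u \<noteq> \<rho>' v" "u \<in> V" "v \<in> V"
          using A unfolding cross_def by auto
        then show "e \<in> cross A \<rho> \<union> (A \<inter> S \<times> (W - S) \<union> A \<inter> (W - S) \<times> S)"
          using S(1) unfolding \<rho>'_def cross_def W_def by (auto split: if_splits)
      next
        fix e assume "e \<in> cross A \<rho> \<union> (A \<inter> S \<times> (W - S) \<union> A \<inter> (W - S) \<times> S)"
        moreover obtain u v where e: "e = (u, v)" by (cases e)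
        ultimately have e': "(u, v) \<in> A" "\<rho> u \<noteq> \<rho> v \<or> (u \<in> S \<and> v \<in> W - S) \<or> (u \<in> W - S \<and> v \<in> S)"
          unfolding cross_def by auto
        then have uv: "u \<in> V" "v \<in> V"
          using A by auto
        then have "\<rho> u \<noteq> n" "\<rho> v \<noteq> n"
          using n by auto
        then have "\<rho>' u \<noteq> \<rho>' v"
          using e' S(1) unfolding \<rho>'_def W_def by auto
        then show "e \<in> cross A \<rho>'"
          using e e' unfolding cross_def by simp
      qed
      moreover have "finite (cross A \<rho>)"
        by (rule finite_subset[OF _ finA]) (auto simp: cross_def)
      moreover have "finite (A \<inter> S \<times> (W - S))" "finite (A \<inter> (W - S) \<times> S)"
        using finA by auto
      moreover have "cross A \<rho> \<inter> (A \<inter> S \<times> (W - S) \<union> A \<inter> (W - S) \<times> S) = {}"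
        using S(1) unfolding cross_def W_def by auto
      moreover have "(A \<inter> S \<times> (W - S)) \<inter> (A \<inter> (W - S) \<times> S) = {}"
        by auto
      ultimately show ?thesis
        by (simp add: card_Un_disjoint)
    qed
    have "G \<inter> (W - S) \<times> S = (G \<inter> S \<times> (W - S))\<inverse>"
      using V(3) unfolding sym_def by auto
    then have G': "card (cross G \<rho>') = card (cross G \<rho>) + 2 * card (G \<inter> S \<times> (W - S))"
      using split[OF V(2)] by simp
    have "V \<times> V \<inter> S \<times> (W - S) = S \<times> (W - S)" "V \<times> V \<inter> (W - S) \<times> S = (W - S) \<times> S"
      using S(1) WV by auto
    then have V': "card (cross (V \<times> V) \<rho>') = card (cross (V \<times> V) \<rho>) + 2 * (card S * card (W - S))"
      using split[of "V \<times> V"] by (simp add: card_cartesian_product)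
    have "ok \<rho>'"
      unfolding ok_def G' V' using \<rho>(1) S(2) unfolding ok_def by (simp add: algebra_simps)
    \<comment> \<open>By the choice of \<open>\<rho>\<close> no crossing pair can be new. So S or W
      - S is empty, and then no cut can have strictly fewer than 0 edges.\<close>
    then have "2 * (card S * card (W - S)) = 0"
      using \<rho>(2)[of \<rho>'] V' by simp
    then have "card S = 0 \<or> card (W - S) = 0"
      by simp
    then have "\<gamma> * real (card S) * real (card (W - S)) = 0"
      by (elim disjE) simp_all
    then show False
      using S(2) of_nat_0_le_iff[of "card (G \<inter> S \<times> (W - S))", where ?'a = real] by linarith
  qed
  then show ?thesis
    using \<rho>(1) unfolding ok_def cross_def by blast
qed

section \<open>Paths as lists, and short paths in well connected graphs\<close>

definition cpairs :: "'a list \<Rightarrow> ('a \<times> 'a) set" where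
  "cpairs xs = set (zip xs (tl xs))"

lemma cpairs_simps [simp]:
  "cpairs [] = {}" "cpairs [x] = {}" "cpairs (x # y # zs) = insert (x, y) (cpairs (y # zs))"
  by (simp_all add: cpairs_def)

lemma cpairs_split: "cpairs (xs @ u # ys) = cpairs (xs @ [u]) \<union> cpairs (u # ys)"
proof (induction xs)
  case (Cons x xs)
  then show ?case by (cases xs) auto
qed simp

lemma cpairs_append:
  assumes "xs \<noteq> []" "ys \<noteq> []"
  shows "cpairs (xs @ ys) = cpairs xs \<union> insert (last xs, hd ys) (cpairs ys)"
proof -
  have "xs @ ys = butlast xs @ last xs # ys"
    using assms by simp
  then have "cpairs (xs @ ys) = cpairs (butlast xs @ [last xs]) \<union> cpairs (last xs # ys)"
    by (metis cpairs_split)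
  then show ?thesis
    using assms by (cases ys) auto
qed

lemma cpairs_decomp: "(u, v) \<in> cpairs xs \<Longrightarrow> \<exists>us vs. xs = us @ u # v # vs"
proof (induction xs)
  case (Cons x xs)
  show ?case
  proof (cases xs)
    case (Cons y ys)
    then consider "u = x" "v = y" | "(u, v) \<in> cpairs xs"
      using Cons.prems by auto
    then show ?thesis
    proof cases
      case 1
      then show ?thesis
        using Cons by (metis append_Nil)
    next
      case 2
      then show ?thesis
        using Cons.IH by (metis append_Cons)
    qed
  qed (use Cons.prems in simp)
qed simp

text \<open>The number of vertices of a path found by a search that adds a fraction \<gamma>^2 / 4
  of all vertices in each step.\<close>

definition path_bound :: "real \<Rightarrow> nat" where
  "path_bound \<gamma> = nat \<lceil>4 / \<gamma>\<^sup>2\<rceil> + 2"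

text \<open>Breadth-first search from u inside V - F, where p is the size of V. If v is not reached
  in the next step either, then its neighbours, at least \<gamma> (p - 1) many, are all outside the
  present ball \<open>N j\<close>. The cut condition for the ball then gives at least \<gamma>^2 (p
  - 1) \<ge> \<gamma>^2 p / 2 boundary vertices, and F contains at most half that many. So each step
  gains \<gamma>^2 p / 4 vertices, and the number of steps is bounded independently of p.\<close>

lemma well_connected_path:
  assumes V: "finite V" "G \<subseteq> V \<times> V" "sym G" "well_connected \<gamma> V G" "0 < \<gamma>" "card V \<ge> 2"
    and uv: "u \<in> V" "v \<in> V" "u \<notin> F" "v \<notin> F" and F: "F \<subseteq> V" "real (card F) \<le> \<gamma>\<^sup>2 / 4 * real (card V)"
  shows "\<exists>xs. xs \<noteq> [] \<and> distinct xs \<and> cpairs xs \<subseteq> G \<and> hd xs = u \<and> last xs = v \<and> set xs \<subseteq> V - F \<and>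
           length xs \<le> path_bound \<gamma>"
proof -
  define N where "N = rec_nat {u} (\<lambda>_ S. S \<union> {w\<in>V - F. \<exists>x\<in>S. (x, w) \<in> G})"
  have N0: "N 0 = {u}" and NS: "N (Suc j) = N j \<union> {w\<in>V - F. \<exists>x\<in>N j. (x, w) \<in> G}" for j
    by (simp_all add: N_def)
  have NV: "N j \<subseteq> V - F" for j
    using uv by (induction j) (auto simp: N0 NS)
  have finN: "finite (N j)" for j
    using NV V(1) by (meson finite_Diff finite_subset)
  have path: "\<exists>xs. xs \<noteq> [] \<and> distinct xs \<and> cpairs xs \<subseteq> G \<and> hd xs = u \<and> last xs = w \<and> set xs \<subseteq> N j \<and> length xs \<le> Suc j"
    if "w \<in> N j" for w j
    using that
  proof (induction j arbitrary: w)
    case 0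
    then show ?case
      by (intro exI[of _ "[u]"]) (simp add: N0)
  next
    case (Suc j)
    show ?case
    proof (cases "w \<in> N j")
      case True
      then obtain xs where "xs \<noteq> []" "distinct xs" "cpairs xs \<subseteq> G" "hd xs = u" "last xs = w" "set xs \<subseteq> N j" "length xs \<le> Suc j"
        using Suc.IH by blast
      then show ?thesis
        using NS[of j] by (intro exI[of _ xs]) auto
    next
      case False
      then obtain x where x: "x \<in> N j" "(x, w) \<in> G"
        using Suc.prems NS by auto
      then obtain xs where xs: "xs \<noteq> []" "distinct xs" "cpairs xs \<subseteq> G" "hd xs = u" "last xs = x" "set xs \<subseteq> N j" "length xs \<le> Suc j"
        using Suc.IH by blast
      have "cpairs (xs @ [w]) \<subseteq> G"
        using xs x cpairs_append[of xs "[w]"] by auto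
      moreover have "distinct (xs @ [w])"
        using xs False by auto
      ultimately show ?thesis
        using xs Suc.prems NS[of j] by (intro exI[of _ "xs @ [w]"]) auto
    qed
  qed
  define p where "p = real (card V)"
  have p: "p \<ge> 2" "p - 1 \<ge> p / 2"
    using V(6) unfolding p_def by linarith+
  have grow: "real (card (N (Suc j))) \<ge> real (card (N j)) + \<gamma>\<^sup>2 / 4 * p" if no: "v \<notin> N (Suc j)" for j
  proof -
    have uN: "u \<in> N j"
      by (induction j) (auto simp: N0 NS)
    have NjV: "N j \<subseteq> V"
      using NV by blast
    have deg: "\<gamma> * (p - 1) \<le> real (card (V - N j))"
    proof -
      have "\<gamma> * real (card {v}) * real (card (V - {v})) \<le> real (card (G \<inter> {v} \<times> (V - {v})))"
        using V(4) uv unfolding well_connected_def by blast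
      also have "real (card (V - {v})) = p - 1"
        using uv V(1) unfolding p_def by (simp add: card_Diff_singleton of_nat_diff Suc_leI card_gt_0_iff) (metis card_gt_0_iff empty_iff of_nat_1 of_nat_diff Suc_leI One_nat_def)
      finally have "\<gamma> * (p - 1) \<le> real (card (G \<inter> {v} \<times> (V - {v})))"
        by simp
      also have "G \<inter> {v} \<times> (V - {v}) \<subseteq> {v} \<times> (V - N j)"
      proof
        fix e assume "e \<in> G \<inter> {v} \<times> (V - {v})"
        then obtain w where w: "e = (v, w)" "(v, w) \<in> G" "w \<in> V"
          by auto
        then have "w \<notin> N j"
          using no uv V(3) unfolding NS sym_def by auto
        then show "e \<in> {v} \<times> (V - N j)"
          using w by auto
      qed
      then have "real (card (G \<inter> {v} \<times> (V - {v}))) \<le> real (card (V - N j))"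
        using V(1) card_mono[of "{v} \<times> (V - N j)" "G \<inter> {v} \<times> (V - {v})"] by (simp add: card_cartesian_product)
      finally show ?thesis .
    qed
    define B where "B = {w\<in>V - N j. \<exists>x\<in>N j. (x, w) \<in> G}"
    have finB: "finite B"
      unfolding B_def using V(1) by simp
    have "\<gamma> * real (card (N j)) * real (card (V - N j)) \<le> real (card (G \<inter> N j \<times> (V - N j)))"
      using V(4) NjV unfolding well_connected_def by blast
    also have "\<dots> \<le> real (card (N j \<times> B))"
      using card_mono[of "N j \<times> B" "G \<inter> N j \<times> (V - N j)"] finN finB unfolding B_def by fastforce
    finally have "real (card (N j)) * (\<gamma> * real (card (V - N j))) \<le> real (card (N j)) * real (card B)"
      by (simp add: card_cartesian_product mult.commute mult.left_commute)
    moreover have "card (N j) > 0"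
      using uN finN by (auto simp: card_gt_0_iff)
    ultimately have "\<gamma> * real (card (V - N j)) \<le> real (card B)"
      by simp
    moreover have "\<gamma> * (\<gamma> * (p - 1)) \<le> \<gamma> * real (card (V - N j))"
      using deg V(5) by (intro mult_left_mono) auto
    moreover have "\<gamma> * (\<gamma> * (p / 2)) \<le> \<gamma> * (\<gamma> * (p - 1))"
      using p V(5) by (intro mult_left_mono) auto
    ultimately have B: "real (card B) \<ge> \<gamma>\<^sup>2 / 2 * p"
      by (simp add: power2_eq_square)
    have "card B - card F \<le> card (B - F)"
      by (rule diff_card_le_card_Diff) (use F V(1) finite_subset in blast)
    then have "real (card (B - F)) \<ge> \<gamma>\<^sup>2 / 4 * p"
      using B F(2) unfolding p_def[symmetric] by linarith
    moreover have "card (N (Suc j)) = card (N j) + card (B - F)"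
    proof -
      have "N (Suc j) = N j \<union> (B - F)"
        unfolding NS B_def by auto
      moreover have "N j \<inter> (B - F) = {}"
        unfolding B_def by auto
      ultimately show ?thesis
        using finN finB by (simp add: card_Un_disjoint)
    qed
    ultimately show ?thesis by simp
  qed
  define J where "J = nat \<lceil>4 / \<gamma>\<^sup>2\<rceil> + 1"
  have "v \<in> N J"
  proof (rule ccontr)
    assume no: "v \<notin> N J"
    have "\<not> v \<in> N j" if "j \<le> J" for j
      using lift_Suc_mono_le[of N j J] that no NS by blast
    then have "j \<le> J \<Longrightarrow> real (card (N j)) \<ge> 1 + real j * (\<gamma>\<^sup>2 / 4 * p)" for j
    proof (induction j)
      case (Suc j)
      have "real (card (N (Suc j))) \<ge> real (card (N j)) + \<gamma>\<^sup>2 / 4 * p"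
        using grow[of j] \<open>\<And>j. j \<le> J \<Longrightarrow> v \<notin> N j\<close> Suc.prems by blast
      moreover have "real (card (N j)) \<ge> 1 + real j * (\<gamma>\<^sup>2 / 4 * p)"
        using Suc by simp
      ultimately show ?case
        by (simp add: algebra_simps add_divide_distrib)
    qed (simp add: N0)
    then have "real (card (N J)) \<ge> 1 + real J * (\<gamma>\<^sup>2 / 4 * p)"
      by blast
    moreover have "real J * (\<gamma>\<^sup>2 / 4 * p) \<ge> p"
    proof -
      have "4 / \<gamma>\<^sup>2 \<le> real J"
        unfolding J_def by linarith
      then have "1 \<le> real J * (\<gamma>\<^sup>2 / 4)"
        using V(5) by (simp add: field_simps)
      then have "1 * p \<le> real J * (\<gamma>\<^sup>2 / 4) * p"
        using p by (intro mult_right_mono) auto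
      then show ?thesis by (simp add: mult.assoc)
    qed
    moreover have "real (card (N J)) \<le> p"
      using NV[of J] V(1) unfolding p_def by (simp add: card_mono subset_Diff_insert) (meson Diff_subset card_mono order_trans)
    ultimately show False by linarith
  qed
  then obtain xs where "xs \<noteq> []" "distinct xs" "cpairs xs \<subseteq> G" "hd xs = u" "last xs = v" "set xs \<subseteq> N J" "length xs \<le> Suc J"
    using path by blast
  then show ?thesis
    using NV[of J] unfolding path_bound_def J_def by (intro exI[of _ xs]) auto
qed

section \<open>Long cycles through tiles\<close>

fun alternate :: "'a list \<Rightarrow> 'a list \<Rightarrow> 'a list" where
  "alternate (x # xs) (y # ys) = x # y # alternate xs ys"
| "alternate _ _ = []"

lemma set_alternate: "length xs = length ys \<Longrightarrow> set (alternate xs ys) = set xs \<union> set ys"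
  by (induction xs ys rule: list_induct2) auto

lemma length_alternate: "length xs = length ys \<Longrightarrow> length (alternate xs ys) = 2 * length xs"
  by (induction xs ys rule: list_induct2) auto

lemma distinct_alternate:
  "length xs = length ys \<Longrightarrow> distinct xs \<Longrightarrow> distinct ys \<Longrightarrow> set xs \<inter> set ys = {} \<Longrightarrow> distinct (alternate xs ys)"
  by (induction xs ys rule: list_induct2) (auto simp: set_alternate)

text \<open>A zigzag that begins on the side A after b and ends on the side B before a. Hence it can
  be inserted into an edge (b, a) of a cycle and keeps it a cycle.\<close>

lemma cpairs_alternate:
  assumes "length xs = length ys" "set xs \<subseteq> A" "set ys \<subseteq> B" "b \<in> B" "a \<in> A" "B \<times> A \<subseteq> G" "A \<times> B \<subseteq> G"
  shows "cpairs (b # alternate xs ys @ [a]) \<subseteq> G"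
  using assms(1-4)
proof (induction xs ys arbitrary: b rule: list_induct2)
  case Nil
  then show ?case
    using assms(5,6) by auto
next
  case (Cons x xs y ys)
  have "cpairs (y # alternate xs ys @ [a]) \<subseteq> G"
    using Cons by simp
  moreover have "(b, x) \<in> G" "(x, y) \<in> G"
    using Cons.prems assms(6,7) by auto
  ultimately show ?case by simp
qed

text \<open>The number h is the loss at which a tile counts as exhausted. The bound 16 (L + 2) \<le>
  \<gamma>^2 h keeps the exhausted tiles so few that connecting paths can avoid all of them, and t
  \<ge> h + L + 3 leaves fresh vertices in every tile side.\<close>

locale tiled_graph =
  fixes V :: "'a set" and G :: "('a \<times> 'a) set" and \<gamma> :: real and X Y :: "'a set" and D :: "('a \<times> 'a) set"
    and t :: nat and T :: "('a set \<times> 'a set) set" and h :: nat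
  assumes finV: "finite V" and GV: "G \<subseteq> V \<times> V" and symG: "sym G"
    and conn: "well_connected \<gamma> V G" and \<gamma>: "0 < \<gamma>" "\<gamma> \<le> 1"
    and XY: "X \<inter> Y = {}" "X \<union> Y \<subseteq> V" and DG: "D \<subseteq> G" and T: "tiling D t X Y T" "T \<noteq> {}"
    and h: "h > 0" "16 * real (path_bound \<gamma> + 2) \<le> \<gamma>\<^sup>2 * real h" and th: "t \<ge> h + path_bound \<gamma> + 3"
begin

abbreviation L :: nat where "L \<equiv> path_bound \<gamma>"

lemma finT: "finite T"
  using T(1) unfolding tiling_def by blast

lemma tileD:
  assumes "p \<in> T"
  shows "fst p \<subseteq> X" "snd p \<subseteq> Y" "card (fst p) = t" "card (snd p) = t" "fst p \<times> snd p \<subseteq> G" "snd p \<times> fst p \<subseteq> G"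
    "finite (fst p)" "finite (snd p)"
proof -
  have "fst p \<subseteq> X \<and> snd p \<subseteq> Y \<and> card (fst p) = t \<and> card (snd p) = t \<and> fst p \<times> snd p \<subseteq> D"
    using assms T(1) unfolding tiling_def by blast
  then show "fst p \<subseteq> X" "snd p \<subseteq> Y" "card (fst p) = t" "card (snd p) = t" and e: "fst p \<times> snd p \<subseteq> G"
    using DG by auto
  show "snd p \<times> fst p \<subseteq> G"
    using e symG unfolding sym_def by blast
  have "fst p \<subseteq> V" "snd p \<subseteq> V"
    using \<open>fst p \<subseteq> X\<close> \<open>snd p \<subseteq> Y\<close> XY(2) by auto
  then show "finite (fst p)" "finite (snd p)"
    using finV finite_subset by blast+
qed

definition body :: "'a set \<times> 'a set \<Rightarrow> 'a set" where
  "body p = fst p \<union> snd p"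

lemma body_disjoint: "p \<in> T \<Longrightarrow> q \<in> T \<Longrightarrow> p \<noteq> q \<Longrightarrow> body p \<inter> body q = {}"
proof -
  assume pq: "p \<in> T" "q \<in> T" "p \<noteq> q"
  then have "fst p \<inter> fst q = {} \<and> snd p \<inter> snd q = {}"
    using T(1) unfolding tiling_def by blast
  moreover have "fst p \<inter> snd q = {}" "snd p \<inter> fst q = {}"
    using tileD[OF pq(1)] tileD[OF pq(2)] XY(1) by auto
  ultimately show ?thesis
    unfolding body_def by auto
qed

lemma body_V: "p \<in> T \<Longrightarrow> body p \<subseteq> V"
  using tileD XY(2) unfolding body_def by blast

lemma card_body: "p \<in> T \<Longrightarrow> card (body p) = 2 * t"
  using tileD[of p] XY(1) unfolding body_def by (subst card_Un_disjoint) auto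

lemma tiles_card: "2 * t * card T \<le> card V"
proof -
  have "card (\<Union>p\<in>T. body p) = (\<Sum>p\<in>T. card (body p))"
  proof (rule card_UN_disjoint)
    show "finite T" by (rule finT)
    show "\<forall>p\<in>T. finite (body p)"
      using tileD unfolding body_def by simp
    show "\<forall>p\<in>T. \<forall>q\<in>T. p \<noteq> q \<longrightarrow> body p \<inter> body q = {}"
      using body_disjoint by blast
  qed
  also have "\<dots> = card T * (2 * t)"
    using card_body by simp
  finally have "card T * (2 * t) = card (\<Union>p\<in>T. body p)" ..
  also have "\<dots> \<le> card V"
    using body_V finV by (intro card_mono) auto
  finally show ?thesis
    by (simp add: mult.commute)
qed

definition exhausted :: "'a set \<Rightarrow> ('a set \<times> 'a set) set" where
  "exhausted W = {p\<in>T. h \<le> card (W \<inter> fst p) \<or> h \<le> card (W \<inter> snd p)}"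

text \<open>Connecting paths have to avoid more than the used vertices W: a tile that has lost h
  vertices on one side is closed as a whole.\<close>

definition blocked :: "'a set \<Rightarrow> 'a set" where
  "blocked W = W \<union> (\<Union>p\<in>exhausted W. body p)"

text \<open>The tiles are disjoint, so at most |W| / h of them are exhausted, with 2 t vertices
  each. With |W| \<le> |T| (L + 2) and h \<le> t, the blocked set times h has size at most 3 |T| t
  (L + 2). As 2 t |T| \<le> |V|, this is at most (3/2) |V| (L + 2), whereas (\<gamma>^2 / 4) |V| h
  is at least 4 |V| (L + 2).\<close>

lemma card_blocked:
  assumes W: "W \<subseteq> V" "card W \<le> card T * (L + 2)"
  shows "real (card (blocked W)) \<le> \<gamma>\<^sup>2 / 4 * real (card V)"
proof -
  have finW: "finite W"
    using W finV finite_subset by blast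
  have finE: "finite (exhausted W)" and ET: "exhausted W \<subseteq> T"
    using finT unfolding exhausted_def by auto
  have "card (exhausted W) * h = (\<Sum>p\<in>exhausted W. h)"
    by simp
  also have "\<dots> \<le> (\<Sum>p\<in>exhausted W. card (W \<inter> body p))"
  proof (rule sum_mono)
    fix p assume "p \<in> exhausted W"
    moreover have "card (W \<inter> fst p) \<le> card (W \<inter> body p)" "card (W \<inter> snd p) \<le> card (W \<inter> body p)"
      using finW unfolding body_def by (auto intro!: card_mono)
    ultimately show "h \<le> card (W \<inter> body p)"
      unfolding exhausted_def by auto
  qed
  also have "\<dots> = card (\<Union>p\<in>exhausted W. W \<inter> body p)"
  proof (rule card_UN_disjoint[symmetric])
    show "\<forall>p\<in>exhausted W. \<forall>q\<in>exhausted W. p \<noteq> q \<longrightarrow> W \<inter> body p \<inter> (W \<inter> body q) = {}"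
      using body_disjoint ET by blast
  qed (use finE finW in auto)
  also have "\<dots> \<le> card W"
    using finW by (intro card_mono) auto
  finally have Eh: "real (card (exhausted W)) * real h \<le> real (card W)"
    by (simp flip: of_nat_mult)
  have "card (\<Union>p\<in>exhausted W. body p) \<le> (\<Sum>p\<in>exhausted W. card (body p))"
    using finE by (rule card_UN_le)
  also have "\<dots> = (\<Sum>p\<in>exhausted W. 2 * t)"
    using ET card_body by (intro sum.cong) auto
  also have "\<dots> = card (exhausted W) * (2 * t)"
    by simp
  finally have "card (blocked W) \<le> card W + card (exhausted W) * (2 * t)"
    unfolding blocked_def using card_Un_le[of W "\<Union>p\<in>exhausted W. body p"] by linarith
  then have "real (card (blocked W)) \<le> real (card W + card (exhausted W) * (2 * t))"
    by (simp only: of_nat_le_iff)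
  then have 1: "real (card (blocked W)) \<le> real (card W) + real (card (exhausted W)) * (2 * real t)"
    by simp
  have hp: "real h > 0" using h by simp
  have "real (card W) \<le> real (card T * (L + 2))"
    using W(2) by (simp only: of_nat_le_iff)
  then have Wk: "real (card W) \<le> real (card T) * real (L + 2)"
    by (simp only: of_nat_mult)
  have "real (card (exhausted W)) * (2 * real t) * real h \<le> real (card T) * real (L + 2) * (2 * real t)"
    using mult_right_mono[OF order_trans[OF Eh Wk], of "2 * real t"] by (simp add: mult.commute mult.left_commute)
  moreover have "real (card W) * real h \<le> real (card T) * real (L + 2) * real t"
    using Wk th by (intro mult_mono) auto
  ultimately have 2: "real (card (blocked W)) * real h \<le> 3 * (real (card T) * real t * real (L + 2))"
    using mult_right_mono[OF 1, of "real h"] hp by (simp add: algebra_simps)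
  have "2 * real t * real (card T) \<le> real (card V)"
    using tiles_card by (simp flip: of_nat_le_iff[where ?'a = real])
  then have "real (card T) * real t * 2 * real (L + 2) \<le> real (card V) * real (L + 2)"
    by (intro mult_right_mono) (simp_all add: mult.commute mult.left_commute)
  then have 3: "2 * (real (card T) * real t * real (L + 2)) \<le> real (card V) * real (L + 2)"
    by (simp only: mult.commute mult.left_commute)
  have 4: "16 * (real (card V) * real (L + 2)) \<le> real (card V) * (\<gamma>\<^sup>2 * real h)"
    using mult_left_mono[OF h(2), of "real (card V)"] by (simp only: mult.left_commute)
  have "0 \<le> real (card V) * (\<gamma>\<^sup>2 * real h)"
    by simp
  then have "4 * (real (card (blocked W)) * real h) \<le> real (card V) * (\<gamma>\<^sup>2 * real h)"
    using 2 3 4 by linarith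
  then have "real (card (blocked W)) * real h \<le> \<gamma>\<^sup>2 / 4 * real (card V) * real h"
    by (simp add: algebra_simps)
  then show ?thesis
    using hp by simp
qed

text \<open>The ends u and v are exempted from the blocked set: a path starts at a used vertex and
  may have to end in a tile that is exhausted.\<close>

lemma path_avoiding:
  assumes W: "W \<subseteq> V" "card W \<le> card T * (L + 2)" and uv: "u \<in> V" "v \<in> V"
  shows "\<exists>xs. xs \<noteq> [] \<and> distinct xs \<and> cpairs xs \<subseteq> G \<and> hd xs = u \<and> last xs = v \<and>
           set xs \<subseteq> V - (blocked W - {u, v}) \<and> length xs \<le> L"
proof (rule well_connected_path[OF finV GV symG conn \<gamma>(1) _ uv])
  have "card T > 0"
    using T(2) finT by (simp add: card_gt_0_iff)
  then have "2 \<le> 2 * t * card T"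
    using th by simp
  then show "2 \<le> card V"
    using tiles_card by linarith
  have "blocked W \<subseteq> V"
    using W body_V unfolding blocked_def exhausted_def by blast
  then show "blocked W - {u, v} \<subseteq> V"
    by blast
  have "card (blocked W - {u, v}) \<le> card (blocked W)"
    using \<open>blocked W \<subseteq> V\<close> finV finite_subset by (intro card_mono) blast+
  then show "real (card (blocked W - {u, v})) \<le> \<gamma>\<^sup>2 / 4 * real (card V)"
    using card_blocked[OF W] by linarith
qed auto

text \<open>A new path has at most L vertices and takes new vertices of Z only if fewer than h are
  used there, so at most h + L are used afterwards; in an exhausted tile nothing changes. The bound
  c may be larger than h + L to allow for a vertex placed in the tile on purpose.\<close>

lemma usage_bound:
  assumes p: "p \<in> T" and W: "finite W" and Q: "card Q \<le> L" "finite Q" "Q \<inter> blocked W \<inter> Z \<subseteq> W" and Z: "Z = fst p \<or> Z = snd p" and c: "h + L \<le> c" "card (W \<inter> Z) \<le> c"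
  shows "card ((W \<union> Q) \<inter> Z) \<le> c"
proof (cases "p \<in> exhausted W")
  case True
  then have "Z \<subseteq> blocked W"
    using Z unfolding blocked_def body_def by auto
  then have "(W \<union> Q) \<inter> Z = W \<inter> Z"
    using Q(3) by blast
  then show ?thesis
    using c(2) by simp
next
  case False
  then have "card (W \<inter> Z) < h"
    using p Z unfolding exhausted_def by auto
  moreover have "card ((W \<union> Q) \<inter> Z) \<le> card (W \<inter> Z \<union> Q)"
    using W Q(2) by (intro card_mono) auto
  moreover have "card (W \<inter> Z \<union> Q) \<le> card (W \<inter> Z) + card Q"
    by (rule card_Un_le)
  ultimately show ?thesis
    using Q(1) c(1) by linarith
qed

text \<open>The path visits the tiles of S in turn and contains from each an edge (b, a), the place
  for a later zigzag; the orientation is part of the claim. The extra 1 for tiles in S stands for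
  their own b or a, which are chosen even if the tile is exhausted. At most L + 2 vertices per tile
  keep the used set within the range of \<open>path_avoiding\<close>.\<close>

lemma skeleton:
  assumes "finite S" "S \<noteq> {}" "S \<subseteq> T"
  shows "\<exists>P. length P \<ge> 2 \<and> distinct P \<and> cpairs P \<subseteq> G \<and> set P \<subseteq> V \<and> length P \<le> card S * (L + 2) \<and>
           (\<forall>p\<in>S. \<exists>b\<in>snd p. \<exists>a\<in>fst p. (b, a) \<in> cpairs P) \<and>
           (\<forall>q\<in>T. \<forall>Z\<in>{fst q, snd q}. card (set P \<inter> Z) \<le> h + L + (if q \<in> S then 1 else 0))"
  using assms
proof (induction S rule: finite_ne_induct)
  case (singleton p)
  have p: "p \<in> T"
    using singleton by simp
  obtain a b where ab: "a \<in> fst p" "b \<in> snd p"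
    using tileD(3,4)[OF p] th by (metis One_nat_def add_is_0 card.empty ex_in_conv le_zero_eq numeral_3_eq_3 nat.distinct(1))
  have "a \<noteq> b" "a \<in> V" "b \<in> V" "(b, a) \<in> G"
    using ab tileD[OF p] XY by auto
  moreover have "card (set [b, a] \<inter> Z) \<le> h + L" for Z
  proof -
    have "card (set [b, a] \<inter> Z) \<le> card (set [b, a])"
      by (intro card_mono) auto
    also have "\<dots> \<le> length [b, a]"
      by (rule card_length)
    finally show ?thesis
      by (simp add: path_bound_def)
  qed
  moreover have "length [b, a] \<le> card {p} * (L + 2)"
    by (simp add: path_bound_def)
  ultimately have "length [b, a] \<ge> 2 \<and> distinct [b, a] \<and> cpairs [b, a] \<subseteq> G \<and> set [b, a] \<subseteq> V \<and>
      length [b, a] \<le> card {p} * (L + 2) \<and> (\<forall>q\<in>{p}. \<exists>b'\<in>snd q. \<exists>a'\<in>fst q. (b', a') \<in> cpairs [b, a]) \<and>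
      (\<forall>q\<in>T. \<forall>Z\<in>{fst q, snd q}. card (set [b, a] \<inter> Z) \<le> h + L + (if q \<in> {p} then 1 else 0))"
    using ab by (simp only: trans_le_add1) auto
  then show ?case by blast
next
  case (insert p S)
  have p: "p \<in> T" and ST: "S \<subseteq> T"
    using insert.prems by auto
  obtain P where P: "length P \<ge> 2" "distinct P" "cpairs P \<subseteq> G" "set P \<subseteq> V" "length P \<le> card S * (L + 2)"
    and edges: "\<forall>p\<in>S. \<exists>b\<in>snd p. \<exists>a\<in>fst p. (b, a) \<in> cpairs P"
    and usage: "\<And>q Z. q \<in> T \<Longrightarrow> Z \<in> {fst q, snd q} \<Longrightarrow> card (set P \<inter> Z) \<le> h + L + (if q \<in> S then 1 else 0)"
    using insert.IH[OF ST] by blast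
  define W where "W = set P"
  have W: "finite W" "W \<subseteq> V"
    using P(4) unfolding W_def by auto
  have "card S \<le> card T"
    using ST finT by (rule card_mono[rotated])
  then have "card S * (L + 2) \<le> card T * (L + 2)"
    by (rule mult_le_mono1)
  moreover have "card W \<le> length P"
    unfolding W_def by (rule card_length)
  ultimately have cardW: "card W \<le> card T * (L + 2)"
    using P(5) by linarith
  have fresh: "\<exists>x. x \<in> Z \<and> x \<notin> U" if "card (U \<inter> Z) \<le> h + L" "card Z = t" for U Z :: "'a set"
  proof (rule ccontr)
    assume "\<not> ?thesis"
    then have "U \<inter> Z = Z" by blast
    then show False
      using that th by simp
  qed
  have "card (W \<inter> snd p) \<le> h + L"
    using usage[OF p, of "snd p"] insert.hyps(3) unfolding W_def by simp
  then obtain b where b: "b \<in> snd p" "b \<notin> W"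
    using fresh[OF _ tileD(4)[OF p]] by blast
  have Pne: "P \<noteq> []"
    using P(1) by auto
  define u where "u = last P"
  have u: "u \<in> W" "u \<in> V"
    using Pne P(4) unfolding u_def W_def by auto
  have bV: "b \<in> V" "b \<in> body p"
    using b body_V[OF p] unfolding body_def by auto
  obtain Q where Q: "Q \<noteq> []" "distinct Q" "cpairs Q \<subseteq> G" "hd Q = u" "last Q = b"
      "set Q \<subseteq> V - (blocked W - {u, b})" "length Q \<le> L"
    using path_avoiding[OF W(2) cardW u(2) bV(1)] by blast
  then obtain Q' where Q': "Q = u # Q'"
    by (metis list.collapse)
  have Q'ne: "Q' \<noteq> []"
    using Q(5) Q' b u by auto
  have lastQ': "last Q' = b"
    using Q(5) Q' Q'ne by simp
  have cardQ: "card (set Q) \<le> L"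
    using card_length[of Q] Q(7) by linarith
  have WB: "W \<subseteq> blocked W"
    unfolding blocked_def by blast
  have Q'W: "set Q' \<inter> W = {}"
    using Q(2,6) Q' b WB by auto
  \<comment> \<open>On a side without b, all of Q is subject to \<open>usage_bound\<close>. The
    vertex b is exempted from avoiding the blocked set, so the side containing it needs the separate
    bound \<open>sp\<close>.\<close>
  have other: "card ((W \<union> set Q) \<inter> Z) \<le> h + L + (if q \<in> S then 1 else 0)"
    if "q \<in> T" "Z = fst q \<or> Z = snd q" "b \<notin> Z" for q Z
  proof (rule usage_bound[OF that(1) W(1) cardQ _ _ that(2)])
    show "set Q \<inter> blocked W \<inter> Z \<subseteq> W"
      using Q(6) that(3) u by blast
    show "card (W \<inter> Z) \<le> h + L + (if q \<in> S then 1 else 0)"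
      using usage[of q Z] that unfolding W_def by auto
  qed auto
  have "b \<notin> fst p"
    using b tileD[OF p] XY(1) by auto
  then have fp: "card ((W \<union> set Q) \<inter> fst p) \<le> h + L"
    using other[OF p, of "fst p"] insert.hyps(3) by simp
  then obtain a where a: "a \<in> fst p" "a \<notin> W \<union> set Q"
    using fresh[OF _ tileD(3)[OF p]] by blast
  have sp: "card ((W \<union> (set Q - {b})) \<inter> snd p) \<le> h + L"
  proof (rule usage_bound[OF p W(1)])
    show "card (set Q - {b}) \<le> L"
      using cardQ by (meson Diff_subset List.finite_set card_mono le_trans)
    show "(set Q - {b}) \<inter> blocked W \<inter> snd p \<subseteq> W"
      using Q(6) u by blast
    show "card (W \<inter> snd p) \<le> h + L"
      by (rule \<open>card (W \<inter> snd p) \<le> h + L\<close>)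
  qed auto
  define P' where "P' = P @ Q' @ [a]"
  have setP': "set P' = insert a (W \<union> set Q)"
    unfolding P'_def W_def Q' using u(1) unfolding W_def by auto
  have ba: "(b, a) \<in> G"
    using tileD(6)[OF p] a b by auto
  have cQ: "cpairs Q = insert (u, hd Q') (cpairs Q')"
    using Q'ne unfolding Q' by (cases Q') auto
  have cP': "cpairs P' = cpairs P \<union> insert (u, hd Q') (cpairs Q' \<union> {(b, a)})"
    unfolding P'_def using cpairs_append[OF Pne, of "Q' @ [a]"] cpairs_append[OF Q'ne, of "[a]"] Q'ne lastQ' u_def
    by simp
  have "length P' \<ge> 2"
    using P(1) unfolding P'_def by simp
  moreover have "distinct P'"
    using P(2) Q(2) Q'W a unfolding P'_def Q' W_def by auto
  moreover have "cpairs P' \<subseteq> G"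
    unfolding cP' using P(3) Q(3) cQ ba by auto
  moreover have "set P' \<subseteq> V"
    unfolding setP' using W(2) Q(6) a body_V[OF p] unfolding body_def by auto
  moreover have "length P' \<le> card (insert p S) * (L + 2)"
    using P(5) Q(7) insert.hyps unfolding P'_def Q' by simp
  moreover have "\<forall>q\<in>insert p S. \<exists>b\<in>snd q. \<exists>a\<in>fst q. (b, a) \<in> cpairs P'"
  proof
    fix q assume "q \<in> insert p S"
    then show "\<exists>b\<in>snd q. \<exists>a\<in>fst q. (b, a) \<in> cpairs P'"
    proof
      assume "q = p"
      then show ?thesis
        using a(1) b(1) unfolding cP' by blast
    next
      assume "q \<in> S"
      then show ?thesis
        using edges unfolding cP' by blast
    qed
  qed
  moreover have "\<forall>q\<in>T. \<forall>Z\<in>{fst q, snd q}. card (set P' \<inter> Z) \<le> h + L + (if q \<in> insert p S then 1 else 0)"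
  proof (intro ballI)
    fix q Z assume q: "q \<in> T" and Z: "Z \<in> {fst q, snd q}"
    then have Zb: "Z \<subseteq> body q"
      unfolding body_def by auto
    show "card (set P' \<inter> Z) \<le> h + L + (if q \<in> insert p S then 1 else 0)"
    proof (cases "q = p")
      case False
      then have d: "body p \<inter> body q = {}"
        using body_disjoint[OF p q] by auto
      then have "b \<notin> Z" "a \<notin> Z"
        using Zb bV a unfolding body_def by auto
      then have "set P' \<inter> Z = (W \<union> set Q) \<inter> Z"
        unfolding setP' by auto
      then show ?thesis
        using other[OF q _ \<open>b \<notin> Z\<close>] Z False by auto
    next
      case True
      have "card (set P' \<inter> Z) \<le> Suc (h + L)"
      proof (cases "Z = fst p")
        case Zf: True
        have "set P' \<inter> Z \<subseteq> insert a ((W \<union> set Q) \<inter> fst p)"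
          unfolding setP' Zf by auto
        then have "card (set P' \<inter> Z) \<le> card (insert a ((W \<union> set Q) \<inter> fst p))"
          using W(1) by (intro card_mono) auto
        also have "\<dots> \<le> Suc (card ((W \<union> set Q) \<inter> fst p))"
          by (rule card_insert_le_m1) auto
        finally show ?thesis
          using fp by linarith
      next
        case False
        then have Zs: "Z = snd p"
          using Z True by auto
        have "a \<notin> snd p"
          using a tileD[OF p] XY(1) by auto
        then have "set P' \<inter> Z \<subseteq> insert b ((W \<union> (set Q - {b})) \<inter> snd p)"
          unfolding setP' Zs by auto
        then have "card (set P' \<inter> Z) \<le> card (insert b ((W \<union> (set Q - {b})) \<inter> snd p))"
          using W(1) by (intro card_mono) auto
        also have "\<dots> \<le> Suc (card ((W \<union> (set Q - {b})) \<inter> snd p))"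
          by (rule card_insert_le_m1) auto
        finally show ?thesis
          using sp by linarith
      qed
      then show ?thesis
        using True by simp
    qed
  qed
  ultimately show ?case by blast
qed

text \<open>The skeleton of all tiles is closed by one more short path. Both of its ends are already
  used, so by \<open>usage_bound\<close> the bound h + L + 1 persists.\<close>

lemma closed_skeleton:
  "\<exists>P. P \<noteq> [] \<and> distinct P \<and> cpairs P \<subseteq> G \<and> (last P, hd P) \<in> G \<and>
     (\<forall>p\<in>T. \<exists>b\<in>snd p. \<exists>a\<in>fst p. (b, a) \<in> cpairs P) \<and>
     (\<forall>q\<in>T. \<forall>Z\<in>{fst q, snd q}. card (set P \<inter> Z) \<le> h + L + 1)"
proof -
  obtain P where P: "length P \<ge> 2" "distinct P" "cpairs P \<subseteq> G" "set P \<subseteq> V" "length P \<le> card T * (L + 2)"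
    and edges: "\<forall>p\<in>T. \<exists>b\<in>snd p. \<exists>a\<in>fst p. (b, a) \<in> cpairs P"
    and usage: "\<And>q Z. q \<in> T \<Longrightarrow> Z \<in> {fst q, snd q} \<Longrightarrow> card (set P \<inter> Z) \<le> h + L + (if q \<in> T then 1 else 0)"
    using skeleton[OF finT T(2) order_refl] by blast
  define W where "W = set P"
  have W: "finite W" "W \<subseteq> V"
    using P(4) unfolding W_def by auto
  have cardW: "card W \<le> card T * (L + 2)"
    using P(5) card_length[of P] unfolding W_def by linarith
  have Pne: "P \<noteq> []"
    using P(1) by auto
  define u v where "u = last P" and "v = hd P"
  obtain x xs where xs: "P = x # xs" "xs \<noteq> []"
    using P(1) by (cases P; cases "tl P") auto
  have "u \<noteq> v"
    using P(2) xs unfolding u_def v_def by auto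
  have uv: "u \<in> W" "v \<in> W" "u \<in> V" "v \<in> V"
    using Pne P(4) unfolding u_def v_def W_def by auto
  obtain Q where Q: "Q \<noteq> []" "distinct Q" "cpairs Q \<subseteq> G" "hd Q = u" "last Q = v"
      "set Q \<subseteq> V - (blocked W - {u, v})" "length Q \<le> L"
    using path_avoiding[OF W(2) cardW uv(3,4)] by blast
  \<comment> \<open>Only the interior of the closing path is appended; it is empty when the path is
    a single edge.\<close>
  obtain Q' where Q': "Q = u # Q' @ [v]"
    using Q(1,4,5) \<open>u \<noteq> v\<close> by (metis append_butlast_last_id last.simps list.collapse)
  have WB: "W \<subseteq> blocked W"
    unfolding blocked_def by blast
  have Q'W: "set Q' \<inter> W = {}"
    using Q(2,6) Q' WB by auto
  define C where "C = P @ Q'"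
  have C: "cpairs C \<subseteq> G \<and> (last C, hd C) \<in> G"
  proof (cases "Q' = []")
    case True
    then show ?thesis
      using P(3) Q(3) Q' unfolding C_def u_def v_def by auto
  next
    case False
    have "cpairs Q = insert (u, hd Q') (cpairs (Q' @ [v]))"
      using False unfolding Q' by (cases Q') auto
    also have "cpairs (Q' @ [v]) = insert (last Q', v) (cpairs Q')"
      using cpairs_append[OF False, of "[v]"] by auto
    finally have "cpairs Q = insert (u, hd Q') (insert (last Q', v) (cpairs Q'))" .
    then show ?thesis
      using P(3) Q(3) cpairs_append[OF Pne False] False Pne unfolding C_def u_def v_def by auto
  qed
  have "card (set C \<inter> Z) \<le> h + L + 1" if q: "q \<in> T" and Z: "Z \<in> {fst q, snd q}" for q Z
  proof -
    have "card ((W \<union> set Q) \<inter> Z) \<le> h + L + 1"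
    proof (rule usage_bound[OF q W(1)])
      show "card (set Q) \<le> L"
        using card_length[of Q] Q(7) by linarith
      show "set Q \<inter> blocked W \<inter> Z \<subseteq> W"
        using Q(6) uv by blast
      show "card (W \<inter> Z) \<le> h + L + 1"
        using usage[OF q Z] q unfolding W_def by simp
    qed (use Z in auto)
    moreover have "set C = W \<union> set Q"
      using uv unfolding C_def W_def Q' by auto
    ultimately show ?thesis by simp
  qed
  moreover have "distinct C"
    using P(2) Q(2) Q'W unfolding C_def Q' W_def by auto
  moreover have "cpairs P \<subseteq> cpairs C"
    using cpairs_append[OF Pne] unfolding C_def by (cases "Q' = []") auto
  then have "\<forall>p\<in>T. \<exists>b\<in>snd p. \<exists>a\<in>fst p. (b, a) \<in> cpairs C"
    using edges by blast
  ultimately show ?thesis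
    using C Pne unfolding C_def by (intro exI[of _ "P @ Q'"]) auto
qed

lemma long_cycle:
  "\<exists>C. C \<noteq> [] \<and> distinct C \<and> cpairs C \<subseteq> G \<and> (last C, hd C) \<in> G \<and>
     2 * (card T * (t - (h + L + 1))) \<le> length C"
proof -
  define q where "q = t - (h + L + 1)"
  obtain P where P: "P \<noteq> []" "distinct P" "cpairs P \<subseteq> G" "(last P, hd P) \<in> G"
     "\<And>p. p \<in> T \<Longrightarrow> \<exists>b\<in>snd p. \<exists>a\<in>fst p. (b, a) \<in> cpairs P"
     "\<And>p Z. p \<in> T \<Longrightarrow> Z \<in> {fst p, snd p} \<Longrightarrow> card (set P \<inter> Z) \<le> h + L + 1"
    using closed_skeleton by blast
  have "\<exists>C. C \<noteq> [] \<and> distinct C \<and> cpairs C \<subseteq> G \<and> (last C, hd C) \<in> G \<and> 2 * (card S * q) \<le> length C \<and>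
      set C \<subseteq> set P \<union> (\<Union>p\<in>S. body p) \<and>
      (\<forall>p\<in>T - S. \<exists>b\<in>snd p. \<exists>a\<in>fst p. (b, a) \<in> cpairs C)" if "finite S" "S \<subseteq> T" for S
    using that
  proof (induction S rule: finite_induct)
    case empty
    then show ?case
      using P by (intro exI[of _ P]) auto
  next
    case (insert p S)
    have p: "p \<in> T"
      using insert.prems by auto
    obtain C where C: "C \<noteq> []" "distinct C" "cpairs C \<subseteq> G" "(last C, hd C) \<in> G" "2 * (card S * q) \<le> length C"
        "set C \<subseteq> set P \<union> (\<Union>p\<in>S. body p)"
        "\<And>p. p \<in> T - S \<Longrightarrow> \<exists>b\<in>snd p. \<exists>a\<in>fst p. (b, a) \<in> cpairs C"
      using insert.IH insert.prems by blast
    obtain a b where ab: "b \<in> snd p" "a \<in> fst p" "(b, a) \<in> cpairs C"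
      using C(7)[of p] p insert.hyps by blast
    obtain us vs where us: "C = us @ b # a # vs"
      using cpairs_decomp[OF ab(3)] by blast
    have free: "\<exists>zs. distinct zs \<and> length zs = q \<and> set zs \<subseteq> Z \<and> set zs \<inter> set P = {}"
      if Z: "Z \<in> {fst p, snd p}" for Z
    proof -
      have finZ: "finite Z" "card Z = t"
        using tileD[OF p] Z by auto
      have "card (Z - set P) = card Z - card (set P \<inter> Z)"
        using finZ by (simp add: card_Diff_subset_Int Int_commute)
      then have "q \<le> card (Z - set P)"
        using P(6)[OF p Z] finZ unfolding q_def by simp
      then obtain Z' where Z': "Z' \<subseteq> Z - set P" "card Z' = q"
        by (meson obtain_subset_with_card_n)
      then have "finite Z'"
        using finZ finite_subset by blast
      then obtain zs where "set zs = Z'" "distinct zs"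
        using finite_distinct_list by blast
      then show ?thesis
        using Z' by (metis Diff_disjoint Diff_subset disjoint_iff distinct_card subsetD subset_trans)
    qed
    obtain as where as: "distinct as" "length as = q" "set as \<subseteq> fst p" "set as \<inter> set P = {}"
      using free[of "fst p"] by blast
    obtain bs where bs: "distinct bs" "length bs = q" "set bs \<subseteq> snd p" "set bs \<inter> set P = {}"
      using free[of "snd p"] by blast
    have len: "length as = length bs"
      using as bs by simp
    define I where "I = alternate as bs"
    have setI: "set I = set as \<union> set bs" and lenI: "length I = 2 * q"
      unfolding I_def using set_alternate[OF len] length_alternate[OF len] as(2) by simp_all
    have "set as \<inter> set bs = {}"
      using as(3) bs(3) tileD[OF p] XY(1) by blast
    then have dI: "distinct I"
      unfolding I_def using distinct_alternate[OF len] as bs by simp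
    have "p \<notin> S" "S \<subseteq> T"
      using insert by auto
    then have "body p \<inter> (\<Union>p\<in>S. body p) = {}"
      using body_disjoint[OF p] by blast
    moreover have "set I \<subseteq> body p" "set I \<inter> set P = {}"
      using as(3,4) bs(3,4) unfolding setI body_def by blast+
    moreover have "A \<inter> K = {}" if "B \<inter> U = {}" "A \<subseteq> B" "A \<inter> R = {}" "K \<subseteq> R \<union> U" for A B K R U :: "'a set"
      using that by blast
    ultimately have IC: "set I \<inter> set C = {}"
      using C(6) by meson
    define C' where "C' = us @ b # I @ a # vs"
    have cC: "cpairs C = cpairs (us @ [b]) \<union> insert (b, a) (cpairs (a # vs))"
      unfolding us using cpairs_split[of us b "a # vs"] by simp
    have cC': "cpairs C' = cpairs (us @ [b]) \<union> (cpairs (b # I @ [a]) \<union> cpairs (a # vs))"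
      unfolding C'_def using cpairs_split[of us b "I @ a # vs"] cpairs_split[of "b # I" a vs] by simp
    have "cpairs (b # I @ [a]) \<subseteq> G"
      unfolding I_def using cpairs_alternate[OF len as(3) bs(3) ab(1,2)] tileD[OF p] by blast
    then have "cpairs C' \<subseteq> G"
      unfolding cC' using C(3) cC by auto
    moreover have "distinct C'"
      using C(2) IC dI unfolding C'_def us by auto
    moreover have "last C' = last C" "hd C' = hd C"
      unfolding C'_def us by (auto simp: hd_append)
    moreover have "2 * (card (insert p S) * q) \<le> length C'"
      using C(5) lenI insert.hyps unfolding C'_def us by (simp add: algebra_simps)
    moreover have "set C' \<subseteq> set P \<union> (\<Union>p\<in>insert p S. body p)"
    proof -
      have "set C' = set C \<union> set I"
        unfolding C'_def us by auto
      moreover have "set I \<subseteq> body p"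
        unfolding setI body_def using as bs by blast
      ultimately show ?thesis
        using C(6) by auto
    qed
    moreover have "\<exists>b\<in>snd r. \<exists>a\<in>fst r. (b, a) \<in> cpairs C'" if r: "r \<in> T - insert p S" for r
    proof -
      obtain a' b' where ab': "b' \<in> snd r" "a' \<in> fst r" "(b', a') \<in> cpairs C"
        using C(7)[of r] r by blast
      have "body p \<inter> body r = {}"
        using body_disjoint[OF p, of r] r by blast
      then have "(b', a') \<noteq> (b, a)"
        using ab ab' unfolding body_def by auto
      then have "(b', a') \<in> cpairs C'"
        using ab'(3) unfolding cC cC' by auto
      then show ?thesis
        using ab' by blast
    qed
    ultimately show ?case
      using C(4) by (intro exI[of _ C']) (auto simp: C'_def)
  qed
  from this[OF finT order_refl] show ?thesis
    unfolding q_def by blast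
qed

end

section \<open>The structure of bipartite graphs without long cycles\<close>

definition cycle_list :: "('a \<times> 'a) set \<Rightarrow> 'a list \<Rightarrow> bool" where
  "cycle_list G C \<longleftrightarrow> 3 \<le> length C \<and> distinct C \<and> cpairs C \<subseteq> G \<and> (last C, hd C) \<in> G"

text \<open>Of the k t tiled vertices on each side the cycle may miss k (h + L + 1). As k t \<le> n
  and 2 (h + L + 1) \<le> \<epsilon> t, this is at most (\<epsilon> / 2) n, exactly the surplus over
  s assumed for k t.\<close>

lemma long_cycle_of_tiling:
  fixes \<epsilon> \<gamma> s :: real and n :: nat
  assumes "finite V" "G \<subseteq> V \<times> V" "sym G" "well_connected \<gamma> V G" "0 < \<gamma>" "\<gamma> \<le> 1"
    and "X \<inter> Y = {}" "X \<union> Y \<subseteq> V" "D \<subseteq> G" "has_tiling D t X Y k" "card X \<le> n" "0 < \<epsilon>" "0 < s"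
    and "h > 0" "16 * real (path_bound \<gamma> + 2) \<le> \<gamma>\<^sup>2 * real h" "t \<ge> h + path_bound \<gamma> + 3"
    and t: "2 * real (h + path_bound \<gamma> + 1) \<le> \<epsilon> * real t" and k: "real (k * t) \<ge> s + \<epsilon> / 2 * real n"
  shows "\<exists>C. cycle_list G C \<and> real (length C) \<ge> 2 * s"
proof -
  obtain T where T: "tiling D t X Y T" and Tk: "card T = k"
    using assms(10) unfolding has_tiling_def by blast
  have "k > 0"
  proof (rule ccontr)
    assume "\<not> k > 0"
    then have "s + \<epsilon> / 2 * real n \<le> 0"
      using k by simp
    moreover have "\<epsilon> / 2 * real n \<ge> 0"
      using assms(12) by simp
    ultimately show False
      using assms(13) by linarith
  qed
  then have "T \<noteq> {}"
    using Tk by auto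
  interpret tiled_graph V G \<gamma> X Y D t T h
    by unfold_locales (fact assms T \<open>T \<noteq> {}\<close>)+
  have "\<exists>C. C \<noteq> [] \<and> distinct C \<and> cpairs C \<subseteq> G \<and> (last C, hd C) \<in> G \<and>
      2 * (k * (t - (h + path_bound \<gamma> + 1))) \<le> length C"
    using long_cycle by (simp only: Tk)
  then obtain C where C: "C \<noteq> []" "distinct C" "cpairs C \<subseteq> G" "(last C, hd C) \<in> G"
      "2 * (k * (t - (h + path_bound \<gamma> + 1))) \<le> length C"
    by (elim exE conjE)
  have q: "t - (h + path_bound \<gamma> + 1) \<ge> 2"
    using assms(16) by linarith
  have "1 * 2 \<le> k * (t - (h + path_bound \<gamma> + 1))"
    using \<open>k > 0\<close> q by (intro mult_le_mono) auto
  then have "3 \<le> length C"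
    using C(5) by linarith
  moreover have "real (length C) \<ge> 2 * s"
  proof -
    define w where "w = h + path_bound \<gamma> + 1"
    have "k * t \<le> n"
      using card_tiling_le[OF finite_subset[OF _ assms(1)] assms(10)] assms(8,11) by auto
    then have "real (k * t) \<le> real n"
      by (simp only: of_nat_le_iff)
    then have "\<epsilon> * real (k * t) \<le> \<epsilon> * real n"
      using assms(12) by (intro mult_left_mono) auto
    moreover have "real k * (2 * real w) \<le> real k * (\<epsilon> * real t)"
      using t unfolding w_def by (intro mult_left_mono) auto
    ultimately have "real k * real w \<le> \<epsilon> / 2 * real n"
      by (simp add: algebra_simps)
    moreover have "real (k * (t - w)) = real (k * t) - real k * real w"
    proof -
      have "w \<le> t"
        using assms(16) unfolding w_def by linarith
      then show ?thesis
        by (simp add: of_nat_diff right_diff_distrib)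
    qed
    ultimately have "s \<le> real (k * (t - w))"
      using k by linarith
    moreover have "real (2 * (k * (t - w))) \<le> real (length C)"
      using C(5) unfolding w_def by (simp only: of_nat_le_iff)
    ultimately show ?thesis by simp
  qed
  ultimately show ?thesis
    using C unfolding cycle_list_def by blast
qed

text \<open>The bound s is for each part separately. There may be many parts, and K as a whole can
  be large.\<close>

definition part_cover :: "('a \<times> 'a) set \<Rightarrow> 'a set \<Rightarrow> real \<Rightarrow> ('a \<Rightarrow> nat) \<Rightarrow> 'a set \<Rightarrow> bool" where
  "part_cover D V s \<rho> K \<longleftrightarrow> (\<forall>x y. (x, y) \<in> D \<longrightarrow> \<rho> x = \<rho> y \<and> (x \<in> K \<or> y \<in> K)) \<and>
     (\<forall>i. real (card {v\<in>V. \<rho> v = i \<and> v \<in> K}) \<le> s)"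

text \<open>This replaces the regularity lemma.\<close>

theorem no_long_cycle_structure:
  fixes \<epsilon> :: real
  assumes "0 < \<epsilon>"
  shows "\<exists>n0. \<forall>n\<ge>n0. \<forall>(X::'a set) Y D s. finite X \<longrightarrow> finite Y \<longrightarrow> card X = n \<longrightarrow> card Y = n \<longrightarrow> X \<inter> Y = {} \<longrightarrow>
    D \<subseteq> X \<times> Y \<longrightarrow> s > 0 \<longrightarrow> \<not> (\<exists>C. cycle_list (D \<union> D\<inverse>) C \<and> real (length C) \<ge> 2 * s) \<longrightarrow>
    (\<exists>D'\<subseteq>D. \<exists>\<rho> K. real (card (D - D')) \<le> \<epsilon> * real n * real n \<and> part_cover D' (X \<union> Y) (s + \<epsilon> * real n) \<rho> K)"
proof -
  \<comment> \<open>Among 2 n vertices at most (2 n)^2 ordered pairs cross, so that the edges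
    between parts number at most (\<epsilon> / 2) n^2; the other half of the error is for the edges
    missed by the covers.\<close>
  define \<gamma> where "\<gamma> = min 1 (\<epsilon> / 8)"
  have \<gamma>: "0 < \<gamma>" "\<gamma> \<le> 1" "\<gamma> \<le> \<epsilon> / 8"
    using assms unfolding \<gamma>_def by auto
  define L where "L = path_bound \<gamma>"
  define h where "h = nat \<lceil>16 * real (L + 2) / \<gamma>\<^sup>2\<rceil> + 1"
  have h: "h > 0" "16 * real (L + 2) \<le> \<gamma>\<^sup>2 * real h"
  proof -
    have "16 * real (L + 2) / \<gamma>\<^sup>2 \<le> real h"
      unfolding h_def by linarith
    then show "16 * real (L + 2) \<le> \<gamma>\<^sup>2 * real h"
      using \<gamma>(1) by (simp add: field_simps)
  qed (simp add: h_def)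
  \<comment> \<open>The second summand leaves room for the skeleton; the first makes the loss of h +
    L + 1 vertices per tile side at most (\<epsilon> / 2) t.\<close>
  define t where "t = nat \<lceil>2 * real (h + L + 1) / \<epsilon>\<rceil> + (h + L + 3)"
  have t: "t \<ge> h + L + 3" "2 * real (h + L + 1) \<le> \<epsilon> * real t" "t > 0"
  proof -
    have "2 * real (h + L + 1) / \<epsilon> \<le> real t"
      unfolding t_def by linarith
    then show "2 * real (h + L + 1) \<le> \<epsilon> * real t"
      using assms by (simp add: field_simps)
  qed (simp_all add: t_def)
  obtain C :: nat where C: "\<And>(X::'a set) (Y::'a set) D N r. finite X \<Longrightarrow> finite Y \<Longrightarrow> D \<subseteq> X \<times> Y \<Longrightarrow> real (card X) \<le> N \<Longrightarrow> r > 0 \<Longrightarrow>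
     (\<exists>k. has_tiling D t X Y k \<and> real (k * t) \<ge> r) \<or>
     nearly_covered (\<epsilon> / 4) C D X Y (r + \<epsilon> / 4 * N)"
    using tiling_or_cover[of "\<epsilon> / 4" t, where ?'a = 'a and ?'b = 'a] assms t(3) by (metis divide_pos_pos zero_less_numeral)
  \<comment> \<open>This turns the linear error terms, 2 C n in total over all parts, into at most
    (\<epsilon> / 4) n^2.\<close>
  define n0 where "n0 = nat \<lceil>8 * real C / \<epsilon>\<rceil> + 1"
  show ?thesis
  proof (rule exI[of _ n0], intro allI impI)
    fix n X Y s and D :: "('a \<times> 'a) set"
    assume n: "n0 \<le> n" and fin: "finite X" "finite Y" and card: "card X = n" "card Y = n" and XY: "X \<inter> Y = {}"
      and D: "D \<subseteq> X \<times> Y" and s: "0 < (s::real)" and no: "\<not> (\<exists>C. cycle_list (D \<union> D\<inverse>) C \<and> real (length C) \<ge> 2 * s)"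
    have nC: "8 * real C \<le> \<epsilon> * real n"
    proof -
      have "8 * real C / \<epsilon> \<le> real n0"
        unfolding n0_def by linarith
      also have "\<dots> \<le> real n"
        using n by simp
      finally show ?thesis
        using assms by (simp add: field_simps)
    qed
    define V where "V = X \<union> Y"
    define G where "G = D \<union> D\<inverse>"
    have V: "finite V" "G \<subseteq> V \<times> V" "sym G"
      using fin D unfolding V_def G_def by (auto simp: sym_def)
    obtain \<rho> :: "'a \<Rightarrow> nat" where
      cross: "real (card {(u, v)\<in>G. \<rho> u \<noteq> \<rho> v}) \<le> \<gamma> * real (card {(u, v)\<in>V \<times> V. \<rho> u \<noteq> \<rho> v})"
      and wc: "\<And>i. well_connected \<gamma> {v\<in>V. \<rho> v = i} G"
      using well_connected_partition[OF V] by blast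
    define Xi where "Xi i = {x\<in>X. \<rho> x = i}" for i
    define Yi where "Yi i = {x\<in>Y. \<rho> x = i}" for i
    define Di where "Di i = D \<inter> Xi i \<times> Yi i" for i
    have finXi: "finite (Xi i)" "finite (Yi i)" for i
      using fin unfolding Xi_def Yi_def by auto
    have cardXi: "card (Xi i) \<le> n" "card (Yi i) \<le> n" for i
      using card fin card_mono[of X "Xi i"] card_mono[of Y "Yi i"] unfolding Xi_def Yi_def by auto
    have "\<exists>D'\<subseteq>Di i. \<exists>P\<subseteq>Xi i. \<exists>Q\<subseteq>Yi i. vertex_cover D' P Q \<and> real (card P + card Q) \<le> s + \<epsilon> / 2 * real n + \<epsilon> / 4 * real n \<and>
        real (card (Di i - D')) \<le> \<epsilon> / 4 * real (card (Xi i)) * real (card (Yi i)) + real C * (real (card (Xi i)) + real (card (Yi i)))" for i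
    proof -
      have notile: "\<not> (\<exists>k. has_tiling (Di i) t (Xi i) (Yi i) k \<and> s + \<epsilon> / 2 * real n \<le> real (k * t))"
      proof
        assume "\<exists>k. has_tiling (Di i) t (Xi i) (Yi i) k \<and> s + \<epsilon> / 2 * real n \<le> real (k * t)"
        then obtain k where k: "has_tiling (Di i) t (Xi i) (Yi i) k" "s + \<epsilon> / 2 * real n \<le> real (k * t)"
          by blast
        define W where "W = {v\<in>V. \<rho> v = i}"
        have "\<exists>C. cycle_list (G \<inter> W \<times> W) C \<and> real (length C) \<ge> 2 * s"
        proof (rule long_cycle_of_tiling[OF _ _ _ _ \<gamma>(1,2) _ _ _ k(1) cardXi(1) assms s h(1) h(2)[unfolded L_def] t(1)[unfolded L_def]
              t(2)[unfolded L_def] k(2)])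
          show "finite W"
            unfolding W_def using V(1) by simp
          show "sym (G \<inter> W \<times> W)"
            using V(3) unfolding sym_def by blast
          have "(G \<inter> W \<times> W) \<inter> S \<times> (W - S) = G \<inter> S \<times> (W - S)" if "S \<subseteq> W" for S
            using that by blast
          then show "well_connected \<gamma> W (G \<inter> W \<times> W)"
            using wc[of i] unfolding well_connected_def W_def by simp
          show "Xi i \<inter> Yi i = {}" "Xi i \<union> Yi i \<subseteq> W" "Di i \<subseteq> G \<inter> W \<times> W"
            using XY unfolding Xi_def Yi_def W_def V_def Di_def G_def by auto
        qed auto
        then obtain C where "cycle_list (G \<inter> W \<times> W) C" "real (length C) \<ge> 2 * s"
          by blast
        then have "cycle_list (D \<union> D\<inverse>) C \<and> real (length C) \<ge> 2 * s"
          unfolding cycle_list_def G_def by blast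
        then show False
          using no by blast
      qed
      have "s + \<epsilon> / 2 * real n > 0"
        using s assms by (simp add: add_pos_nonneg)
      moreover have "Di i \<subseteq> Xi i \<times> Yi i"
        unfolding Di_def by blast
      moreover have "real (card (Xi i)) \<le> real n"
        using cardXi(1) by simp
      ultimately show ?thesis
        using C[OF finXi(1)[of i] finXi(2)[of i], of "Di i" "real n" "s + \<epsilon> / 2 * real n"] notile unfolding nearly_covered_def by blast
    qed
    then obtain D' P Q where DPQ: "\<And>i. D' i \<subseteq> Di i" "\<And>i. P i \<subseteq> Xi i" "\<And>i. Q i \<subseteq> Yi i"
      "\<And>i. vertex_cover (D' i) (P i) (Q i)" "\<And>i. real (card (P i) + card (Q i)) \<le> s + \<epsilon> / 2 * real n + \<epsilon> / 4 * real n"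
      "\<And>i. real (card (Di i - D' i)) \<le> \<epsilon> / 4 * real (card (Xi i)) * real (card (Yi i)) + real C * (real (card (Xi i)) + real (card (Yi i)))"
      by metis
    define E where "E = (\<Union>i. D' i)"
    define K where "K = (\<Union>i. P i \<union> Q i)"
    have "E \<subseteq> D"
      unfolding E_def using DPQ(1) unfolding Di_def by blast
    moreover have "part_cover E (X \<union> Y) (s + \<epsilon> * real n) \<rho> K"
      unfolding part_cover_def
    proof (intro conjI allI impI)
      fix x y assume "(x, y) \<in> E"
      then obtain i where i: "(x, y) \<in> D' i"
        unfolding E_def by blast
      then have "(x, y) \<in> Di i"
        using DPQ(1) by blast
      then show "\<rho> x = \<rho> y"
        unfolding Di_def Xi_def Yi_def by simp
      have "x \<in> P i \<or> y \<in> Q i"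
        using DPQ(4)[of i] i unfolding vertex_cover_def by auto
      then show "x \<in> K \<or> y \<in> K"
        unfolding K_def by blast
    next
      fix i
      have "{v\<in>X \<union> Y. \<rho> v = i \<and> v \<in> K} \<subseteq> P i \<union> Q i"
      proof
        fix v assume v: "v \<in> {v\<in>X \<union> Y. \<rho> v = i \<and> v \<in> K}"
        then obtain j where j: "v \<in> P j \<or> v \<in> Q j"
          unfolding K_def by blast
        then have "\<rho> v = j"
          using DPQ(2,3)[of j] unfolding Xi_def Yi_def by blast
        then show "v \<in> P i \<union> Q i"
          using v j by blast
      qed
      moreover have "finite (P i \<union> Q i)"
        using DPQ(2,3)[of i] finXi[of i] finite_subset by blast
      ultimately have "card {v\<in>X \<union> Y. \<rho> v = i \<and> v \<in> K} \<le> card (P i) + card (Q i)"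
        by (meson card_Un_le card_mono order_trans)
      then have "real (card {v\<in>X \<union> Y. \<rho> v = i \<and> v \<in> K}) \<le> real (card (P i) + card (Q i))"
        by (simp only: of_nat_le_iff)
      also have "\<dots> \<le> s + \<epsilon> / 2 * real n + \<epsilon> / 4 * real n"
        by (rule DPQ(5))
      also have "\<dots> \<le> s + \<epsilon> * real n"
        using assms by simp
      finally show "real (card {v\<in>X \<union> Y. \<rho> v = i \<and> v \<in> K}) \<le> s + \<epsilon> * real n" .
    qed
    moreover have "real (card (D - E)) \<le> \<epsilon> * real n * real n"
    proof -
      define I where "I = \<rho> ` V"
      define Cr where "Cr = {(u, v)\<in>G. \<rho> u \<noteq> \<rho> v}"
      have finI: "finite I"
        unfolding I_def using V(1) by simp
      have finG: "finite G" "finite D"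
        using V(1,2) finite_subset[of G "V \<times> V"] unfolding G_def by auto
      have finCr: "finite Cr"
        by (rule finite_subset[OF _ finG(1)]) (auto simp: Cr_def)
      have "D - E \<subseteq> Cr \<union> (\<Union>i\<in>I. Di i - D' i)"
      proof
        fix e assume e: "e \<in> D - E"
        obtain x y where xy: "e = (x, y)" by (cases e)
        have "x \<in> X" "y \<in> Y"
          using e xy D by auto
        then show "e \<in> Cr \<union> (\<Union>i\<in>I. Di i - D' i)"
          using e xy unfolding Cr_def G_def I_def V_def Di_def Xi_def Yi_def E_def by auto
      qed
      moreover have "finite (\<Union>i\<in>I. Di i - D' i)"
        using finI finG unfolding Di_def by auto
      ultimately have "card (D - E) \<le> card Cr + card (\<Union>i\<in>I. Di i - D' i)"
        using finCr by (meson card_Un_le card_mono finite_Un order_trans)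
      also have "\<dots> \<le> card Cr + (\<Sum>i\<in>I. card (Di i - D' i))"
        using card_UN_le[OF finI] by simp
      finally have "real (card (D - E)) \<le> real (card Cr + (\<Sum>i\<in>I. card (Di i - D' i)))"
        by (simp only: of_nat_le_iff)
      then have 1: "real (card (D - E)) \<le> real (card Cr) + (\<Sum>i\<in>I. real (card (Di i - D' i)))"
        by simp
      have "card {(u, v)\<in>V \<times> V. \<rho> u \<noteq> \<rho> v} \<le> card (V \<times> V)"
        using V(1) by (intro card_mono) auto
      also have "\<dots> = (2 * n) * (2 * n)"
        using card fin XY unfolding V_def by (simp add: card_cartesian_product card_Un_disjoint mult_2)
      finally have "real (card {(u, v)\<in>V \<times> V. \<rho> u \<noteq> \<rho> v}) \<le> real ((2 * n) * (2 * n))"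
        by (simp only: of_nat_le_iff)
      then have "\<gamma> * real (card {(u, v)\<in>V \<times> V. \<rho> u \<noteq> \<rho> v}) \<le> \<epsilon> / 8 * real ((2 * n) * (2 * n))"
        using \<gamma> assms by (intro mult_mono) auto
      then have 2: "real (card Cr) \<le> \<epsilon> / 2 * real n * real n"
        using cross unfolding Cr_def by simp
      have sumX: "(\<Sum>i\<in>I. card (Xi i)) = n" "(\<Sum>i\<in>I. card (Yi i)) = n"
      proof -
        have "(\<Sum>i\<in>I. card (Xi i)) = card (\<Union>i\<in>I. Xi i)"
          by (rule card_UN_disjoint[symmetric]) (use finI finXi in \<open>auto simp: Xi_def\<close>)
        also have "(\<Union>i\<in>I. Xi i) = X"
          unfolding I_def V_def Xi_def by auto
        finally show "(\<Sum>i\<in>I. card (Xi i)) = n"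
          using card by simp
        have "(\<Sum>i\<in>I. card (Yi i)) = card (\<Union>i\<in>I. Yi i)"
          by (rule card_UN_disjoint[symmetric]) (use finI finXi in \<open>auto simp: Yi_def\<close>)
        also have "(\<Union>i\<in>I. Yi i) = Y"
          unfolding I_def V_def Yi_def by auto
        finally show "(\<Sum>i\<in>I. card (Yi i)) = n"
          using card by simp
      qed
      have "(\<Sum>i\<in>I. real (card (Di i - D' i))) \<le>
          (\<Sum>i\<in>I. (\<epsilon> / 4 * real n + real C) * real (card (Xi i)) + real C * real (card (Yi i)))"
      proof (rule sum_mono)
        fix i
        have "\<epsilon> / 4 * real (card (Xi i)) * real (card (Yi i)) \<le> \<epsilon> / 4 * real (card (Xi i)) * real n"
          using assms cardXi by (intro mult_left_mono) auto
        then show "real (card (Di i - D' i)) \<le> (\<epsilon> / 4 * real n + real C) * real (card (Xi i)) + real C * real (card (Yi i))"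
          using DPQ(6)[of i] by (simp add: algebra_simps)
      qed
      also have "\<dots> = (\<epsilon> / 4 * real n + real C) * real (\<Sum>i\<in>I. card (Xi i)) + real C * real (\<Sum>i\<in>I. card (Yi i))"
        by (simp add: sum.distrib sum_distrib_left)
      also have "\<dots> = (\<epsilon> / 4 * real n + 2 * real C) * real n"
        unfolding sumX by (simp add: algebra_simps)
      also have "\<dots> \<le> (\<epsilon> / 4 * real n + \<epsilon> / 4 * real n) * real n"
        using nC by (intro mult_right_mono) auto
      finally have "(\<Sum>i\<in>I. real (card (Di i - D' i))) \<le> \<epsilon> / 2 * real n * real n"
        by simp
      then show ?thesis
        using 1 2 by simp
    qed
    ultimately show "\<exists>D'\<subseteq>D. \<exists>\<rho> K. real (card (D - D')) \<le> \<epsilon> * real n * real n \<and> part_cover D' (X \<union> Y) (s + \<epsilon> * real n) \<rho> K"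
      by blast
  qed
qed

section \<open>Two partitions with small covers\<close>

definition covered :: "'a set \<Rightarrow> ('a \<Rightarrow> nat) \<Rightarrow> 'a set \<Rightarrow> nat \<Rightarrow> 'a set" where
  "covered X \<rho> C i = {x\<in>X. \<rho> x = i \<and> x \<in> C}"

definition nbs :: "('a \<times> 'a) set \<Rightarrow> 'a set \<Rightarrow> 'a \<Rightarrow> 'a set" where
  "nbs E Y x = {y\<in>Y. (x, y) \<in> E}"

text \<open>Red is described by the labels \<open>\<rho>\<close> and the cover C, blue by
  \<open>\<beta>\<close> and K. The colours of edges are not recorded, only that one of the two
  descriptions fits. The notion is symmetric in the colours and in the sides, so that an argument
  for one side or colour can be reused for the other.\<close>

definition split_graph :: "'a set \<Rightarrow> 'a set \<Rightarrow> ('a \<times> 'a) set \<Rightarrow> ('a \<Rightarrow> nat) \<Rightarrow> 'a set \<Rightarrow> ('a \<Rightarrow> nat) \<Rightarrow> 'a set \<Rightarrow> real \<Rightarrow> real \<Rightarrow> bool" where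
  "split_graph X Y E \<rho> C \<beta> K d s \<longleftrightarrow> finite X \<and> finite Y \<and>
     (\<forall>x\<in>X. \<forall>y\<in>Y. (x, y) \<in> E \<longrightarrow> \<rho> x = \<rho> y \<and> (x \<in> C \<or> y \<in> C) \<or> \<beta> x = \<beta> y \<and> (x \<in> K \<or> y \<in> K)) \<and>
     (\<forall>i. real (card (covered X \<rho> C i)) + real (card (covered Y \<rho> C i)) < s) \<and>
     (\<forall>i. real (card (covered X \<beta> K i)) + real (card (covered Y \<beta> K i)) < s) \<and>
     (\<forall>x\<in>X. d \<le> real (card (nbs E Y x))) \<and> (\<forall>y\<in>Y. d \<le> real (card (nbs (E\<inverse>) X y)))"

lemma split_graph_swap_colour: "split_graph X Y E \<rho> C \<beta> K d s \<Longrightarrow> split_graph X Y E \<beta> K \<rho> C d s"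
  unfolding split_graph_def by blast

lemma split_graph_swap_side: "split_graph X Y E \<rho> C \<beta> K d s \<Longrightarrow> split_graph Y X (E\<inverse>) \<rho> C \<beta> K d s"
  unfolding split_graph_def by (simp add: add.commute) metis

lemma split_graphD:
  assumes "split_graph X Y E \<rho> C \<beta> K d s"
  shows "finite X" "finite Y"
    "\<And>x y. x \<in> X \<Longrightarrow> y \<in> Y \<Longrightarrow> (x, y) \<in> E \<Longrightarrow> \<rho> x = \<rho> y \<and> (x \<in> C \<or> y \<in> C) \<or> \<beta> x = \<beta> y \<and> (x \<in> K \<or> y \<in> K)"
    "\<And>i. real (card (covered X \<rho> C i)) + real (card (covered Y \<rho> C i)) < s"
    "\<And>i. real (card (covered X \<beta> K i)) + real (card (covered Y \<beta> K i)) < s"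
    "\<And>x. x \<in> X \<Longrightarrow> d \<le> real (card (nbs E Y x))" "\<And>y. y \<in> Y \<Longrightarrow> d \<le> real (card (nbs (E\<inverse>) X y))"
    "finite (covered X \<rho> C i)" "finite (covered Y \<rho> C i)" "finite (covered X \<beta> K i)" "finite (covered Y \<beta> K i)"
    "finite (nbs E Y x)" "finite (nbs (E\<inverse>) X x)" "s > 0"
proof -
  note * = assms[unfolded split_graph_def]
  show fin: "finite X" "finite Y" using * by blast+
  show "\<And>x y. x \<in> X \<Longrightarrow> y \<in> Y \<Longrightarrow> (x, y) \<in> E \<Longrightarrow> \<rho> x = \<rho> y \<and> (x \<in> C \<or> y \<in> C) \<or> \<beta> x = \<beta> y \<and> (x \<in> K \<or> y \<in> K)"
    "\<And>i. real (card (covered X \<beta> K i)) + real (card (covered Y \<beta> K i)) < s"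
    "\<And>x. x \<in> X \<Longrightarrow> d \<le> real (card (nbs E Y x))" "\<And>y. y \<in> Y \<Longrightarrow> d \<le> real (card (nbs (E\<inverse>) X y))"
    using * by blast+
  show c: "\<And>i. real (card (covered X \<rho> C i)) + real (card (covered Y \<rho> C i)) < s"
    using * by blast
  show "finite (covered X \<rho> C i)" "finite (covered Y \<rho> C i)" "finite (covered X \<beta> K i)" "finite (covered Y \<beta> K i)"
    "finite (nbs E Y x)" "finite (nbs (E\<inverse>) X x)"
    using fin unfolding covered_def nbs_def by auto
  show "s > 0"
    using c[of 0] by linarith
qed

lemma card_le_Un:
  assumes "A \<subseteq> B \<union> C" "finite B" "finite C"
  shows "real (card A) \<le> real (card B) + real (card C)"
proof -
  have "card A \<le> card (B \<union> C)"
    using assms by (intro card_mono) auto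
  also have "\<dots> \<le> card B + card C"
    by (rule card_Un_le)
  finally show ?thesis
    by (simp flip: of_nat_add)
qed

lemma card_le_Un3:
  assumes "A \<subseteq> B \<union> C \<union> D" "finite B" "finite C" "finite D"
  shows "real (card A) \<le> real (card B) + real (card C) + real (card D)"
  using card_le_Un[of A "B \<union> C" D] card_le_Un[of "B \<union> C" B C] assms by fastforce

lemma meet_if_large:
  assumes "A \<subseteq> U" "B \<subseteq> U" "finite U" "real (card U) < real (card A) + real (card B)"
  shows "\<exists>z. z \<in> A \<and> z \<in> B"
proof (rule ccontr)
  assume "\<not> ?thesis"
  then have "A \<inter> B = {}" by blast
  moreover have "finite A" "finite B"
    using assms finite_subset by blast+
  ultimately have "card (A \<union> B) = card A + card B"
    by (simp add: card_Un_disjoint)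
  moreover have "card (A \<union> B) \<le> card U"
    using assms by (intro card_mono) auto
  ultimately show False
    using assms(4) by linarith
qed

lemma card_split_label:
  assumes "finite X"
  shows "real (card X) = real (card {x\<in>X. \<rho> x = i}) + real (card {x\<in>X. \<rho> x \<noteq> i})"
proof -
  have "X = {x\<in>X. \<rho> x = i} \<union> {x\<in>X. \<rho> x \<noteq> i}"
    by auto
  then have "card X = card ({x\<in>X. \<rho> x = i} \<union> {x\<in>X. \<rho> x \<noteq> i})"
    by simp
  also have "\<dots> = card {x\<in>X. \<rho> x = i} + card {x\<in>X. \<rho> x \<noteq> i}"
    using assms by (intro card_Un_disjoint) auto
  finally show ?thesis by simp
qed

lemma card_less_by_label:
  fixes \<beta> :: "'a \<Rightarrow> nat"
  assumes "finite A" "finite B" "A \<noteq> {}"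
    and "\<And>a. a \<in> A \<Longrightarrow> card {x\<in>A. \<beta> x = \<beta> a} < card {x\<in>B. \<beta> x = \<beta> a}"
  shows "card A < card B"
proof -
  have "A = (\<Union>j\<in>\<beta> ` A. {x\<in>A. \<beta> x = j})"
    by auto
  then have "card A = card (\<Union>j\<in>\<beta> ` A. {x\<in>A. \<beta> x = j})"
    by (rule arg_cong)
  also have "\<dots> = (\<Sum>j\<in>\<beta> ` A. card {x\<in>A. \<beta> x = j})"
    by (rule card_UN_disjoint) (use assms in auto)
  also have "\<dots> < (\<Sum>j\<in>\<beta> ` A. card {x\<in>B. \<beta> x = j})"
    using assms by (intro sum_strict_mono) auto
  also have "\<dots> = card (\<Union>j\<in>\<beta> ` A. {x\<in>B. \<beta> x = j})"
    by (rule card_UN_disjoint[symmetric]) (use assms in auto)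
  also have "\<dots> \<le> card B"
    using assms(2) by (intro card_mono) auto
  finally show ?thesis .
qed

text \<open>A neighbour of a vertex x in neither cover has to be covered itself, in the red or in
  the blue part of x. There are fewer than 2 s \<le> d such vertices.\<close>

lemma split_graph_covered_vertex:
  assumes G: "split_graph X Y E \<rho> C \<beta> K d s" and "2 * s \<le> d" "x \<in> X"
  shows "x \<in> C \<or> x \<in> K"
proof (rule ccontr)
  assume no: "\<not> ?thesis"
  note D = split_graphD[OF G]
  have "nbs E Y x \<subseteq> covered Y \<rho> C (\<rho> x) \<union> covered Y \<beta> K (\<beta> x)"
  proof
    fix y assume "y \<in> nbs E Y x"
    then show "y \<in> covered Y \<rho> C (\<rho> x) \<union> covered Y \<beta> K (\<beta> x)"
      using D(3)[of x y] assms(3) no by (auto simp: nbs_def covered_def)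
  qed
  then have "real (card (nbs E Y x)) \<le> real (card (covered Y \<rho> C (\<rho> x))) + real (card (covered Y \<beta> K (\<beta> x)))"
    by (rule card_le_Un) (rule D)+
  then show False
    using D(6)[OF assms(3)] D(4)[of "\<rho> x"] D(5)[of "\<beta> x"] assms(2) by linarith
qed

text \<open>The comparison is made inside each blue part that meets X - C. Let this part have kX and
  kY blue-covered vertices in X and Y. For x in X - C, red edges end in fewer than s red-covered
  vertices, so more than 2 s - s - kY > kX neighbours of x are blue-uncovered and in its blue part.
  On the other side, all vertices of X - C in the part are blue-covered, hence at most kX
  many.\<close>

lemma split_graph_uncovered_less:
  assumes G: "split_graph X Y E \<rho> C \<beta> K d s" and s: "2 * s \<le> d" and "X - C \<noteq> {}"
  shows "card (X - C) < card (Y - K)"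
proof (rule card_less_by_label)
  note D = split_graphD[OF G]
  fix x assume x: "x \<in> X - C"
  have "nbs E Y x \<subseteq> covered Y \<rho> C (\<rho> x) \<union> covered Y \<beta> K (\<beta> x) \<union> {y\<in>Y - K. \<beta> y = \<beta> x}"
  proof
    fix y assume "y \<in> nbs E Y x"
    then show "y \<in> covered Y \<rho> C (\<rho> x) \<union> covered Y \<beta> K (\<beta> x) \<union> {y\<in>Y - K. \<beta> y = \<beta> x}"
      using D(3)[of x y] x by (auto simp: nbs_def covered_def)
  qed
  then have "real (card (nbs E Y x)) \<le> real (card (covered Y \<rho> C (\<rho> x))) + real (card (covered Y \<beta> K (\<beta> x)))
      + real (card {y\<in>Y - K. \<beta> y = \<beta> x})"
    by (rule card_le_Un3) (use D in auto)
  then have "real (card (covered X \<beta> K (\<beta> x))) < real (card {y\<in>Y - K. \<beta> y = \<beta> x})"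
    using D(6)[of x] x D(4)[of "\<rho> x"] D(5)[of "\<beta> x"] s by auto
  moreover have "{z\<in>X - C. \<beta> z = \<beta> x} \<subseteq> covered X \<beta> K (\<beta> x)"
    using split_graph_covered_vertex[OF G s] unfolding covered_def by auto
  then have "card {z\<in>X - C. \<beta> z = \<beta> x} \<le> card (covered X \<beta> K (\<beta> x))"
    using D by (intro card_mono) auto
  ultimately show "card {z\<in>X - C. \<beta> z = \<beta> x} < card {y\<in>Y - K. \<beta> y = \<beta> x}"
    by linarith
qed (use split_graphD(1,2)[OF G] assms(3) in auto)

text \<open>Swapping both sides and colours reverses the strict comparison of X - C with Y - K, so
  neither set can be nonempty.\<close>

lemma split_graph_all_covered:
  assumes G: "split_graph X Y E \<rho> C \<beta> K d s" and s: "2 * s \<le> d"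
  shows "X \<subseteq> C" "Y \<subseteq> K"
proof -
  have 1: "X - C \<noteq> {} \<Longrightarrow> card (X - C) < card (Y - K)"
    by (rule split_graph_uncovered_less[OF G s])
  have 2: "Y - K \<noteq> {} \<Longrightarrow> card (Y - K) < card (X - C)"
    by (rule split_graph_uncovered_less[OF split_graph_swap_colour[OF split_graph_swap_side[OF G]] s])
  show "X \<subseteq> C"
    using 1 2 by (metis Diff_eq_empty_iff card.empty not_less_zero order_less_asym)
  show "Y \<subseteq> K"
    using 1 2 by (metis Diff_eq_empty_iff card.empty not_less_zero order_less_asym)
qed

theorem split_graph_half_degree:
  assumes G: "split_graph X Y E \<rho> C \<beta> K d s" and "X \<noteq> {}"
  shows "d < 2 * s"
proof (rule ccontr)
  assume "\<not> ?thesis"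
  then have s: "2 * s \<le> d" by simp
  note D = split_graphD[OF G]
  obtain x where x: "x \<in> X"
    using assms(2) by blast
  have "Y \<subseteq> K" "Y \<subseteq> C"
    using split_graph_all_covered(2)[OF G s] split_graph_all_covered(2)[OF split_graph_swap_colour[OF G] s] by blast+
  have "nbs E Y x \<subseteq> covered Y \<rho> C (\<rho> x) \<union> covered Y \<beta> K (\<beta> x)"
  proof
    fix y assume "y \<in> nbs E Y x"
    then show "y \<in> covered Y \<rho> C (\<rho> x) \<union> covered Y \<beta> K (\<beta> x)"
      using D(3)[of x y] x \<open>Y \<subseteq> K\<close> \<open>Y \<subseteq> C\<close> by (auto simp: nbs_def covered_def)
  qed
  then have "real (card (nbs E Y x)) \<le> real (card (covered Y \<rho> C (\<rho> x))) + real (card (covered Y \<beta> K (\<beta> x)))"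
    by (rule card_le_Un) (rule D)+
  then show False
    using D(6)[OF x] D(4)[of "\<rho> x"] D(5)[of "\<beta> x"] s by linarith
qed

text \<open>The inequalities of the regime \<delta> > 2/3. Two consequences recur below: n - d < s
  \<le> 2 d - n gives 3 d > 2 n, and 2 s \<le> n together with s \<le> 2 d - n gives 3 s \<le> 2 d.
  The sides may be slightly smaller than n, to allow for the deletion of vertices that have lost
  many edges.\<close>

definition tight_graph :: "'a set \<Rightarrow> 'a set \<Rightarrow> ('a \<times> 'a) set \<Rightarrow> ('a \<Rightarrow> nat) \<Rightarrow> 'a set \<Rightarrow> ('a \<Rightarrow> nat) \<Rightarrow> 'a set \<Rightarrow> real \<Rightarrow> real \<Rightarrow> real \<Rightarrow> bool" where
  "tight_graph X Y E \<rho> C \<beta> K d s n \<longleftrightarrow> split_graph X Y E \<rho> C \<beta> K d s \<and> real (card X) \<le> n \<and> real (card Y) \<le> n \<and>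
     2 * s \<le> real (card X) \<and> 2 * s \<le> real (card Y) \<and> n - d < s \<and> s \<le> 2 * d - n"

lemma tight_graph_swap_colour: "tight_graph X Y E \<rho> C \<beta> K d s n \<Longrightarrow> tight_graph X Y E \<beta> K \<rho> C d s n"
  unfolding tight_graph_def using split_graph_swap_colour by blast

lemma tight_graph_swap_side: "tight_graph X Y E \<rho> C \<beta> K d s n \<Longrightarrow> tight_graph Y X (E\<inverse>) \<rho> C \<beta> K d s n"
  unfolding tight_graph_def using split_graph_swap_side by blast

text \<open>Let b be the red-covered vertices of part i in Y. Since |b| < s \<le> 2 d - n, the
  vertices x and x' have a common neighbour outside b. Neither of the two edges to it can be red, as
  no end is covered there, so its blue label is that of x and of x'.\<close>

lemma tight_graph_same_label:
  assumes G: "tight_graph X Y E \<rho> C \<beta> K d s n"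
    and x: "x \<in> X" "\<rho> x = i" "x \<notin> C" and x': "x' \<in> X" "\<rho> x' = i" "x' \<notin> C"
  shows "\<beta> x = \<beta> x'"
proof -
  note H = G[unfolded tight_graph_def]
  note D = split_graphD[OF conjunct1[OF H]]
  define b where "b = covered Y \<rho> C i"
  have b: "finite b" "b \<subseteq> Y" "real (card b) < s"
    using D(4)[of i] D(2) unfolding b_def covered_def by auto
  have size: "real (card (nbs E Y z - b)) \<ge> d - real (card b)" if "z \<in> X" for z
  proof -
    have "real (card (nbs E Y z)) \<le> real (card (nbs E Y z - b)) + real (card b)"
      by (rule card_le_Un) (use b D(2) in \<open>auto simp: nbs_def\<close>)
    then show ?thesis
      using D(6)[OF that] by linarith
  qed
  have "card b \<le> card Y"
    using b D(2) by (intro card_mono) auto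
  then have "real (card (Y - b)) = real (card Y) - real (card b)"
    using b by (simp add: card_Diff_subset of_nat_diff)
  then have "\<exists>y. y \<in> nbs E Y x - b \<and> y \<in> nbs E Y x' - b"
    using size[OF x(1)] size[OF x'(1)] H b(3) D(2)
    by (intro meet_if_large[of _ "Y - b"]) (auto simp: nbs_def)
  then obtain y where y: "y \<in> Y" "(x, y) \<in> E" "(x', y) \<in> E" "y \<notin> b"
    unfolding nbs_def by blast
  have "\<beta> x = \<beta> y"
    using D(3)[OF x(1) y(1,2)] x y(1,4) unfolding b_def covered_def by auto
  moreover have "\<beta> x' = \<beta> y"
    using D(3)[OF x'(1) y(1,3)] x' y(1,4) unfolding b_def covered_def by auto
  ultimately show ?thesis by simp
qed

text \<open>By assumption part i of X is covered by the sets a and a' of red-covered and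
  blue-covered vertices. If part i of Y were covered by b and b' as well, then |X| + |Y| < 4 s. So
  some y of part i is in neither cover; its neighbours are in a or a', whence d \<le> |a| + |a'|.
  This leaves so little for b and b' that every x has to be in a or a', and |X| < 2 s.\<close>

lemma tight_graph_one_label:
  assumes G: "tight_graph X Y E \<rho> C \<beta> K d s n"
    and x2: "real (card {x\<in>X. \<rho> x \<noteq> i}) < s" and y2: "real (card {y\<in>Y. \<rho> y \<noteq> i}) < s"
    and lab: "\<And>x. x \<in> X \<Longrightarrow> \<rho> x = i \<Longrightarrow> x \<notin> C \<Longrightarrow> \<beta> x = j" "\<And>y. y \<in> Y \<Longrightarrow> \<rho> y = i \<Longrightarrow> y \<notin> C \<Longrightarrow> \<beta> y = j"
    and cov: "\<And>x. x \<in> X \<Longrightarrow> \<rho> x = i \<Longrightarrow> x \<notin> C \<Longrightarrow> x \<in> K"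
  shows False
proof -
  note H = G[unfolded tight_graph_def]
  note D = split_graphD[OF conjunct1[OF H]]
  define a b a' b' where "a = covered X \<rho> C i" and "b = covered Y \<rho> C i"
    and "a' = covered X \<beta> K j" and "b' = covered Y \<beta> K j"
  have fin: "finite a" "finite b" "finite a'" "finite b'"
    using D unfolding a_def b_def a'_def b'_def by auto
  have ab: "real (card a) + real (card b) < s" "real (card a') + real (card b') < s"
    using D(4)[of i] D(5)[of j] unfolding a_def b_def a'_def b'_def by auto
  note X12 = card_split_label[OF D(1), of \<rho> i] and Y12 = card_split_label[OF D(2), of \<rho> i]
  have X1: "{x\<in>X. \<rho> x = i} \<subseteq> a \<union> a'"
    using lab(1) cov unfolding a_def a'_def covered_def by auto
  have "\<exists>y. y \<in> Y \<and> \<rho> y = i \<and> y \<notin> C \<and> y \<notin> K"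
  proof (rule ccontr)
    assume "\<not> ?thesis"
    then have Y1: "{y\<in>Y. \<rho> y = i} \<subseteq> b \<union> b'"
      using lab(2) unfolding b_def b'_def covered_def by auto
    show False
      using card_le_Un[OF X1 fin(1,3)] card_le_Un[OF Y1 fin(2,4)] X12 Y12 H x2 y2 ab by linarith
  qed
  then obtain y where y: "y \<in> Y" "\<rho> y = i" "y \<notin> C" "y \<notin> K"
    by blast
  have "nbs (E\<inverse>) X y \<subseteq> a \<union> a'"
  proof
    fix x assume "x \<in> nbs (E\<inverse>) X y"
    then show "x \<in> a \<union> a'"
      using D(3)[of x y] y lab(2)[OF y(1-3)] unfolding nbs_def a_def a'_def covered_def by auto
  qed
  then have "real (card (nbs (E\<inverse>) X y)) \<le> real (card a) + real (card a')"
    by (rule card_le_Un) (rule fin)+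
  then have aa: "d \<le> real (card a) + real (card a')"
    using D(7)[OF y(1)] by linarith
  have "X \<subseteq> a \<union> a'"
  proof
    fix x assume x: "x \<in> X"
    show "x \<in> a \<union> a'"
    proof (rule ccontr)
      assume no: "x \<notin> a \<union> a'"
      then have r: "\<rho> x \<noteq> i" and k: "\<not> (\<beta> x = j \<and> x \<in> K)"
        using X1 x unfolding a'_def covered_def by auto
      have "nbs E Y x \<subseteq> b \<union> b' \<union> {y\<in>Y. \<rho> y \<noteq> i}"
      proof
        fix z assume z: "z \<in> nbs E Y x"
        show "z \<in> b \<union> b' \<union> {y\<in>Y. \<rho> y \<noteq> i}"
        proof (rule ccontr)
          assume z': "z \<notin> b \<union> b' \<union> {y\<in>Y. \<rho> y \<noteq> i}"
          then have zz: "z \<in> Y" "\<rho> z = i" "z \<notin> C" "(x, z) \<in> E"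
            using z unfolding nbs_def b_def covered_def by auto
          then have "\<beta> z = j"
            using lab(2) by blast
          then show False
            using D(3)[OF x zz(1,4)] zz r k z' unfolding b'_def covered_def by auto
        qed
      qed
      \<comment> \<open>Here |b| + |b'| < 2 s - d, and fewer than s vertices of Y lie outside part
        i; so the degree would be below 3 s - d \<le> d.\<close>
      then have "real (card (nbs E Y x)) \<le> real (card b) + real (card b') + real (card {y\<in>Y. \<rho> y \<noteq> i})"
        by (rule card_le_Un3) (use fin D(2) in auto)
      then show False
        using D(6)[OF x] aa ab y2 H by linarith
    qed
  qed
  then have "real (card X) \<le> real (card a) + real (card a')"
    by (rule card_le_Un) (rule fin)+
  then show False
    using ab H by linarith
qed

text \<open>Otherwise the red-uncovered vertices of part i have a single blue label on each side. If
  the two labels differ, there is no edge between these vertices, and the degrees of one from each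
  side add up to less than 3 s \<le> 2 d. If they agree, one side has all of them blue-covered,
  since two vertices in neither cover, one from each side, would have total degree below 2 s; this
  is the situation of \<open>tight_graph_one_label\<close>.\<close>

lemma tight_graph_one_side_large:
  assumes G: "tight_graph X Y E \<rho> C \<beta> K d s n"
  shows "s \<le> real (card {x\<in>X. \<rho> x \<noteq> i}) \<or> s \<le> real (card {y\<in>Y. \<rho> y \<noteq> i})"
proof (rule ccontr)
  assume "\<not> ?thesis"
  then have x2: "real (card {x\<in>X. \<rho> x \<noteq> i}) < s" and y2: "real (card {y\<in>Y. \<rho> y \<noteq> i}) < s"
    by auto
  note H = G[unfolded tight_graph_def]
  note D = split_graphD[OF conjunct1[OF H]]
  define a b where "a = covered X \<rho> C i" and "b = covered Y \<rho> C i"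
  have fin: "finite a" "finite b"
    using D unfolding a_def b_def by auto
  have ab: "real (card a) + real (card b) < s"
    using D(4)[of i] unfolding a_def b_def by auto
  note X12 = card_split_label[OF D(1), of \<rho> i] and Y12 = card_split_label[OF D(2), of \<rho> i]
  have "\<exists>x. x \<in> X \<and> \<rho> x = i \<and> x \<notin> C"
  proof (rule ccontr)
    assume "\<not> ?thesis"
    then have "{x\<in>X. \<rho> x = i} \<subseteq> a \<union> {}"
      unfolding a_def covered_def by auto
    then have "real (card {x\<in>X. \<rho> x = i}) \<le> real (card a)"
      using card_le_Un[of _ a "{}"] fin by simp
    then show False
      using X12 x2 H ab by linarith
  qed
  then obtain x where x: "x \<in> X" "\<rho> x = i" "x \<notin> C" by blast
  have "\<exists>y. y \<in> Y \<and> \<rho> y = i \<and> y \<notin> C"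
  proof (rule ccontr)
    assume "\<not> ?thesis"
    then have "{x\<in>Y. \<rho> x = i} \<subseteq> b \<union> {}"
      unfolding b_def covered_def by auto
    then have "real (card {x\<in>Y. \<rho> x = i}) \<le> real (card b)"
      using card_le_Un[of _ b "{}"] fin by simp
    then show False
      using Y12 y2 H ab by linarith
  qed
  then obtain y where y: "y \<in> Y" "\<rho> y = i" "y \<notin> C" by blast
  have labX: "\<beta> z = \<beta> x" if "z \<in> X" "\<rho> z = i" "z \<notin> C" for z
    using tight_graph_same_label[OF G that x] .
  have labY: "\<beta> z = \<beta> y" if "z \<in> Y" "\<rho> z = i" "z \<notin> C" for z
    using tight_graph_same_label[OF tight_graph_swap_side[OF G] that y] .
  show False
  proof (cases "\<beta> x = \<beta> y")
    case False
    have no: "(u, v) \<notin> E" if "u \<in> X" "\<rho> u = i" "u \<notin> C" "v \<in> Y" "\<rho> v = i" "v \<notin> C" for u v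
      using D(3)[of u v] that labX[of u] labY[of v] False by auto
    have "nbs E Y x \<subseteq> b \<union> {y\<in>Y. \<rho> y \<noteq> i}"
      using no[OF x] unfolding nbs_def b_def covered_def by auto
    then have "real (card (nbs E Y x)) \<le> real (card b) + real (card {y\<in>Y. \<rho> y \<noteq> i})"
      by (rule card_le_Un) (use fin D(2) in auto)
    moreover have "nbs (E\<inverse>) X y \<subseteq> a \<union> {x\<in>X. \<rho> x \<noteq> i}"
      using no[OF _ _ _ y] unfolding nbs_def a_def covered_def by auto
    then have "real (card (nbs (E\<inverse>) X y)) \<le> real (card a) + real (card {x\<in>X. \<rho> x \<noteq> i})"
      by (rule card_le_Un) (use fin D(1) in auto)
    ultimately show False
      using D(6)[OF x(1)] D(7)[OF y(1)] x2 y2 ab H by linarith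
  next
    case True
    define j where "j = \<beta> x"
    have lab: "\<And>x. x \<in> X \<Longrightarrow> \<rho> x = i \<Longrightarrow> x \<notin> C \<Longrightarrow> \<beta> x = j" "\<And>y. y \<in> Y \<Longrightarrow> \<rho> y = i \<Longrightarrow> y \<notin> C \<Longrightarrow> \<beta> y = j"
      using labX labY True unfolding j_def by auto
    define a' b' where "a' = covered X \<beta> K j" and "b' = covered Y \<beta> K j"
    have fin': "finite a'" "finite b'"
      using D unfolding a'_def b'_def by auto
    have ab': "real (card a') + real (card b') < s"
      using D(5)[of j] unfolding a'_def b'_def by auto
    have "(\<forall>x\<in>X. \<rho> x = i \<longrightarrow> x \<notin> C \<longrightarrow> x \<in> K) \<or> (\<forall>y\<in>Y. \<rho> y = i \<longrightarrow> y \<notin> C \<longrightarrow> y \<in> K)"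
    proof (rule ccontr)
      assume "\<not> ?thesis"
      then obtain u v where u: "u \<in> X" "\<rho> u = i" "u \<notin> C" "u \<notin> K" and v: "v \<in> Y" "\<rho> v = i" "v \<notin> C" "v \<notin> K"
        by blast
      have "nbs E Y u \<subseteq> b \<union> b'"
      proof
        fix z assume "z \<in> nbs E Y u"
        then show "z \<in> b \<union> b'"
          using D(3)[of u z] u lab(1)[OF u(1-3)] unfolding nbs_def b_def b'_def covered_def by auto
      qed
      then have 1: "real (card (nbs E Y u)) \<le> real (card b) + real (card b')"
        by (rule card_le_Un) (use fin fin' in auto)
      have "nbs (E\<inverse>) X v \<subseteq> a \<union> a'"
      proof
        fix z assume "z \<in> nbs (E\<inverse>) X v"
        then show "z \<in> a \<union> a'"
          using D(3)[of z v] v lab(2)[OF v(1-3)] unfolding nbs_def a_def a'_def covered_def by auto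
      qed
      then have "real (card (nbs (E\<inverse>) X v)) \<le> real (card a) + real (card a')"
        by (rule card_le_Un) (use fin fin' in auto)
      then show False
        using 1 D(6)[OF u(1)] D(7)[OF v(1)] ab ab' H by linarith
    qed
    then show False
      using tight_graph_one_label[OF G x2 y2 lab] tight_graph_one_label[OF tight_graph_swap_side[OF G] y2 x2 lab(2,1)]
      by blast
  qed
qed

text \<open>If Y were almost inside red part i, then X would not be. Edges between
  \<open>X2\<close>, the vertices of X outside the part, and \<open>Y1\<close>, those of Y inside
  it, can only be blue, and common neighbours force one blue label j on all these vertices. Both
  sets are too large to be blue-covered. An uncovered vertex of either set has only blue-covered
  neighbours in the other, fewer than s for the two together, whereas the degree condition gives
  them more than s.\<close>

lemma tight_graph_outside_Y:
  assumes G: "tight_graph X Y E \<rho> C \<beta> K d s n"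
  shows "s \<le> real (card {y\<in>Y. \<rho> y \<noteq> i})"
proof (rule ccontr)
  assume "\<not> ?thesis"
  then have y2: "real (card {y\<in>Y. \<rho> y \<noteq> i}) < s" by simp
  then have x2: "s \<le> real (card {x\<in>X. \<rho> x \<noteq> i})"
    using tight_graph_one_side_large[OF G, of i] by linarith
  note H = G[unfolded tight_graph_def]
  note D = split_graphD[OF conjunct1[OF H]]
  note X12 = card_split_label[OF D(1), of \<rho> i] and Y12 = card_split_label[OF D(2), of \<rho> i]
  define X2 Y1 where "X2 = {x\<in>X. \<rho> x \<noteq> i}" and "Y1 = {y\<in>Y. \<rho> y = i}"
  have fin: "finite X2" "finite Y1"
    unfolding X2_def Y1_def using D(1,2) by auto
  have blue: "\<beta> x = \<beta> y \<and> (x \<in> K \<or> y \<in> K)" if "x \<in> X2" "y \<in> Y1" "(x, y) \<in> E" for x y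
    using D(3)[of x y] that unfolding X2_def Y1_def by auto
  have big: "d - real (card {y\<in>Y. \<rho> y \<noteq> i}) \<le> real (card (nbs E Y x \<inter> Y1))" if "x \<in> X2" for x
  proof -
    have "real (card (nbs E Y x)) \<le> real (card (nbs E Y x \<inter> Y1)) + real (card {y\<in>Y. \<rho> y \<noteq> i})"
      by (rule card_le_Un) (use D(2) in \<open>auto simp: nbs_def Y1_def\<close>)
    then show ?thesis
      using D(6)[of x] that unfolding X2_def by auto
  qed
  have big': "d - real (card {x\<in>X. \<rho> x = i}) \<le> real (card (nbs (E\<inverse>) X y \<inter> X2))" if "y \<in> Y1" for y
  proof -
    have "real (card (nbs (E\<inverse>) X y)) \<le> real (card (nbs (E\<inverse>) X y \<inter> X2)) + real (card {x\<in>X. \<rho> x = i})"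
      by (rule card_le_Un) (use D(1) in \<open>auto simp: nbs_def X2_def\<close>)
    then show ?thesis
      using D(7)[of y] that unfolding Y1_def by auto
  qed
  have same: "\<beta> x = \<beta> x'" if x: "x \<in> X2" "x' \<in> X2" for x x'
  proof -
    have "\<exists>y. y \<in> nbs E Y x \<inter> Y1 \<and> y \<in> nbs E Y x' \<inter> Y1"
      using big[OF x(1)] big[OF x(2)] Y12 y2 H fin(2) unfolding Y1_def
      by (intro meet_if_large[of _ "{y\<in>Y. \<rho> y = i}"]) auto
    then obtain y where "y \<in> Y1" "(x, y) \<in> E" "(x', y) \<in> E"
      unfolding nbs_def by blast
    then show ?thesis
      using blue[OF x(1)] blue[OF x(2)] by metis
  qed
  have "X2 \<noteq> {}"
  proof
    assume "X2 = {}"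
    then show False
      using x2 D(14) unfolding X2_def[symmetric] by simp
  qed
  then obtain x0 where x0: "x0 \<in> X2" by blast
  define j where "j = \<beta> x0"
  have labX: "\<beta> x = j" if "x \<in> X2" for x
    using same[OF that x0] unfolding j_def .
  have labY: "\<beta> y = j" if y: "y \<in> Y1" for y
  proof -
    have "0 < real (card (nbs (E\<inverse>) X y \<inter> X2))"
      using big'[OF y] X12 x2 H by linarith
    then obtain x where "x \<in> X2" "(x, y) \<in> E"
      unfolding nbs_def by (auto simp: card_gt_0_iff)
    then show ?thesis
      using blue y labX by metis
  qed
  define a' b' where "a' = covered X \<beta> K j" and "b' = covered Y \<beta> K j"
  have fin': "finite a'" "finite b'"
    using D unfolding a'_def b'_def by auto
  have ab': "real (card a') + real (card b') < s"
    using D(5)[of j] unfolding a'_def b'_def by auto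
  have "\<exists>x\<in>X2. x \<notin> K"
  proof (rule ccontr)
    assume "\<not> ?thesis"
    then have "X2 \<subseteq> a'"
      using labX unfolding a'_def covered_def X2_def by auto
    then have "card X2 \<le> card a'"
      by (rule card_mono[OF fin'(1)])
    then show False
      using x2 ab' unfolding X2_def[symmetric] by linarith
  qed
  then obtain x where x: "x \<in> X2" "x \<notin> K" by blast
  have "\<exists>y\<in>Y1. y \<notin> K"
  proof (rule ccontr)
    assume "\<not> ?thesis"
    then have "Y1 \<subseteq> b'"
      using labY unfolding b'_def covered_def Y1_def by auto
    then have "card Y1 \<le> card b'"
      using fin' by (intro card_mono)
    then show False
      using Y12 y2 H ab' unfolding Y1_def[symmetric] by linarith
  qed
  then obtain y where y: "y \<in> Y1" "y \<notin> K" by blast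
  have "nbs E Y x \<inter> Y1 \<subseteq> b'"
  proof
    fix z assume "z \<in> nbs E Y x \<inter> Y1"
    then show "z \<in> b'"
      using blue[of x z] x labX unfolding nbs_def b'_def covered_def by auto
  qed
  then have "card (nbs E Y x \<inter> Y1) \<le> card b'"
    using fin' by (intro card_mono)
  moreover have "nbs (E\<inverse>) X y \<inter> X2 \<subseteq> a'"
  proof
    fix z assume "z \<in> nbs (E\<inverse>) X y \<inter> X2"
    then show "z \<in> a'"
      using blue[of z y] y labX unfolding nbs_def a'_def covered_def by auto
  qed
  then have "card (nbs (E\<inverse>) X y \<inter> X2) \<le> card a'"
    using fin' by (intro card_mono)
  ultimately show False
    using big[OF x(1)] big'[OF y(1)] X12 x2 y2 ab' H by linarith
qed

lemma tight_graph_outside_X: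
  assumes "tight_graph X Y E \<rho> C \<beta> K d s n"
  shows "s \<le> real (card {x\<in>X. \<rho> x \<noteq> i})"
  by (rule tight_graph_outside_Y[OF tight_graph_swap_side[OF assms]])

section \<open>The grid of pairs of labels\<close>

lemma split_graph_edge_labels:
  assumes "split_graph X Y E \<rho> C \<beta> K d s" "x \<in> X" "y \<in> Y" "(x, y) \<in> E"
  shows "\<rho> x = \<rho> y \<or> \<beta> x = \<beta> y"
  using split_graphD(3)[OF assms] by blast

text \<open>A vertex of Y shares a label with each neighbour and has only two labels, so it is
  adjacent to at most two of the three vertices. But 3 d > 2 n gives them a common
  neighbour.\<close>

lemma tight_graph_no_three_diagonal:
  assumes G: "tight_graph X Y E \<rho> C \<beta> K d s n" and x: "x1 \<in> X" "x2 \<in> X" "x3 \<in> X"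
    and r: "\<rho> x1 \<noteq> \<rho> x2" "\<rho> x1 \<noteq> \<rho> x3" "\<rho> x2 \<noteq> \<rho> x3"
    and b: "\<beta> x1 \<noteq> \<beta> x2" "\<beta> x1 \<noteq> \<beta> x3" "\<beta> x2 \<noteq> \<beta> x3"
  shows False
proof -
  note H = G[unfolded tight_graph_def]
  note D = split_graphD[OF conjunct1[OF H]]
  have lab: "\<rho> x = \<rho> y \<or> \<beta> x = \<beta> y" if "x \<in> X" "y \<in> nbs E Y x" for x y
    using split_graph_edge_labels[OF conjunct1[OF H] that(1)] that(2) unfolding nbs_def by blast
  define A1 A2 A3 where "A1 = nbs E Y x1" and "A2 = nbs E Y x2" and "A3 = nbs E Y x3"
  have fin: "finite A1" "finite A2" "finite A3"
    unfolding A1_def A2_def A3_def by (rule D)+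
  have sub: "A1 \<subseteq> Y" "A2 \<subseteq> Y" "A3 \<subseteq> Y"
    unfolding A1_def A2_def A3_def nbs_def by auto
  have "y \<notin> A3" if "y \<in> A1" "y \<in> A2" for y
  proof
    assume "y \<in> A3"
    then show False
      using lab[OF x(1), of y] lab[OF x(2), of y] lab[OF x(3), of y] that r b
      unfolding A1_def A2_def A3_def by metis
  qed
  then have "card (A3 \<union> A1 \<inter> A2) = card A3 + card (A1 \<inter> A2)"
    using fin by (intro card_Un_disjoint) auto
  moreover have "card (A3 \<union> A1 \<inter> A2) \<le> card Y" "card (A1 \<union> A2) \<le> card Y"
    using sub D(2) by (auto intro!: card_mono)
  moreover have "card A1 + card A2 = card (A1 \<union> A2) + card (A1 \<inter> A2)"
    using fin by (intro card_Un_Int)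
  ultimately have "card A1 + card A2 + card A3 \<le> 2 * card Y"
    by linarith
  then have "real (card A1) + real (card A2) + real (card A3) \<le> 2 * real (card Y)"
    by linarith
  then show False
    using D(6)[OF x(1)] D(6)[OF x(2)] D(6)[OF x(3)] H unfolding A1_def A2_def A3_def by linarith
qed

text \<open>Koenig's theorem for matchings of size two: cells of a grid, no three of them in
  distinct rows and distinct columns, lie on two lines. Two rows and two columns are excluded by
  assumption, so the lines are a row and a column.\<close>

lemma cross_of_no_three_diagonal:
  assumes diag: "\<And>x1 x2 x3. x1 \<in> X \<Longrightarrow> x2 \<in> X \<Longrightarrow> x3 \<in> X \<Longrightarrow> \<rho> x1 \<noteq> \<rho> x2 \<Longrightarrow> \<rho> x1 \<noteq> \<rho> x3 \<Longrightarrow> \<rho> x2 \<noteq> \<rho> x3 \<Longrightarrow>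
      \<beta> x1 \<noteq> \<beta> x2 \<Longrightarrow> \<beta> x1 \<noteq> \<beta> x3 \<Longrightarrow> \<beta> x2 \<noteq> \<beta> x3 \<Longrightarrow> False"
    and rows: "\<And>p q. \<exists>x\<in>X. \<rho> x \<noteq> p \<and> \<rho> x \<noteq> q" and cols: "\<And>p q. \<exists>x\<in>X. \<beta> x \<noteq> p \<and> \<beta> x \<noteq> q"
  shows "\<exists>r c. \<forall>x\<in>X. \<rho> x = r \<or> \<beta> x = c"
proof -
  obtain x0 where x0: "x0 \<in> X"
    using rows by blast
  obtain x1 where x1: "x1 \<in> X" "\<rho> x1 \<noteq> \<rho> x0"
    using rows by blast
  obtain x2 where x2: "x2 \<in> X" "\<beta> x2 \<noteq> \<beta> x0"
    using cols by blast
  obtain p q where pq: "p \<in> X" "q \<in> X" "\<rho> p \<noteq> \<rho> q" "\<beta> p \<noteq> \<beta> q"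
    using x0 x1 x2 by metis
  obtain z where z: "z \<in> X" "\<rho> z \<noteq> \<rho> p" "\<rho> z \<noteq> \<rho> q"
    using rows by blast
  obtain w where w: "w \<in> X" "\<beta> w \<noteq> \<beta> p" "\<beta> w \<noteq> \<beta> q"
    using cols by blast
  \<comment> \<open>The cell z is in a third row and w in a third column. Hence z is in the column
    of p or of q; in the first case w is forced into the row of q, and that row and column contain
    everything. The second case is the same with p and q exchanged.\<close>
  have core: "\<exists>r c. \<forall>x\<in>X. \<rho> x = r \<or> \<beta> x = c"
    if pq: "p \<in> X" "q \<in> X" "\<rho> p \<noteq> \<rho> q" "\<beta> p \<noteq> \<beta> q"
      and z: "z \<in> X" "\<rho> z \<noteq> \<rho> p" "\<rho> z \<noteq> \<rho> q" and w: "w \<in> X" "\<beta> w \<noteq> \<beta> p" "\<beta> w \<noteq> \<beta> q"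
      and zp: "\<beta> z = \<beta> p" for p q
  proof (intro exI ballI)
    have wq: "\<rho> w = \<rho> q"
      using diag[of z w q] diag[of p q w] pq z w zp by metis
    fix x assume x: "x \<in> X"
    show "\<rho> x = \<rho> q \<or> \<beta> x = \<beta> p"
      using diag[of p q x] diag[of z q x] diag[of p w x] diag[of z w x] pq z w zp wq x by metis
  qed
  have "\<beta> z = \<beta> p \<or> \<beta> z = \<beta> q"
    using diag[of p q z] pq z by metis
  then show ?thesis
    using core[of p q] core[of q p] pq z w by metis
qed

text \<open>It remains to exclude a row r and a column c. Since s > n - d, each x has a neighbour
  outside its red part, hence with the same blue label; likewise with the colours swapped. So cells
  of X in two further columns and two further rows lead to vertices of Y off the cross in two
  distinct columns and in two distinct rows. Any two vertices of Y off the cross have a common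
  neighbour on it and therefore share a label, which these four cannot do.\<close>

lemma tight_graph_two_labels:
  assumes G: "tight_graph X Y E \<rho> C \<beta> K d s n"
  shows "(\<exists>p q. \<forall>x\<in>X. \<rho> x = p \<or> \<rho> x = q) \<or> (\<exists>p q. \<forall>x\<in>X. \<beta> x = p \<or> \<beta> x = q)"
proof (rule ccontr)
  assume "\<not> ?thesis"
  then have rows: "\<And>p q. \<exists>x\<in>X. \<rho> x \<noteq> p \<and> \<rho> x \<noteq> q" and cols: "\<And>p q. \<exists>x\<in>X. \<beta> x \<noteq> p \<and> \<beta> x \<noteq> q"
    by metis+
  note H = G[unfolded tight_graph_def]
  note D = split_graphD[OF conjunct1[OF H]]
  obtain r c where cr: "\<And>x. x \<in> X \<Longrightarrow> \<rho> x = r \<or> \<beta> x = c"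
  proof -
    have "\<exists>r c. \<forall>x\<in>X. \<rho> x = r \<or> \<beta> x = c"
      by (rule cross_of_no_three_diagonal[OF _ rows cols]) (rule tight_graph_no_three_diagonal[OF G])
    then show ?thesis
      using that by blast
  qed
  have off: "\<exists>y\<in>Y. \<rho> y \<noteq> \<rho> x \<and> \<beta> y = \<beta> x"
    if G: "tight_graph X Y E \<rho> C \<beta> K d s n" and x: "x \<in> X" for \<rho> C \<beta> K x
  proof (rule ccontr)
    assume no: "\<not> ?thesis"
    note H = G[unfolded tight_graph_def]
    note D = split_graphD[OF conjunct1[OF H]]
    have "{y\<in>Y. \<rho> y \<noteq> \<rho> x} \<inter> nbs E Y x = {}"
      using no split_graph_edge_labels[OF conjunct1[OF H] x] unfolding nbs_def by fastforce
    then have "card ({y\<in>Y. \<rho> y \<noteq> \<rho> x} \<union> nbs E Y x) = card {y\<in>Y. \<rho> y \<noteq> \<rho> x} + card (nbs E Y x)"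
      using D(2) by (intro card_Un_disjoint) (auto simp: nbs_def)
    moreover have "card ({y\<in>Y. \<rho> y \<noteq> \<rho> x} \<union> nbs E Y x) \<le> card Y"
      using D(2) by (intro card_mono) (auto simp: nbs_def)
    ultimately show False
      using tight_graph_outside_Y[OF G, of "\<rho> x"] D(6)[OF x] H by linarith
  qed
  have line: "\<rho> y = \<rho> y' \<or> \<beta> y = \<beta> y'"
    if y: "y \<in> Y" "\<rho> y \<noteq> r" "\<beta> y \<noteq> c" and y': "y' \<in> Y" "\<rho> y' \<noteq> r" "\<beta> y' \<noteq> c" for y y'
  proof -
    have "\<exists>x. x \<in> nbs (E\<inverse>) X y \<and> x \<in> nbs (E\<inverse>) X y'"
      using D(7)[OF y(1)] D(7)[OF y'(1)] H D(1)
      by (intro meet_if_large[of _ X]) (auto simp: nbs_def)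
    then obtain x where "x \<in> X" "(x, y) \<in> E" "(x, y') \<in> E"
      unfolding nbs_def by blast
    then show ?thesis
      using split_graph_edge_labels[OF conjunct1[OF H], of x y] split_graph_edge_labels[OF conjunct1[OF H], of x y']
        cr[of x] y y' by metis
  qed
  obtain u2 where u2: "u2 \<in> X" "\<beta> u2 \<noteq> c" using cols by blast
  obtain u3 where u3: "u3 \<in> X" "\<beta> u3 \<noteq> c" "\<beta> u3 \<noteq> \<beta> u2" using cols by blast
  obtain v2 where v2: "v2 \<in> X" "\<rho> v2 \<noteq> r" using rows by blast
  obtain v3 where v3: "v3 \<in> X" "\<rho> v3 \<noteq> r" "\<rho> v3 \<noteq> \<rho> v2" using rows by blast
  obtain y1 where y1: "y1 \<in> Y" "\<rho> y1 \<noteq> r" "\<beta> y1 = \<beta> u2"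
    using off[OF G u2(1)] cr[OF u2(1)] u2(2) by auto
  obtain y2 where y2: "y2 \<in> Y" "\<rho> y2 \<noteq> r" "\<beta> y2 = \<beta> u3"
    using off[OF G u3(1)] cr[OF u3(1)] u3(2) by auto
  obtain y3 where y3: "y3 \<in> Y" "\<beta> y3 \<noteq> c" "\<rho> y3 = \<rho> v2"
    using off[OF tight_graph_swap_colour[OF G] v2(1)] cr[OF v2(1)] v2(2) by auto
  obtain y4 where y4: "y4 \<in> Y" "\<beta> y4 \<noteq> c" "\<rho> y4 = \<rho> v3"
    using off[OF tight_graph_swap_colour[OF G] v3(1)] cr[OF v3(1)] v3(2) by auto
  show False
    using line[of y1 y2] line[of y3 y4] line[of y1 y3] line[of y1 y4] line[of y2 y3] line[of y2 y4]
      y1 y2 y3 y4 u2 u3 v2 v3 by metis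
qed

text \<open>Red edges at x stay in its red part; a blue one ends in a blue-covered vertex because x
  is not covered.\<close>

lemma split_graph_uncovered_degree:
  assumes G: "split_graph X Y E \<rho> C \<beta> K d s" and x: "x \<in> X" "x \<notin> K"
  shows "d \<le> real (card {y\<in>Y. \<rho> y = \<rho> x}) + real (card (covered Y \<beta> K (\<beta> x)))"
proof -
  note D = split_graphD[OF G]
  have "nbs E Y x \<subseteq> {y\<in>Y. \<rho> y = \<rho> x} \<union> covered Y \<beta> K (\<beta> x)"
  proof
    fix y assume "y \<in> nbs E Y x"
    then show "y \<in> {y\<in>Y. \<rho> y = \<rho> x} \<union> covered Y \<beta> K (\<beta> x)"
      using D(3)[of x y] x unfolding nbs_def covered_def by auto
  qed
  then have "real (card (nbs E Y x)) \<le> real (card {y\<in>Y. \<rho> y = \<rho> x}) + real (card (covered Y \<beta> K (\<beta> x)))"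
    by (rule card_le_Un) (use D in auto)
  then show ?thesis
    using D(6)[OF x(1)] by linarith
qed

text \<open>At least s vertices have a blue label other than q, hence the label p, and fewer than s
  of these can be covered.\<close>

lemma tight_graph_uncovered_exists:
  assumes G: "tight_graph X Y E \<rho> C \<beta> K d s n" and lab: "\<And>x. x \<in> X \<Longrightarrow> \<beta> x = p \<or> \<beta> x = q"
  shows "\<exists>x\<in>X. \<beta> x = p \<and> x \<notin> K"
proof (rule ccontr)
  assume no: "\<not> ?thesis"
  note D = split_graphD[OF conjunct1[OF G[unfolded tight_graph_def]]]
  have "{x\<in>X. \<beta> x \<noteq> q} \<subseteq> covered X \<beta> K p"
    using no lab unfolding covered_def by blast
  then have "card {x\<in>X. \<beta> x \<noteq> q} \<le> card (covered X \<beta> K p)"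
    by (rule card_mono[OF D(10)])
  then show False
    using tight_graph_outside_X[OF tight_graph_swap_colour[OF G], of q] D(5)[of p] by linarith
qed

text \<open>With two blue labels the cover K has fewer than 2 s vertices in all. If the
  blue-uncovered vertices of Y are in red part i, too, then K contains everything outside the part,
  at least 2 s vertices. Otherwise some y has all its neighbours in K, so that K has at least d
  vertices in X and fewer than 2 s - d in Y. Adding the degree bounds of two uncovered vertices of
  X, one for each blue label, gives 2 d < 2 (n - s) + (2 s - d), against 3 d > 2 n.\<close>

lemma tight_graph_one_uncovered_label:
  assumes G: "tight_graph X Y E \<rho> C \<beta> K d s n" and "p \<noteq> q"
    and labX: "\<And>x. x \<in> X \<Longrightarrow> \<beta> x = p \<or> \<beta> x = q" and labY: "\<And>y. y \<in> Y \<Longrightarrow> \<beta> y = p \<or> \<beta> y = q"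
    and i: "\<And>x. x \<in> X \<Longrightarrow> x \<notin> K \<Longrightarrow> \<rho> x = i"
  shows False
proof -
  note H = G[unfolded tight_graph_def]
  note D = split_graphD[OF conjunct1[OF H]]
  have split: "card (Z \<inter> K) = card (covered Z \<beta> K p) + card (covered Z \<beta> K q)"
    if "finite Z" "\<And>z. z \<in> Z \<Longrightarrow> \<beta> z = p \<or> \<beta> z = q" for Z
  proof -
    have "Z \<inter> K = covered Z \<beta> K p \<union> covered Z \<beta> K q"
      using that(2) unfolding covered_def by blast
    moreover have "covered Z \<beta> K p \<inter> covered Z \<beta> K q = {}" "finite (covered Z \<beta> K p)" "finite (covered Z \<beta> K q)"
      using \<open>p \<noteq> q\<close> that(1) unfolding covered_def by auto
    ultimately show ?thesis
      by (simp add: card_Un_disjoint)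
  qed
  have total: "real (card (X \<inter> K)) + real (card (Y \<inter> K)) < 2 * s"
    using split[OF D(1) labX] split[OF D(2) labY] D(5)[of p] D(5)[of q] by simp
  have finK: "finite (X \<inter> K)" "finite (Y \<inter> K)"
    using D(1,2) by auto
  show False
  proof (cases "\<exists>y\<in>Y. y \<notin> K \<and> \<rho> y \<noteq> i")
    case False
    then have sub: "{y\<in>Y. \<rho> y \<noteq> i} \<subseteq> Y \<inter> K" "{x\<in>X. \<rho> x \<noteq> i} \<subseteq> X \<inter> K"
      using i by auto
    show False
      using card_mono[OF finK(2) sub(1)] card_mono[OF finK(1) sub(2)]
        tight_graph_outside_X[OF G, of i] tight_graph_outside_Y[OF G, of i] total by linarith
  next
    case True
    then obtain y where y: "y \<in> Y" "y \<notin> K" "\<rho> y \<noteq> i" by blast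
    have "nbs (E\<inverse>) X y \<subseteq> X \<inter> K"
    proof
      fix x assume "x \<in> nbs (E\<inverse>) X y"
      then show "x \<in> X \<inter> K"
        using D(3)[of x y] y i[of x] unfolding nbs_def by (cases "x \<in> K") auto
    qed
    then have "card (nbs (E\<inverse>) X y) \<le> card (X \<inter> K)"
      by (rule card_mono[OF finK(1)])
    then have dX: "d \<le> real (card (X \<inter> K))"
      using D(7)[OF y(1)] by linarith
    obtain u where u: "u \<in> X" "\<beta> u = p" "u \<notin> K"
      using tight_graph_uncovered_exists[OF G labX] by blast
    have labX': "\<And>x. x \<in> X \<Longrightarrow> \<beta> x = q \<or> \<beta> x = p"
      using labX by blast
    obtain v where v: "v \<in> X" "\<beta> v = q" "v \<notin> K"
      using tight_graph_uncovered_exists[OF G labX'] by blast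
    have "\<rho> u = i" "\<rho> v = i"
      using i u v by auto
    then have "d \<le> real (card {y\<in>Y. \<rho> y = i}) + real (card (covered Y \<beta> K p))"
      "d \<le> real (card {y\<in>Y. \<rho> y = i}) + real (card (covered Y \<beta> K q))"
      using split_graph_uncovered_degree[OF conjunct1[OF H] u(1,3)]
        split_graph_uncovered_degree[OF conjunct1[OF H] v(1,3)] u v by auto
    then have "2 * d \<le> 2 * real (card {y\<in>Y. \<rho> y = i}) + real (card (Y \<inter> K))"
      using split[OF D(2) labY] by simp
    then show False
      using dX total tight_graph_outside_Y[OF G, of i] card_split_label[OF D(2), of \<rho> i] H by linarith
  qed
qed

text \<open>If x and y are blue-uncovered with the same blue label, then the red part of x in Y and
  the red part of y in X have more than n vertices together. Different red parts have at most n
  vertices on one side. So two such pairs (x, y) agree in the red label of the first or of the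
  second component. Hence on one side all blue-uncovered vertices lie in one red part, which is
  impossible.\<close>

lemma tight_graph_not_two_labels:
  assumes G: "tight_graph X Y E \<rho> C \<beta> K d s n" and labX: "\<And>x. x \<in> X \<Longrightarrow> \<beta> x = p \<or> \<beta> x = q"
  shows False
proof -
  note H = G[unfolded tight_graph_def]
  note D = split_graphD[OF conjunct1[OF H]]
  have "p \<noteq> q"
  proof
    assume "p = q"
    then have none: "{x\<in>X. \<beta> x \<noteq> p} = {}"
      using labX by auto
    show False
      using tight_graph_outside_X[OF tight_graph_swap_colour[OF G], of p] D(14) unfolding none by simp
  qed
  \<comment> \<open>With a third blue label, y would have only red edges, and its red part has at
    most n - s < d vertices in X.\<close>
  have labY: "\<beta> y = p \<or> \<beta> y = q" if y: "y \<in> Y" for y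
  proof (rule ccontr)
    assume no: "\<not> ?thesis"
    have "nbs (E\<inverse>) X y \<subseteq> {x\<in>X. \<rho> x = \<rho> y}"
    proof
      fix x assume "x \<in> nbs (E\<inverse>) X y"
      then show "x \<in> {x\<in>X. \<rho> x = \<rho> y}"
        using D(3)[of x y] y no labX[of x] unfolding nbs_def by auto
    qed
    then have "card (nbs (E\<inverse>) X y) \<le> card {x\<in>X. \<rho> x = \<rho> y}"
      using D(1) by (intro card_mono) auto
    then show False
      using D(7)[OF y] tight_graph_outside_X[OF G, of "\<rho> y"] card_split_label[OF D(1), of \<rho> "\<rho> y"] H by linarith
  qed
  have labX': "\<And>x. x \<in> X \<Longrightarrow> \<beta> x = q \<or> \<beta> x = p" and labY': "\<And>x. x \<in> Y \<Longrightarrow> \<beta> x = q \<or> \<beta> x = p"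
    using labX labY by blast+
  note G' = tight_graph_swap_side[OF G]
  have pair: "n < real (card {v\<in>Y. \<rho> v = \<rho> x}) + real (card {u\<in>X. \<rho> u = \<rho> y})"
    if "x \<in> X" "x \<notin> K" "y \<in> Y" "y \<notin> K" "\<beta> x = \<beta> y" for x y
    using split_graph_uncovered_degree[OF conjunct1[OF H] that(1,2)]
      split_graph_uncovered_degree[OF split_graph_swap_side[OF conjunct1[OF H]] that(3,4)] that(5) D(5)[of "\<beta> y"] H by auto
  have two: "real (card {z\<in>Z. \<rho> z = i}) + real (card {z\<in>Z. \<rho> z = j}) \<le> n"
    if "finite Z" "real (card Z) \<le> n" "i \<noteq> j" for Z i j
  proof -
    have "card {z\<in>Z. \<rho> z = i} + card {z\<in>Z. \<rho> z = j} = card ({z\<in>Z. \<rho> z = i} \<union> {z\<in>Z. \<rho> z = j})"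
      using that by (intro card_Un_disjoint[symmetric]) auto
    also have "\<dots> \<le> card Z"
      using that(1) by (intro card_mono) auto
    finally show ?thesis
      using that(2) by linarith
  qed
  have match: "\<rho> x = \<rho> x' \<or> \<rho> y = \<rho> y'"
    if "x \<in> X" "x \<notin> K" "y \<in> Y" "y \<notin> K" "\<beta> x = \<beta> y" "x' \<in> X" "x' \<notin> K" "y' \<in> Y" "y' \<notin> K" "\<beta> x' = \<beta> y'" for x y x' y'
  proof (rule ccontr)
    assume no: "\<not> ?thesis"
    then have "\<rho> x \<noteq> \<rho> x'" "\<rho> y \<noteq> \<rho> y'" by auto
    then show False
      using pair[OF that(1-5)] pair[OF that(6-10)] two[OF D(2), of "\<rho> x" "\<rho> x'"] two[OF D(1), of "\<rho> y" "\<rho> y'"] H by linarith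
  qed
  obtain xp where xp: "xp \<in> X" "\<beta> xp = p" "xp \<notin> K"
    using tight_graph_uncovered_exists[OF G labX] by blast
  obtain xq where xq: "xq \<in> X" "\<beta> xq = q" "xq \<notin> K"
    using tight_graph_uncovered_exists[OF G labX'] by blast
  obtain yp where yp: "yp \<in> Y" "\<beta> yp = p" "yp \<notin> K"
    using tight_graph_uncovered_exists[OF G' labY] by blast
  obtain yq where yq: "yq \<in> Y" "\<beta> yq = q" "yq \<notin> K"
    using tight_graph_uncovered_exists[OF G' labY'] by blast
  have "(\<forall>x\<in>X. x \<notin> K \<longrightarrow> \<rho> x = \<rho> xp) \<or> (\<forall>y\<in>Y. y \<notin> K \<longrightarrow> \<rho> y = \<rho> yp)"
  proof (cases "\<forall>u\<in>X. \<forall>v\<in>X. u \<notin> K \<longrightarrow> v \<notin> K \<longrightarrow> \<beta> u = p \<longrightarrow> \<beta> v = q \<longrightarrow> \<rho> u = \<rho> v")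
    case True
    then have "\<rho> x = \<rho> xp" if "x \<in> X" "x \<notin> K" for x
      using labX[OF that(1)] that xp xq by metis
    then show ?thesis by blast
  next
    case False
    then obtain u v where uv: "u \<in> X" "v \<in> X" "u \<notin> K" "v \<notin> K" "\<beta> u = p" "\<beta> v = q" "\<rho> u \<noteq> \<rho> v"
      by blast
    have "\<rho> y = \<rho> y'" if "y \<in> Y" "y \<notin> K" "\<beta> y = p" "y' \<in> Y" "y' \<notin> K" "\<beta> y' = q" for y y'
      using match[of u y v y'] uv that by metis
    then have "\<rho> y = \<rho> yp" if "y \<in> Y" "y \<notin> K" for y
      using labY[OF that(1)] that yp yq by metis
    then show ?thesis by blast
  qed
  then show False
    using tight_graph_one_uncovered_label[OF G \<open>p \<noteq> q\<close> labX labY]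
      tight_graph_one_uncovered_label[OF G' \<open>p \<noteq> q\<close> labY labX] by blast
qed

theorem no_tight_graph: "\<not> tight_graph X Y E \<rho> C \<beta> K d s n"
proof
  assume G: "tight_graph X Y E \<rho> C \<beta> K d s n"
  from tight_graph_two_labels[OF G] show False
  proof (elim disjE exE)
    fix p q assume "\<forall>x\<in>X. \<rho> x = p \<or> \<rho> x = q"
    then show False
      using tight_graph_not_two_labels[OF tight_graph_swap_colour[OF G]] by blast
  next
    fix p q assume "\<forall>x\<in>X. \<beta> x = p \<or> \<beta> x = q"
    then show False
      using tight_graph_not_two_labels[OF G] by blast
  qed
qed

section \<open>Large minimum degree\<close>

text \<open>Double counting of the pairs in S. In its use S consists of the deleted edges, and the
  lemma bounds the number of vertices that lose many of them.\<close>

lemma card_heavy_le: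
  fixes \<eta> :: real
  assumes fin: "finite X" "finite Y" and "S \<subseteq> X \<times> Y" "real (card S) \<le> \<eta> * \<eta> * real n * real n" "0 < \<eta>" "0 < n"
  shows "real (card {x\<in>X. \<eta> * real n \<le> real (card (nbs S Y x))}) \<le> \<eta> * real n"
proof -
  define Xb where "Xb = {x\<in>X. \<eta> * real n \<le> real (card (nbs S Y x))}"
  have Xb: "Xb \<subseteq> X" "finite Xb"
    unfolding Xb_def using fin by auto
  have "real (card Xb) * (\<eta> * real n) \<le> (\<Sum>x\<in>Xb. real (card (nbs S Y x)))"
    using sum_bounded_below[of Xb "\<eta> * real n" "\<lambda>x. real (card (nbs S Y x))"] unfolding Xb_def by simp
  also have "\<dots> = real (card (SIGMA x:Xb. nbs S Y x))"
    using Xb fin by (subst card_SigmaI) (auto simp: nbs_def)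
  also have "(SIGMA x:Xb. nbs S Y x) \<subseteq> S"
    unfolding nbs_def by auto
  then have "real (card (SIGMA x:Xb. nbs S Y x)) \<le> real (card S)"
    using assms(3) fin finite_subset[of S "X \<times> Y"] by (simp add: card_mono)
  finally have "real (card Xb) * (\<eta> * real n) \<le> \<eta> * real n * (\<eta> * real n)"
    using assms(4) by (simp add: algebra_simps)
  then show ?thesis
    using assms(5,6) unfolding Xb_def by simp
qed

text \<open>One \<eta> pays for the deleted edges at x, the other for the deleted vertices
  \<open>Yb\<close>.\<close>

lemma good_degree:
  fixes \<eta> \<delta> :: real
  assumes fin: "finite Y" and x: "x \<in> X" "\<not> \<eta> * real n \<le> real (card (nbs S Y x))"
    and Yb: "real (card Yb) \<le> \<eta> * real n" "finite Yb"
    and deg: "\<delta> * real n \<le> real (card (nbs D Y x))" and D: "D \<subseteq> E \<union> S"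
  shows "(\<delta> - 2 * \<eta>) * real n \<le> real (card (nbs E (Y - Yb) x))"
proof -
  have "nbs D Y x \<subseteq> nbs E (Y - Yb) x \<union> nbs S Y x \<union> Yb"
    using D unfolding nbs_def by auto
  then have "real (card (nbs D Y x)) \<le> real (card (nbs E (Y - Yb) x)) + real (card (nbs S Y x)) + real (card Yb)"
    by (rule card_le_Un3) (use fin Yb in \<open>auto simp: nbs_def\<close>)
  then show ?thesis
    using deg x(2) Yb(1) by (simp add: algebra_simps)
qed

lemma covered_of_part_cover:
  assumes "part_cover D (X \<union> Y) u \<rho> K" "X' \<subseteq> X" "Y' \<subseteq> Y" "X \<inter> Y = {}" "finite X" "finite Y"
  shows "real (card (covered X' \<rho> K i)) + real (card (covered Y' \<rho> K i)) \<le> u"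
proof -
  have "card (covered X' \<rho> K i) + card (covered Y' \<rho> K i) = card (covered X' \<rho> K i \<union> covered Y' \<rho> K i)"
  proof (rule card_Un_disjoint[symmetric])
    have "finite X'" "finite Y'"
      using assms finite_subset by blast+
    then show "finite (covered X' \<rho> K i)" "finite (covered Y' \<rho> K i)"
      unfolding covered_def by auto
  qed (use assms in \<open>auto simp: covered_def\<close>)
  also have "\<dots> \<le> card {v\<in>X \<union> Y. \<rho> v = i \<and> v \<in> K}"
    by (rule card_mono) (use assms in \<open>auto simp: covered_def\<close>)
  finally have "real (card (covered X' \<rho> K i) + card (covered Y' \<rho> K i)) \<le> real (card {v\<in>X \<union> Y. \<rho> v = i \<and> v \<in> K})"
    by (simp only: of_nat_le_iff)
  moreover have "real (card {v\<in>X \<union> Y. \<rho> v = i \<and> v \<in> K}) \<le> u"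
    using assms(1) unfolding part_cover_def by blast
  ultimately show ?thesis by simp
qed

text \<open>The quantity f / 2 - (1 - \<delta>) is the slack in the condition n - d < s after
  division by n; it is positive only above 2/3, which explains the threshold.\<close>

lemma f_bound_cases:
  assumes "0 < \<delta>" "\<delta> \<le> 1"
  shows "0 < f_bound \<delta>" "f_bound \<delta> \<le> 1" "2 / 3 < \<delta> \<Longrightarrow> f_bound \<delta> \<le> 4 * \<delta> - 2"
    "2 / 3 < \<delta> \<Longrightarrow> 0 < f_bound \<delta> / 2 - (1 - \<delta>)" "\<delta> \<le> 2 / 3 \<Longrightarrow> f_bound \<delta> = \<delta>"
  using assms unfolding f_bound_def by (auto split: if_splits)

lemma coloured_bipartite_cycle:
  fixes \<delta> \<epsilon> :: real
  assumes \<delta>: "0 < \<delta>" "\<delta> \<le> 1" and \<epsilon>: "0 < \<epsilon>" "\<epsilon> \<le> f_bound \<delta> / 2" and gap: "2 / 3 < \<delta> \<Longrightarrow> \<epsilon> \<le> f_bound \<delta> / 2 - (1 - \<delta>)"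
  shows "\<exists>n0. \<forall>n\<ge>n0. \<forall>(X::'a set) Y R B. finite X \<longrightarrow> finite Y \<longrightarrow> card X = n \<longrightarrow> card Y = n \<longrightarrow> X \<inter> Y = {} \<longrightarrow>
     R \<subseteq> X \<times> Y \<longrightarrow> B \<subseteq> X \<times> Y \<longrightarrow> (\<forall>x\<in>X. \<delta> * real n \<le> real (card (nbs (R \<union> B) Y x))) \<longrightarrow>
     (\<forall>y\<in>Y. \<delta> * real n \<le> real (card (nbs ((R \<union> B)\<inverse>) X y))) \<longrightarrow>
     (\<exists>C. (cycle_list (R \<union> R\<inverse>) C \<or> cycle_list (B \<union> B\<inverse>) C) \<and> (f_bound \<delta> - \<epsilon>) * real n \<le> real (length C))"
proof -
  note f = f_bound_cases[OF \<delta>]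
  \<comment> \<open>Divided by n, the condition \<open>s' \<le> 2 * d - real n\<close> reads f / 2 -
    \<epsilon> / 2 + \<eta> \<le> 2 \<delta> - 1 - 4 \<eta>. Where f = 4 \<delta> - 2 it amounts to
    10 \<eta> \<le> \<epsilon>.\<close>
  define \<eta> where "\<eta> = \<epsilon> / 10"
  have \<eta>: "0 < \<eta>" "\<eta> < 1" "10 * \<eta> = \<epsilon>"
    using \<epsilon> f(2) unfolding \<eta>_def by auto
  \<comment> \<open>Each colour loses at most \<epsilon>' n^2 edges, together \<eta>^2 n^2, so at
    most \<eta> n vertices of a side lose \<eta> n edges or more.\<close>
  define \<epsilon>' where "\<epsilon>' = \<eta> * \<eta> / 2"
  have \<epsilon>': "0 < \<epsilon>'" "\<epsilon>' < \<eta>"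
  proof -
    show "0 < \<epsilon>'"
      using \<eta>(1) unfolding \<epsilon>'_def by simp
    have "\<eta> * \<eta> < \<eta> * 1"
      using \<eta> by (intro mult_strict_left_mono) auto
    then show "\<epsilon>' < \<eta>"
      using \<eta>(1) unfolding \<epsilon>'_def by simp
  qed
  obtain n0 where n0: "\<And>n (X::'a set) Y D s. n0 \<le> n \<Longrightarrow> finite X \<Longrightarrow> finite Y \<Longrightarrow> card X = n \<Longrightarrow> card Y = n \<Longrightarrow> X \<inter> Y = {} \<Longrightarrow>
    D \<subseteq> X \<times> Y \<Longrightarrow> s > 0 \<Longrightarrow> \<not> (\<exists>C. cycle_list (D \<union> D\<inverse>) C \<and> real (length C) \<ge> 2 * s) \<Longrightarrow>
    (\<exists>D'\<subseteq>D. \<exists>\<rho> K. real (card (D - D')) \<le> \<epsilon>' * real n * real n \<and> part_cover D' (X \<union> Y) (s + \<epsilon>' * real n) \<rho> K)"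
    using no_long_cycle_structure[OF \<epsilon>'(1), where ?'a = 'a] by metis
  show ?thesis
  proof (rule exI[of _ "max n0 1"], intro allI impI)
    fix n and X Y :: "'a set" and R B
    assume n: "max n0 1 \<le> n" and fin: "finite X" "finite Y" and card: "card X = n" "card Y = n" and XY: "X \<inter> Y = {}"
      and RB: "R \<subseteq> X \<times> Y" "B \<subseteq> X \<times> Y" and degX: "\<forall>x\<in>X. \<delta> * real n \<le> real (card (nbs (R \<union> B) Y x))"
      and degY: "\<forall>y\<in>Y. \<delta> * real n \<le> real (card (nbs ((R \<union> B)\<inverse>) X y))"
    have npos: "n > 0" "n0 \<le> n"
      using n by auto
    define s where "s = (f_bound \<delta> - \<epsilon>) / 2 * real n"
    have s: "s > 0" "2 * s = (f_bound \<delta> - \<epsilon>) * real n"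
      using \<epsilon> f(1) npos unfolding s_def by auto
    show "\<exists>C. (cycle_list (R \<union> R\<inverse>) C \<or> cycle_list (B \<union> B\<inverse>) C) \<and> (f_bound \<delta> - \<epsilon>) * real n \<le> real (length C)"
    proof (rule ccontr)
      assume no: "\<not> ?thesis"
      have "\<not> (\<exists>C. cycle_list (R \<union> R\<inverse>) C \<and> real (length C) \<ge> 2 * s)"
        "\<not> (\<exists>C. cycle_list (B \<union> B\<inverse>) C \<and> real (length C) \<ge> 2 * s)"
        using no unfolding s(2) by blast+
      then obtain R' B' \<rho> \<beta> KR KB where R': "R' \<subseteq> R" "real (card (R - R')) \<le> \<epsilon>' * real n * real n"
          "part_cover R' (X \<union> Y) (s + \<epsilon>' * real n) \<rho> KR"
        and B': "B' \<subseteq> B" "real (card (B - B')) \<le> \<epsilon>' * real n * real n"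
          "part_cover B' (X \<union> Y) (s + \<epsilon>' * real n) \<beta> KB"
        using n0[OF npos(2) fin card XY RB(1) s(1)] n0[OF npos(2) fin card XY RB(2) s(1)] by metis
      define S where "S = (R - R') \<union> (B - B')"
      have SXY: "S \<subseteq> X \<times> Y"
        using RB unfolding S_def by blast
      have "finite R" "finite B"
        using RB fin by (meson finite_SigmaI finite_subset)+
      then have "real (card S) \<le> real (card (R - R')) + real (card (B - B'))"
        unfolding S_def by (intro card_le_Un) auto
      then have cardS: "real (card S) \<le> \<eta> * \<eta> * real n * real n"
        using R'(2) B'(2) unfolding \<epsilon>'_def by (simp add: algebra_simps)
      \<comment> \<open>The vertices that lose many edges are removed, because
        \<open>split_graph\<close> demands the degree bound at every remaining vertex.\<close>
      define Xb where "Xb = {x\<in>X. \<eta> * real n \<le> real (card (nbs S Y x))}"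
      define Yb where "Yb = {y\<in>Y. \<eta> * real n \<le> real (card (nbs (S\<inverse>) X y))}"
      have Xb: "real (card Xb) \<le> \<eta> * real n" "finite Xb" "Xb \<subseteq> X"
        using card_heavy_le[OF fin SXY cardS \<eta>(1) npos(1)] fin unfolding Xb_def by auto
      have "S\<inverse> \<subseteq> Y \<times> X" "real (card (S\<inverse>)) \<le> \<eta> * \<eta> * real n * real n"
        using SXY cardS by auto
      then have Yb: "real (card Yb) \<le> \<eta> * real n" "finite Yb" "Yb \<subseteq> Y"
        using card_heavy_le[OF fin(2,1) _ _ \<eta>(1) npos(1)] fin unfolding Yb_def by auto
      define E where "E = R' \<union> B'"
      define d where "d = (\<delta> - 2 * \<eta>) * real n"
      define s' where "s' = s + \<eta> * real n"
      have "\<epsilon>' * real n < \<eta> * real n"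
        using \<epsilon>'(2) npos by simp
      then have s': "s + \<epsilon>' * real n < s'"
        unfolding s'_def by simp
      have G: "split_graph (X - Xb) (Y - Yb) E \<rho> KR \<beta> KB d s'"
        unfolding split_graph_def
      proof (intro conjI ballI allI impI)
        fix x y assume xy: "(x, y) \<in> E"
        show "\<rho> x = \<rho> y \<and> (x \<in> KR \<or> y \<in> KR) \<or> \<beta> x = \<beta> y \<and> (x \<in> KB \<or> y \<in> KB)"
          using xy R'(3) B'(3) unfolding E_def part_cover_def by blast
      next
        fix i
        show "real (card (covered (X - Xb) \<rho> KR i)) + real (card (covered (Y - Yb) \<rho> KR i)) < s'"
          using covered_of_part_cover[OF R'(3) Diff_subset Diff_subset XY fin, of Xb i Yb] s' by linarith
        show "real (card (covered (X - Xb) \<beta> KB i)) + real (card (covered (Y - Yb) \<beta> KB i)) < s'"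
          using covered_of_part_cover[OF B'(3) Diff_subset Diff_subset XY fin, of Xb i Yb] s' by linarith
      next
        fix x assume x: "x \<in> X - Xb"
        then show "d \<le> real (card (nbs E (Y - Yb) x))"
          unfolding d_def using good_degree[OF fin(2), of x X \<eta> n S Yb \<delta> "R \<union> B" E] Yb degX
          unfolding Xb_def S_def E_def by auto
      next
        fix y assume y: "y \<in> Y - Yb"
        have "(R \<union> B)\<inverse> \<subseteq> E\<inverse> \<union> S\<inverse>"
          unfolding S_def E_def by auto
        then show "d \<le> real (card (nbs (E\<inverse>) (X - Xb) y))"
          unfolding d_def using good_degree[OF fin(1), of y Y \<eta> n "S\<inverse>" Xb \<delta> "(R \<union> B)\<inverse>" "E\<inverse>"] Xb degY y
          unfolding Yb_def by auto
      qed (use fin in auto)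
      have X': "real (card (X - Xb)) \<le> real n" "(1 - \<eta>) * real n \<le> real (card (X - Xb))"
        using Xb card fin card_mono[OF fin(1) Xb(3)] by (simp_all add: card_Diff_subset of_nat_diff algebra_simps)
      have Y': "real (card (Y - Yb)) \<le> real n" "(1 - \<eta>) * real n \<le> real (card (Y - Yb))"
        using Yb card fin card_mono[OF fin(2) Yb(3)] by (simp_all add: card_Diff_subset of_nat_diff algebra_simps)
      have s'n: "s' = ((f_bound \<delta> - \<epsilon>) / 2 + \<eta>) * real n"
        unfolding s'_def s_def by (simp add: algebra_simps)
      show False
      proof (cases "\<delta> \<le> 2 / 3")
        case True
        have "0 < (1 - \<eta>) * real n"
          using \<eta> npos by simp
        then have "X - Xb \<noteq> {}"
          using X'(2) by (metis card.empty leD of_nat_0)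
        then have "d < 2 * s'"
          by (rule split_graph_half_degree[OF G])
        moreover have "2 * s' = (\<delta> - \<epsilon> + 2 * \<eta>) * real n"
          using s(2) unfolding s'_def f(5)[OF True] by (simp add: algebra_simps)
        ultimately have "(\<delta> - 2 * \<eta>) * real n < (\<delta> - \<epsilon> + 2 * \<eta>) * real n"
          unfolding d_def by simp
        then have "\<delta> - 2 * \<eta> < \<delta> - \<epsilon> + 2 * \<eta>"
          using npos by simp
        then show False
          using \<eta> by linarith
      next
        case False
        then have big: "2 / 3 < \<delta>" by simp
        have scale: "a * real n \<le> b * real n" if "a \<le> b" for a b :: real
          using that by (intro mult_right_mono) auto
        have "2 * s' = (f_bound \<delta> - \<epsilon> + 2 * \<eta>) * real n"
          using s(2) unfolding s'_def by (simp add: algebra_simps)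
        then have "2 * s' \<le> (1 - \<eta>) * real n"
          using scale[of "f_bound \<delta> - \<epsilon> + 2 * \<eta>" "1 - \<eta>"] f(2) \<eta> by simp
        moreover have "real n - d < s'"
        proof -
          have "(1 - (\<delta> - 2 * \<eta>)) * real n < ((f_bound \<delta> - \<epsilon>) / 2 + \<eta>) * real n"
            using gap[OF big] \<eta> npos by (intro mult_strict_right_mono) auto
          then show ?thesis
            unfolding d_def s'n by (simp add: algebra_simps)
        qed
        moreover have "s' \<le> 2 * d - real n"
        proof -
          have "(f_bound \<delta> - \<epsilon>) / 2 + \<eta> \<le> 2 * (\<delta> - 2 * \<eta>) - 1"
            using f(3)[OF big] \<eta> by (simp add: field_simps)
          from scale[OF this] show ?thesis
            unfolding d_def s'n by (simp add: algebra_simps)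
        qed
        ultimately have "tight_graph (X - Xb) (Y - Yb) E \<rho> KR \<beta> KB d s' (real n)"
          unfolding tight_graph_def using G X' Y' by linarith
        then show False
          using no_tight_graph by blast
      qed
    qed
  qed
qed

section \<open>From relations back to graphs given by edge sets\<close>

lemma nbs_eq_degree:
  assumes "\<forall>e\<in>E. \<exists>x\<in>X. \<exists>y\<in>Y. e = {x, y}" "X \<inter> Y = {}" "x \<in> X"
  shows "card (nbs {(x, y)\<in>X \<times> Y. {x, y} \<in> E} Y x) = vertex_degree E x"
proof -
  have "bij_betw (\<lambda>y. {x, y}) (nbs {(x, y)\<in>X \<times> Y. {x, y} \<in> E} Y x) {e\<in>E. x \<in> e}"
  proof (rule bij_betwI')
    fix y z assume "y \<in> nbs {(x, y)\<in>X \<times> Y. {x, y} \<in> E} Y x" "z \<in> nbs {(x, y)\<in>X \<times> Y. {x, y} \<in> E} Y x"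
    then show "({x, y} = {x, z}) = (y = z)"
      by (auto simp: doubleton_eq_iff)
  next
    fix y assume "y \<in> nbs {(x, y)\<in>X \<times> Y. {x, y} \<in> E} Y x"
    then show "{x, y} \<in> {e\<in>E. x \<in> e}"
      by (auto simp: nbs_def)
  next
    fix e assume e: "e \<in> {e\<in>E. x \<in> e}"
    then obtain x' y where xy: "x' \<in> X" "y \<in> Y" "e = {x', y}"
      using assms(1) by blast
    then have "x' = x"
      using e assms(2,3) by auto
    then show "\<exists>y\<in>nbs {(x, y)\<in>X \<times> Y. {x, y} \<in> E} Y x. e = {x, y}"
      using e xy by (intro bexI[of _ y]) (auto simp: nbs_def)
  qed
  then show ?thesis
    unfolding vertex_degree_def by (rule bij_betw_same_card)
qed

lemma cycle_edges_of_cycle_list: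
  assumes C: "cycle_list (R \<union> R\<inverse>) C" and R: "\<And>x y. (x, y) \<in> R \<Longrightarrow> {x, y} \<in> F"
  shows "cycle_edges C \<subseteq> F"
proof
  fix e assume "e \<in> cycle_edges C"
  then obtain i where i: "i < length C" "e = {C ! i, C ! (Suc i mod length C)}"
    unfolding cycle_edges_def by blast
  have edge: "{u, v} \<in> F" if "(u, v) \<in> R \<union> R\<inverse>" for u v
    using that R[of u v] R[of v u] by (auto simp: insert_commute)
  show "e \<in> F"
  proof (cases "Suc i < length C")
    case True
    then have "(C ! i, C ! Suc i) \<in> cpairs C"
      unfolding cpairs_def set_zip by (auto simp: nth_tl intro!: exI[of _ i])
    then show ?thesis
      using C edge i True unfolding cycle_list_def by auto
  next
    \<comment> \<open>The index i is the last one, and the edge is the closing one from the last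
      vertex to the first.\<close>
    case False
    then have "Suc i = length C"
      using i by simp
    moreover have "C \<noteq> []"
      using i by auto
    moreover have "i = length C - 1"
      using \<open>Suc i = length C\<close> by simp
    ultimately have "C ! i = last C" "C ! (Suc i mod length C) = hd C"
      by (simp_all add: last_conv_nth hd_conv_nth)
    then show ?thesis
      using C edge i unfolding cycle_list_def by auto
  qed
qed

theorem theorem1p3:
  fixes \<delta> \<epsilon> :: real
  assumes "0 \<le> \<delta>" and "\<delta> \<le> 1" and "\<epsilon> > 0"
  shows "\<exists>n\<^sub>0::nat. \<forall>n\<ge>n\<^sub>0. \<forall>(V :: 'a set) E.
           balanced_bipartite_graph V E \<and> card V = 2 * n \<and>
           real (min_degree V E) \<ge> \<delta> * real n \<longrightarrow>
           (\<forall>E\<^sub>R E\<^sub>B. two_coloring E E\<^sub>R E\<^sub>B \<longrightarrow>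
              (\<exists>C. is_cycle E C \<and> monochromatic E\<^sub>R E\<^sub>B C \<and>
                   real (length C) \<ge> (f_bound \<delta> - \<epsilon>) * real n) \<or> \<delta> = 0)"
proof (cases "\<delta> = 0")
  case False
  then have \<delta>: "0 < \<delta>" "\<delta> \<le> 1"
    using assms by auto
  \<comment> \<open>A smaller \<epsilon> only strengthens the conclusion, so it may be shrunk to
    satisfy the hypotheses of \<open>coloured_bipartite_cycle\<close>; all terms of the minimum are
    positive because \<delta> > 0.\<close>
  define \<epsilon>' where "\<epsilon>' = min \<epsilon> (min (f_bound \<delta> / 2) (if 2 / 3 < \<delta> then f_bound \<delta> / 2 - (1 - \<delta>) else 1))"
  have \<epsilon>': "0 < \<epsilon>'" "\<epsilon>' \<le> f_bound \<delta> / 2" "2 / 3 < \<delta> \<Longrightarrow> \<epsilon>' \<le> f_bound \<delta> / 2 - (1 - \<delta>)" "\<epsilon>' \<le> \<epsilon>"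
    using assms(3) f_bound_cases[OF \<delta>] unfolding \<epsilon>'_def by auto
  obtain n0 where n0: "\<And>n (X::'a set) Y R B. n0 \<le> n \<Longrightarrow> finite X \<Longrightarrow> finite Y \<Longrightarrow> card X = n \<Longrightarrow> card Y = n \<Longrightarrow> X \<inter> Y = {} \<Longrightarrow>
     R \<subseteq> X \<times> Y \<Longrightarrow> B \<subseteq> X \<times> Y \<Longrightarrow> (\<And>x. x\<in>X \<Longrightarrow> \<delta> * real n \<le> real (card (nbs (R \<union> B) Y x))) \<Longrightarrow>
     (\<And>y. y\<in>Y \<Longrightarrow> \<delta> * real n \<le> real (card (nbs ((R \<union> B)\<inverse>) X y))) \<Longrightarrow>
     (\<exists>C. (cycle_list (R \<union> R\<inverse>) C \<or> cycle_list (B \<union> B\<inverse>) C) \<and> (f_bound \<delta> - \<epsilon>') * real n \<le> real (length C))"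
    using coloured_bipartite_cycle[OF \<delta> \<epsilon>'(1-3), where ?'a = 'a] by metis
  show ?thesis
  proof (rule exI[of _ n0], intro allI impI disjI1, elim conjE)
    fix n and V :: "'a set" and E E\<^sub>R E\<^sub>B
    assume n: "n0 \<le> n" and G: "balanced_bipartite_graph V E" and V: "card V = 2 * n"
      and deg: "\<delta> * real n \<le> real (min_degree V E)" and col: "two_coloring E E\<^sub>R E\<^sub>B"
    have finV: "finite V"
      using G unfolding balanced_bipartite_graph_def simple_graph_def by blast
    obtain X Y where XY: "X \<union> Y = V" "X \<inter> Y = {}" "card X = card Y" "\<forall>e\<in>E. \<exists>x\<in>X. \<exists>y\<in>Y. e = {x, y}"
      using G unfolding balanced_bipartite_graph_def by blast
    have fin: "finite X" "finite Y"
      using XY(1) finV by auto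
    have card: "card X = n" "card Y = n"
      using card_Un_disjoint[OF fin XY(2)] XY(1,3) V by auto
    define P where "P F = {(x, y)\<in>X \<times> Y. {x, y} \<in> F}" for F
    have PE: "P E\<^sub>R \<union> P E\<^sub>B = P E"
      using col unfolding two_coloring_def P_def by auto
    have degV: "\<delta> * real n \<le> real (vertex_degree E v)" if "v \<in> V" for v
    proof -
      have "min_degree V E \<le> vertex_degree E v"
        unfolding min_degree_def using that finV by (intro Min_le) auto
      then show ?thesis
        using deg by linarith
    qed
    have "\<exists>C. (cycle_list (P E\<^sub>R \<union> (P E\<^sub>R)\<inverse>) C \<or> cycle_list (P E\<^sub>B \<union> (P E\<^sub>B)\<inverse>) C) \<and> (f_bound \<delta> - \<epsilon>') * real n \<le> real (length C)"
    proof (rule n0[OF n fin card XY(2)])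
      fix x assume "x \<in> X"
      then show "\<delta> * real n \<le> real (card (nbs (P E\<^sub>R \<union> P E\<^sub>B) Y x))"
        unfolding PE using nbs_eq_degree[OF XY(4,2)] degV[of x] XY(1) unfolding P_def by auto
    next
      fix y assume y: "y \<in> Y"
      have E': "\<forall>e\<in>E. \<exists>y\<in>Y. \<exists>x\<in>X. e = {y, x}"
        using XY(4) by (metis insert_commute)
      have "(P E)\<inverse> = {(y, x)\<in>Y \<times> X. {y, x} \<in> E}"
        unfolding P_def by (auto simp: insert_commute)
      then show "\<delta> * real n \<le> real (card (nbs ((P E\<^sub>R \<union> P E\<^sub>B)\<inverse>) X y))"
        unfolding PE using nbs_eq_degree[OF E' _ y] degV[of y] XY(1,2) y by (auto simp: Int_commute)
    qed (auto simp: P_def)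
    then obtain C where C: "cycle_list (P E\<^sub>R \<union> (P E\<^sub>R)\<inverse>) C \<or> cycle_list (P E\<^sub>B \<union> (P E\<^sub>B)\<inverse>) C"
      "(f_bound \<delta> - \<epsilon>') * real n \<le> real (length C)"
      by blast
    have mono: "cycle_edges C \<subseteq> E\<^sub>R \<or> cycle_edges C \<subseteq> E\<^sub>B"
      using C(1) cycle_edges_of_cycle_list[of "P E\<^sub>R" C E\<^sub>R] cycle_edges_of_cycle_list[of "P E\<^sub>B" C E\<^sub>B]
      unfolding P_def by blast
    then have "cycle_edges C \<subseteq> E"
      using col unfolding two_coloring_def by blast
    then have "is_cycle E C"
      using C(1) unfolding is_cycle_def cycle_list_def by blast
    moreover have "(f_bound \<delta> - \<epsilon>) * real n \<le> (f_bound \<delta> - \<epsilon>') * real n"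
      using \<epsilon>'(4) by (intro mult_right_mono) auto
    then have "(f_bound \<delta> - \<epsilon>) * real n \<le> real (length C)"
      using C(2) by linarith
    ultimately show "\<exists>C. is_cycle E C \<and> monochromatic E\<^sub>R E\<^sub>B C \<and> real (length C) \<ge> (f_bound \<delta> - \<epsilon>) * real n"
      using mono unfolding monochromatic_def by blast
  qed
qed simp

end
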